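(* Let $\Delta>0$, let $W\subset\{(\mu,\sigma^2,\alpha_\pi,B)\in\mathbb{R}^4:\sigma^2>0,\ \alpha_\pi>1,\ B<0\}$ be a compact parameter space and $\beta_0\in W$. Let $V=(V_n)_{n\in\mathbb{N}}$ be a square-integrable integrated supOU process with grid size $\Delta$, whose mean reversion distribution $\pi$ is the law of $BR$ with $R\sim\Gamma(\alpha_\pi,1)$ and whose true parameter vector is $\beta_0$. For $\beta=(\mu,\sigma^2,\alpha_\pi,B)\in W$ and integers $h\ge 0$ put $\varphi_h:=\varphi_h(\beta):=(1-B\Delta h)^{3-\alpha_\pi}$, and define the infinite moment vector $$f_V(V,\beta)=\big(f_{\mathbb{E}}(V,\beta),\,f_{\mathrm{var}}(V,\beta),\,f_1(V,\beta),\,f_2(V,\beta),\dots\big)',$$ where $$f_{\mathbb{E}}(V,\beta)=V_1+\frac{\Delta\mu}{B(\alpha_\pi-1)},$$ $$f_{\mathrm{var}}(V,\beta)=V_1^2-\Big(\frac{\Delta\mu}{B(\alpha_\pi-1)}\Big)^2+\sigma^2\,\frac{(1-B\Delta)^{3-\alpha_\pi}-1-\Delta B(\alpha_\pi-3)}{B^3(\alpha_\pi-1)(\alpha_\pi-2)(\alpha_\pi-3)},$$ $$f_h(V,\beta)=V_1V_{1+h}-\Big(\frac{\Delta\mu}{B(\alpha_\pi-1)}\Big)^2+\frac{\sigma^2(\varphi_{h+1}-2\varphi_h+\varphi_{h-1})}{2B^3(\alpha_\pi-1)(\alpha_\pi-2)(\alpha_\pi-3)},\quad h\ge1$$ (for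 $\alpha_\pi\in\{2,3\}$ the fractions are understood as their limits, i.e. continuous extensions in $\alpha_\pi$). Then $\beta_0$ is asymptotically identifiable, i.e. the map $W\to\mathbb{R}^{\mathbb{N}}$, $\beta\mapsto\mathbb{E}[f_V(V,\beta)]$ (componentwise expectation) has $\beta_0$ as its unique zero.
   Context: Lévy basis: a real-valued Lévy basis on $\mathbb{R}_-\times\mathbb{R}$ ($\mathbb{R}_-$ = negative reals) is a family $\Lambda=\{\Lambda(C)\}$ of real random variables indexed by bounded Borel sets $C\subset\mathbb{R}_-\times\mathbb{R}$, such that each $\Lambda(C)$ is infinitely divisible, the values on pairwise disjoint sets are independent, and $\Lambda$ is a.s. countably additive on pairwise disjoint sets whose union is bounded. It has generating quadruple $(\gamma,\Sigma,\nu,\pi)$ if $\mathbb{E}(e^{iu\Lambda(C)})=\exp(\phi(u)\Pi(C))$ with $\Pi=\pi\times\lambda$ ($\pi$ a probability measure on $\mathbb{R}_-$, $\lambda$ Lebesgue measure) and $\phi(u)=iu\gamma-\tfrac12\Sigma u^2+\int_{\mathbb{R}}(e^{iux}-1-iux1_{\{|x|\le1\}})\nu(dx)$. The underlying Lévy process is $L_t=\Lambda(\mathbb{R}_-\times(0,t])$, $t\ge0$, with $\mu=\mathbb{E}[L_1]$, $\sigma^2=\operatorname{var}(L_1)$. Integrated supOU process: let $X_t=\int_{\mathbb{R}_-}\int_{-\infty}^te^{A(t-s)}\Lambda(dA,ds)$ be a supOU process (with $\int_{|x|>1}\log|x|\,\nu(dx)<\infty$, $-\int_{\mathbb{R}_-}\frac1A\pi(dA)<\infty$)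 with generating quadruple $(\gamma,0,\nu,\pi)$ such that $\gamma-\int_{|x|\le1}x\,\nu(dx)\ge0$, $\int_{|x|\le1}|x|\nu(dx)<\infty$, $\nu(\mathbb{R}_-)=0$. Then $V_n=\int_{(n-1)\Delta}^{n\Delta}X_s\,ds$, $n\in\mathbb{N}$. If $\int_{x>1}x^2\nu(dx)<\infty$, then $V$ is stationary and square-integrable, and it is known that $\mathbb{E}(V_1)=-\Delta\mu\int_{\mathbb{R}_-}\frac1A\pi(dA)$, $\operatorname{var}(V_1)=-\sigma^2\int_{\mathbb{R}_-}\frac1{A^2}\big(\frac{e^{A\Delta}}A-\frac1A-\Delta\big)\pi(dA)$, $\operatorname{cov}(V_{h+1},V_1)=-\sigma^2\int_{\mathbb{R}_-}\frac1{2A^3}\big(e^{A\Delta(h+1)}-2e^{A\Delta h}+e^{A\Delta(h-1)}\big)\pi(dA)$ for $h\ge1$. "True parameter vector $\beta_0$" means that $V$ is generated with $(\mu,\sigma^2,\alpha_\pi,B)=\beta_0$. *)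

theory Defs
  imports "HOL-Probability.Probability"
begin

section \<open>Levy bases\<close>

text \<open>The index space is \<open>(-\<infinity>,0) \<times> \<real>\<close>, realised as a subset of \<open>real \<times> real\<close>.\<close>

definition index_space :: "(real \<times> real) set" where
  "index_space = {..<0} \<times> UNIV"

definition bounded_borel :: "(real \<times> real) set set" where
  "bounded_borel = {C. C \<in> sets borel \<and> bounded C \<and> C \<subseteq> index_space}"

definition infinitely_divisible :: "real measure \<Rightarrow> bool" where
  "infinitely_divisible D \<longleftrightarrow>
     (\<forall>n\<ge>1. \<exists>Q. prob_space Q \<and> sets Q = sets borel \<and>
        D = distr (Pi\<^sub>M {..<n::nat} (\<lambda>_. Q)) borel (\<lambda>x. \<Sum>i<n. x i))"

text \<open>Independence of the values on finitely many disjoint sets is the case of a sequence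
  \<open>C\<close> that is eventually empty.\<close>

definition levy_basis :: "'a measure \<Rightarrow> ((real \<times> real) set \<Rightarrow> 'a \<Rightarrow> real) \<Rightarrow> bool" where
  "levy_basis M \<Lambda> \<longleftrightarrow>
     prob_space M \<and>
     (\<forall>C\<in>bounded_borel. \<Lambda> C \<in> borel_measurable M \<and> infinitely_divisible (distr M borel (\<Lambda> C))) \<and>
     (\<forall>C :: nat \<Rightarrow> (real \<times> real) set. range C \<subseteq> bounded_borel \<and> disjoint_family C \<longrightarrow>
        prob_space.indep_vars M (\<lambda>_. borel) (\<lambda>i. \<Lambda> (C i)) UNIV) \<and>
     (\<forall>C :: nat \<Rightarrow> (real \<times> real) set.
        range C \<subseteq> bounded_borel \<and> disjoint_family C \<and> bounded (\<Union>i. C i) \<longrightarrow>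
        (AE \<omega> in M. (\<lambda>i. \<Lambda> (C i) \<omega>) sums \<Lambda> (\<Union>i. C i) \<omega>))"

definition levy_measure :: "real measure \<Rightarrow> bool" where
  "levy_measure \<nu> \<longleftrightarrow>
     sets \<nu> = sets borel \<and> emeasure \<nu> {0} = 0 \<and> (\<integral>\<^sup>+x. ennreal (min 1 (x\<^sup>2)) \<partial>\<nu>) < \<infinity>"

definition levy_exponent :: "real \<Rightarrow> real \<Rightarrow> real measure \<Rightarrow> real \<Rightarrow> complex" where
  "levy_exponent \<gamma> S \<nu> u =
     \<i> * of_real (u * \<gamma>) - of_real (S * u\<^sup>2 / 2)
     + (CLINT x|\<nu>. iexp (u * x) - 1 - \<i> * of_real (u * x * indicator {x. \<bar>x\<bar> \<le> 1} x))"

definition generating_quadruple ::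
  "'a measure \<Rightarrow> ((real \<times> real) set \<Rightarrow> 'a \<Rightarrow> real) \<Rightarrow>
   real \<Rightarrow> real \<Rightarrow> real measure \<Rightarrow> real measure \<Rightarrow> bool" where
  "generating_quadruple M \<Lambda> \<gamma> S \<nu> \<pi> \<longleftrightarrow>
     S \<ge> 0 \<and> levy_measure \<nu> \<and>
     prob_space \<pi> \<and> sets \<pi> = sets borel \<and> emeasure \<pi> {0..} = 0 \<and>
     (\<forall>C\<in>bounded_borel. \<forall>u. char (distr M borel (\<Lambda> C)) u =
        exp (levy_exponent \<gamma> S \<nu> u * of_real (measure (\<pi> \<Otimes>\<^sub>M lborel) C)))"

section \<open>Integration with respect to a Levy basis\<close>

definition tendsto_in_prob ::
  "'a measure \<Rightarrow> (nat \<Rightarrow> 'a \<Rightarrow> real) \<Rightarrow> ('a \<Rightarrow> real) \<Rightarrow> bool" where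
  "tendsto_in_prob M Y Z \<longleftrightarrow>
     (\<forall>\<epsilon>>0. (\<lambda>n. measure M {\<omega> \<in> space M. \<bar>Y n \<omega> - Z \<omega>\<bar> > \<epsilon>}) \<longlonglongrightarrow> 0)"

definition levy_simple :: "(real \<times> real \<Rightarrow> real) \<Rightarrow> bool" where
  "levy_simple f \<longleftrightarrow>
     f \<in> borel_measurable borel \<and> finite (range f) \<and> {z. f z \<noteq> 0} \<in> bounded_borel"

definition levy_simple_integral ::
  "((real \<times> real) set \<Rightarrow> 'a \<Rightarrow> real) \<Rightarrow> (real \<times> real \<Rightarrow> real) \<Rightarrow> (real \<times> real) set \<Rightarrow> 'a \<Rightarrow> real" where
  "levy_simple_integral \<Lambda> f A \<omega> = (\<Sum>y\<in>range f - {0}. y * \<Lambda> (A \<inter> f -` {y}) \<omega>)"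

text \<open>\<open>has_levy_integral M \<Lambda> P f Y\<close>: the function \<open>f\<close> is \<open>\<Lambda>\<close>-integrable in the sense of
  Rajput and Rosinski, with control measure \<open>P\<close> up to null sets, and \<open>Y\<close> is a version of
  \<open>\<integral> f d\<Lambda>\<close>.\<close>

definition has_levy_integral ::
  "'a measure \<Rightarrow> ((real \<times> real) set \<Rightarrow> 'a \<Rightarrow> real) \<Rightarrow> (real \<times> real) measure \<Rightarrow>
   (real \<times> real \<Rightarrow> real) \<Rightarrow> ('a \<Rightarrow> real) \<Rightarrow> bool" where
  "has_levy_integral M \<Lambda> P f Y \<longleftrightarrow>
     f \<in> borel_measurable borel \<and> Y \<in> borel_measurable M \<and>
     (\<exists>F :: nat \<Rightarrow> real \<times> real \<Rightarrow> real.
        (\<forall>n. levy_simple (F n)) \<and>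
        (AE z in P. (\<lambda>n. F n z) \<longlonglongrightarrow> f z) \<and>
        (\<forall>A\<in>sets borel. A \<subseteq> index_space \<longrightarrow>
           (\<exists>Z\<in>borel_measurable M. tendsto_in_prob M (\<lambda>n. levy_simple_integral \<Lambda> (F n) A) Z)) \<and>
        tendsto_in_prob M (\<lambda>n. levy_simple_integral \<Lambda> (F n) index_space) Y)"

text \<open>The set \<open>(-\<infinity>,0) \<times> (0,t]\<close> is unbounded, so \<open>\<Lambda>\<close> of it is understood as
  the \<open>\<Lambda>\<close>-integral of its indicator function.\<close>

definition underlying_levy_process ::
  "'a measure \<Rightarrow> ((real \<times> real) set \<Rightarrow> 'a \<Rightarrow> real) \<Rightarrow> real measure \<Rightarrow> (real \<Rightarrow> 'a \<Rightarrow> real) \<Rightarrow> bool" where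
  "underlying_levy_process M \<Lambda> \<pi> L \<longleftrightarrow>
     (\<forall>t\<ge>0. has_levy_integral M \<Lambda> (\<pi> \<Otimes>\<^sub>M lborel) (indicator ({..<0} \<times> {0<..t})) (L t))"

section \<open>SupOU and integrated supOU processes\<close>

definition supOU_kernel :: "real \<Rightarrow> real \<times> real \<Rightarrow> real" where
  "supOU_kernel t = (\<lambda>(a, s). if a < 0 \<and> s \<le> t then exp (a * (t - s)) else 0)"

definition supOU_process ::
  "'a measure \<Rightarrow> ((real \<times> real) set \<Rightarrow> 'a \<Rightarrow> real) \<Rightarrow>
   real \<Rightarrow> real \<Rightarrow> real measure \<Rightarrow> real measure \<Rightarrow> (real \<Rightarrow> 'a \<Rightarrow> real) \<Rightarrow> bool" where
  "supOU_process M \<Lambda> \<gamma> S \<nu> \<pi> X \<longleftrightarrow>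
     levy_basis M \<Lambda> \<and> generating_quadruple M \<Lambda> \<gamma> S \<nu> \<pi> \<and>
     set_integrable \<nu> {x. \<bar>x\<bar> > 1} (\<lambda>x. ln \<bar>x\<bar>) \<and>
     integrable \<pi> (\<lambda>a. 1 / a) \<and>
     (\<forall>t. has_levy_integral M \<Lambda> (\<pi> \<Otimes>\<^sub>M lborel) (supOU_kernel t) (X t))"

text \<open>The integrals \<open>\<integral> X\<^sub>s ds\<close> are formed path by path, from a jointly measurable version of
  \<open>X\<close> with locally integrable paths. Only the values \<open>V n\<close> with \<open>n \<ge> 1\<close> matter.\<close>

definition integrated_supOU ::
  "'a measure \<Rightarrow> ((real \<times> real) set \<Rightarrow> 'a \<Rightarrow> real) \<Rightarrow>
   real \<Rightarrow> real measure \<Rightarrow> real measure \<Rightarrow> real \<Rightarrow> (nat \<Rightarrow> 'a \<Rightarrow> real) \<Rightarrow> bool" where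
  "integrated_supOU M \<Lambda> \<gamma> \<nu> \<pi> \<Delta> V \<longleftrightarrow>
     set_integrable \<nu> {x. \<bar>x\<bar> \<le> 1} (\<lambda>x. \<bar>x\<bar>) \<and>
     \<gamma> - (LINT x:{x. \<bar>x\<bar> \<le> 1}|\<nu>. x) \<ge> 0 \<and>
     emeasure \<nu> {..<0} = 0 \<and>
     (\<exists>X. supOU_process M \<Lambda> \<gamma> 0 \<nu> \<pi> X \<and>
          (\<lambda>(s, \<omega>). X s \<omega>) \<in> borel_measurable (borel \<Otimes>\<^sub>M M) \<and>
          (AE \<omega> in M. \<forall>a b. set_integrable lborel {a..b} (\<lambda>s. X s \<omega>)) \<and>
          (\<forall>n\<ge>1. V n \<in> borel_measurable M \<and>
             (AE \<omega> in M. V n \<omega> = (LINT s:{(real n - 1) * \<Delta>..real n * \<Delta>}|lborel. X s \<omega>))))"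

definition square_integrable :: "'a measure \<Rightarrow> ('a \<Rightarrow> real) \<Rightarrow> bool" where
  "square_integrable M Y \<longleftrightarrow> Y \<in> borel_measurable M \<and> integrable M (\<lambda>\<omega>. (Y \<omega>)\<^sup>2)"

definition gamma_distribution :: "real \<Rightarrow> real measure" where
  "gamma_distribution \<alpha> =
     density lborel (\<lambda>x. ennreal (if x > 0 then x powr (\<alpha> - 1) * exp (- x) / Gamma \<alpha> else 0))"

definition mean_reversion_law :: "real \<Rightarrow> real \<Rightarrow> real measure" where
  "mean_reversion_law \<alpha> B = distr (gamma_distribution \<alpha>) borel (\<lambda>r. B * r)"

text \<open>Parameter vectors are quadruples \<open>(\<mu>, \<sigma>\<^sup>2, \<alpha>, B)\<close>; \<open>s2\<close> stands for \<open>\<sigma>\<^sup>2\<close>.\<close>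

type_synonym param = "real \<times> real \<times> real \<times> real"

definition true_parameter ::
  "'a measure \<Rightarrow> (real \<Rightarrow> 'a \<Rightarrow> real) \<Rightarrow> real measure \<Rightarrow> param \<Rightarrow> bool" where
  "true_parameter M L \<pi> = (\<lambda>(\<mu>, s2, \<alpha>, B).
     square_integrable M (L 1) \<and>
     prob_space.expectation M (L 1) = \<mu> \<and>
     prob_space.variance M (L 1) = s2 \<and>
     \<pi> = mean_reversion_law \<alpha> B)"

section \<open>The moment vector and asymptotic identifiability\<close>

text \<open>Continuous extension of a function of \<open>\<alpha>\<close> to the removable singularities 2 and 3.\<close>

definition cont_ext :: "(real \<Rightarrow> real) \<Rightarrow> real \<Rightarrow> real" where
  "cont_ext g \<alpha> = (if \<alpha> \<in> {2, 3} then Lim (at \<alpha>) g else g \<alpha>)"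

definition phi :: "real \<Rightarrow> real \<Rightarrow> real \<Rightarrow> nat \<Rightarrow> real" where
  "phi \<Delta> \<alpha> B h = (1 - B * \<Delta> * real h) powr (3 - \<alpha>)"

definition f_mean :: "real \<Rightarrow> (nat \<Rightarrow> real) \<Rightarrow> param \<Rightarrow> real" where
  "f_mean \<Delta> v = (\<lambda>(\<mu>, s2, \<alpha>, B). v 1 + \<Delta> * \<mu> / (B * (\<alpha> - 1)))"

definition f_var :: "real \<Rightarrow> (nat \<Rightarrow> real) \<Rightarrow> param \<Rightarrow> real" where
  "f_var \<Delta> v = (\<lambda>(\<mu>, s2, \<alpha>, B).
     (v 1)\<^sup>2 - (\<Delta> * \<mu> / (B * (\<alpha> - 1)))\<^sup>2
     + s2 * cont_ext (\<lambda>a. ((1 - B * \<Delta>) powr (3 - a) - 1 - \<Delta> * B * (a - 3))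
                          / (B ^ 3 * (a - 1) * (a - 2) * (a - 3))) \<alpha>)"

definition f_cov :: "real \<Rightarrow> (nat \<Rightarrow> real) \<Rightarrow> nat \<Rightarrow> param \<Rightarrow> real" where
  "f_cov \<Delta> v h = (\<lambda>(\<mu>, s2, \<alpha>, B).
     v 1 * v (1 + h) - (\<Delta> * \<mu> / (B * (\<alpha> - 1)))\<^sup>2
     + cont_ext (\<lambda>a. s2 * (phi \<Delta> a B (h + 1) - 2 * phi \<Delta> a B h + phi \<Delta> a B (h - 1))
                     / (2 * B ^ 3 * (a - 1) * (a - 2) * (a - 3))) \<alpha>)"

text \<open>Entry 0 is the mean component, entry 1 the variance component, and entry \<open>h + 1\<close> the
  component \<open>f\<^sub>h\<close> for \<open>h \<ge> 1\<close>.\<close>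

definition f_V :: "real \<Rightarrow> (nat \<Rightarrow> real) \<Rightarrow> param \<Rightarrow> nat \<Rightarrow> real" where
  "f_V \<Delta> v \<beta> k =
     (if k = 0 then f_mean \<Delta> v \<beta> else if k = 1 then f_var \<Delta> v \<beta> else f_cov \<Delta> v (k - 1) \<beta>)"

definition asymptotically_identifiable ::
  "'p set \<Rightarrow> ('p \<Rightarrow> nat \<Rightarrow> real) \<Rightarrow> 'p \<Rightarrow> bool" where
  "asymptotically_identifiable W G \<beta>\<^sub>0 \<longleftrightarrow> {\<beta> \<in> W. G \<beta> = (\<lambda>_. 0)} = {\<beta>\<^sub>0}"

end

theory Submission
  imports Defs "HOL-Real_Asymp.Real_Asymp"
begin

text \<open>If \<open>Y\<close> is the \<open>\<Lambda>\<close>-integral of \<open>f\<close>, then the characteristic function of \<open>Y\<close> is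
  \<open>exp (\<integral> \<phi> (u f(z)) \<Pi>(dz))\<close> for small \<open>u\<close>: the exponents of the approximating simple integrals
  converge on every Borel set, so the Vitali--Hahn--Saks theorem allows passing to the limit under the
  integral. Expanding to second order gives the first two moments of \<open>Y\<close> from those of \<open>L\<^sub>1\<close>, and
  polarization and Fubini turn this into the mean of \<open>V\<^sub>1\<close> and
  \<open>cov(V\<^sub>1, V\<^bsub>1+h\<^esub>) = \<sigma>\<^sup>2 / (2 b (\<alpha> - 1)) \<integral>\<integral> (1 + b \<bar>t - s\<bar>)\<^bsup>1-\<alpha>\<^esup> dt ds\<close> with \<open>b = - B\<close>, where \<open>s\<close> runs
  over \<open>[0, \<Delta>]\<close> and \<open>t\<close> over \<open>[h \<Delta>, (h + 1) \<Delta>]\<close>.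
  As \<open>h \<rightarrow> \<infinity>\<close> these autocovariances decay like \<open>\<sigma>\<^sup>2 / (2 b (\<alpha> - 1)) b\<^bsup>1-\<alpha>\<^esup> \<Delta>\<^sup>2 (\<Delta> h)\<^bsup>1-\<alpha>\<^esup>\<close>, which determines
  \<open>\<alpha>\<close> and the coefficient \<open>\<sigma>\<^sup>2 / (2 b (\<alpha> - 1)) b\<^bsup>1-\<alpha>\<^esup>\<close>. Given these two, a single autocovariance is strictly
  monotone in \<open>b\<close>, and finally the mean determines \<open>\<mu>\<close>.\<close>

section \<open>Setwise convergence of densities\<close>

text \<open>A \<open>\<Lambda>\<close>-integral is given only as a limit in probability, so neither
  integrability nor moments can be read off its definition; everything passes through characteristic
  functions. There, \<open>F n\<close> converges without a majorant, and an exponent can be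
  recovered only where a branch of the logarithm can be followed. The limits over all Borel sets
  replace the majorant, and the branch restricts the formula to small \<open>u\<close>, which is
  enough for an expansion at 0. The moments of \<open>L 1\<close> and of \<open>X t\<close> are
  linked through \<open>levy_mean\<close> and \<open>levy_variance\<close>, which depend on
  \<open>\<gamma>\<close> and \<open>\<nu>\<close> alone. At \<alpha> equal to 2 or 3 the
  antiderivatives become logarithms. These cases are never computed: \<open>memory_integral\<close>
  is continuous in the exponent and represents the fractions and their extensions alike, with the
  variance as its lag 0. The monotonicity in \<open>b\<close> rests on \<open>b powr (a - 1) * (1 +
  b * w) powr (1 - a) = (1 / b + w) powr (1 - a)\<close>: once the leading coefficient is fixed,
  \<open>b\<close> enters only as a shift.\<close>

text \<open>A gliding hump: since \<open>k n \<longlonglongrightarrow> 0\<close> almost everywhere, the sets \<open>E m\<close> on which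
  \<open>\<bar>k n\<bar>\<close> stays below an integrable weight for \<open>n \<ge> m\<close> exhaust the space, so infinitely many
  \<open>k n\<close> carry most of their \<open>L\<^sup>1\<close> mass on pairwise disjoint sets.\<close>

lemma (in sigma_finite_measure) setwise_null_imp_L1_null:
  fixes k :: "nat \<Rightarrow> 'a \<Rightarrow> real"
  assumes int: "\<And>n. integrable M (k n)"
    and ae: "AE x in M. (\<lambda>n. k n x) \<longlonglongrightarrow> 0"
    and setwise: "\<And>A. A \<in> sets M \<Longrightarrow> (\<lambda>n. \<integral>x. indicator A x * k n x \<partial>M) \<longlonglongrightarrow> 0"
  shows "(\<lambda>n. \<integral>x. \<bar>k n x\<bar> \<partial>M) \<longlonglongrightarrow> 0"
proof (rule ccontr)
  assume "\<not> ?thesis"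
  then obtain \<epsilon> where \<epsilon>: "\<epsilon> > 0"
      and "\<not> (\<forall>\<^sub>F n in sequentially. dist (\<integral>x. \<bar>k n x\<bar> \<partial>M) 0 < \<epsilon>)"
    unfolding tendsto_iff by blast
  then have large: "\<exists>n\<ge>N. (\<integral>x. \<bar>k n x\<bar> \<partial>M) \<ge> \<epsilon>" for N
    by (auto simp: eventually_sequentially not_less)
  \<comment> \<open>Sigma-finiteness supplies an integrable weight that is positive everywhere: a
    null sequence eventually falls below it, and it serves as the majorant on
    \<open>E m\<close>.\<close>
  obtain h where h: "h \<in> borel_measurable M" "integral\<^sup>N M h \<noteq> \<infinity>" "\<And>x. x \<in> space M \<Longrightarrow> 0 < h x \<and> h x < \<infinity>"
    using Ex_finite_integrable_function by blast
  define w where "w x = enn2real (h x)" for x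
  have w: "integrable M w"
  proof (rule integrableI_nonneg)
    show "(\<integral>\<^sup>+ x. ennreal (w x) \<partial>M) < \<infinity>"
      using h by (subst nn_integral_cong[where v = h]) (auto simp: w_def less_top)
  qed (use h(1) in \<open>auto simp: w_def[abs_def]\<close>)
  have w_pos: "w x > 0" if "x \<in> space M" for x
    using h(3)[OF that] by (simp add: w_def enn2real_positive_iff)
  define E where "E m = {x \<in> space M. \<forall>n\<ge>m. \<bar>k n x\<bar> \<le> w x}" for m
  have [measurable]: "k n \<in> borel_measurable M" "w \<in> borel_measurable M" for n
    using int w by auto
  have [measurable]: "E m \<in> sets M" for m
    unfolding E_def by measurable
  have E_mono: "m \<le> m' \<Longrightarrow> E m \<subseteq> E m'" for m m'
    by (auto simp: E_def)
  have ev: "AE x in M. eventually (\<lambda>m. x \<in> E m) sequentially"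
    using ae AE_space
  proof eventually_elim
    case (elim x)
    from tendsto_rabs_zero[OF elim(1)] have "\<forall>\<^sub>F n in sequentially. \<bar>k n x\<bar> < w x"
      using w_pos[OF elim(2)] by (rule order_tendstoD(2))
    then obtain N where N: "\<And>n. n \<ge> N \<Longrightarrow> \<bar>k n x\<bar> < w x"
      by (auto simp: eventually_sequentially)
    have "x \<in> E m" if "m \<ge> N" for m
      using elim(2) that order.trans[of N m] unfolding E_def by (blast intro: less_imp_le N)
    then show ?case
      by (auto simp: eventually_sequentially)
  qed
  have T1: "(\<lambda>n. \<integral>x. indicator (E m) x * \<bar>k n x\<bar> \<partial>M) \<longlonglongrightarrow> 0" for m
  proof (rule LIMSEQ_offset[where k = m])
    have "(\<lambda>n. \<integral>x. indicator (E m) x * \<bar>k (n + m) x\<bar> \<partial>M) \<longlonglongrightarrow> (\<integral>x. 0 \<partial>M)"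
    proof (rule integral_dominated_convergence[where w = w])
      show "AE x in M. (\<lambda>n. indicator (E m) x * \<bar>k (n + m) x\<bar>) \<longlonglongrightarrow> 0"
        using ae
      proof eventually_elim
        case (elim x)
        then show ?case
          by (intro tendsto_mult_right_zero tendsto_rabs_zero LIMSEQ_ignore_initial_segment)
      qed
      show "AE x in M. norm (indicator (E m) x * \<bar>k (n + m) x\<bar>) \<le> w x" for n
        using w_pos by (intro AE_I2) (auto simp: E_def indicator_def less_imp_le)
    qed (use w in auto)
    then show "(\<lambda>n. \<integral>x. indicator (E m) x * \<bar>k (n + m) x\<bar> \<partial>M) \<longlonglongrightarrow> 0" by simp
  qed
  have T2: "(\<lambda>m. \<integral>x. indicator (space M - E m) x * \<bar>k n x\<bar> \<partial>M) \<longlonglongrightarrow> 0" for n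
  proof -
    have "(\<lambda>m. \<integral>x. indicator (space M - E m) x * \<bar>k n x\<bar> \<partial>M) \<longlonglongrightarrow> (\<integral>x. 0 \<partial>M)"
    proof (rule integral_dominated_convergence[where w = "\<lambda>x. \<bar>k n x\<bar>"])
      show "AE x in M. (\<lambda>m. indicator (space M - E m) x * \<bar>k n x\<bar>) \<longlonglongrightarrow> 0"
        using ev
      proof eventually_elim
        case (elim x)
        then show ?case
          by (intro tendsto_eventually) (auto elim!: eventually_mono)
      qed
    qed (use int in \<open>auto simp: indicator_def\<close>)
    then show ?thesis by simp
  qed
  \<comment> \<open>The order of choice matters: \<open>n\<close> comes first, with little mass of
    \<open>k n\<close> on the given \<open>E m0\<close> (by \<open>T1\<close>), and then
    \<open>m\<close>, with little mass of this \<open>k n\<close> off \<open>E m\<close> (by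
    \<open>T2\<close>). What is left sits on \<open>E m - E m0\<close>.\<close>
  have step: "\<exists>n m. n \<ge> j \<and> m \<ge> m0 \<and> (\<integral>x. \<bar>k n x\<bar> \<partial>M) \<ge> \<epsilon> \<and>
      (\<integral>x. indicator (space M - E m) x * \<bar>k n x\<bar> \<partial>M) < \<epsilon> / 8 \<and>
      (\<integral>x. indicator (E m0) x * \<bar>k n x\<bar> \<partial>M) < \<epsilon> / 8" for j m0 :: nat
  proof -
    obtain N where N: "\<And>n. n \<ge> N \<Longrightarrow> (\<integral>x. indicator (E m0) x * \<bar>k n x\<bar> \<partial>M) < \<epsilon> / 8"
      using order_tendstoD(2)[OF T1[of m0], of "\<epsilon> / 8"] \<epsilon> by (auto simp: eventually_sequentially)
    obtain n where n: "n \<ge> max j N" "(\<integral>x. \<bar>k n x\<bar> \<partial>M) \<ge> \<epsilon>"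
      using large by blast
    obtain N' where N': "\<And>m. m \<ge> N' \<Longrightarrow> (\<integral>x. indicator (space M - E m) x * \<bar>k n x\<bar> \<partial>M) < \<epsilon> / 8"
      using order_tendstoD(2)[OF T2[of n], of "\<epsilon> / 8"] \<epsilon> by (auto simp: eventually_sequentially)
    show ?thesis
      using N[of n] n N'[of "max m0 N'"] by (intro exI[of _ n] exI[of _ "max m0 N'"]) auto
  qed
  let ?P = "\<lambda>j p. fst p \<ge> j \<and> (\<integral>x. \<bar>k (fst p) x\<bar> \<partial>M) \<ge> \<epsilon> \<and>
      (\<integral>x. indicator (space M - E (snd p)) x * \<bar>k (fst p) x\<bar> \<partial>M) < \<epsilon> / 8"
  let ?Q = "\<lambda>j p p'. snd p \<le> snd p' \<and> (\<integral>x. indicator (E (snd p)) x * \<bar>k (fst p') x\<bar> \<partial>M) < \<epsilon> / 8"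
  have "\<exists>f :: nat \<Rightarrow> nat \<times> nat. \<forall>j. ?P j (f j) \<and> ?Q j (f j) (f (Suc j))"
  proof (rule dependent_nat_choice)
    obtain n m where "n \<ge> 0 \<and> m \<ge> 0 \<and> (\<integral>x. \<bar>k n x\<bar> \<partial>M) \<ge> \<epsilon> \<and>
      (\<integral>x. indicator (space M - E m) x * \<bar>k n x\<bar> \<partial>M) < \<epsilon> / 8"
      using step[of 0 0] by blast
    then show "\<exists>p. ?P 0 p"
      by (intro exI[of _ "(n, m)"]) simp
    fix p j
    obtain n m where "n \<ge> Suc j \<and> m \<ge> snd p \<and> (\<integral>x. \<bar>k n x\<bar> \<partial>M) \<ge> \<epsilon> \<and>
      (\<integral>x. indicator (space M - E m) x * \<bar>k n x\<bar> \<partial>M) < \<epsilon> / 8 \<and>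
      (\<integral>x. indicator (E (snd p)) x * \<bar>k n x\<bar> \<partial>M) < \<epsilon> / 8"
      using step[of "Suc j" "snd p"] by blast
    then show "\<exists>p'. ?P (Suc j) p' \<and> ?Q j p p'"
      by (intro exI[of _ "(n, m)"]) simp
  qed
  then obtain f where f: "\<And>j. ?P j (f j)" "\<And>j. ?Q j (f j) (f (Suc j))"
    by blast
  define m where "m j = snd (f j)" for j
  \<comment> \<open>The index is shifted: \<open>f (Suc j)\<close> was chosen against
    \<open>E (m j)\<close>, so \<open>k (n j)\<close> carries its mass on \<open>D j\<close>,
    between \<open>m j\<close> and \<open>m (Suc j)\<close>.\<close>
  define n where "n j = fst (f (Suc j))" for j
  define D where "D j = E (m (Suc j)) - E (m j)" for j
  have m_mono: "i \<le> j \<Longrightarrow> m i \<le> m j" for i j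
    by (rule lift_Suc_mono_le[of m]) (simp add: m_def f(2))
  have disj: "i = j" if "x \<in> D i" "x \<in> D j" for x i j
  proof (rule ccontr)
    assume "i \<noteq> j"
    then consider "Suc i \<le> j" | "Suc j \<le> i" by linarith
    then show False
      using that E_mono[OF m_mono, of "Suc i" j] E_mono[OF m_mono, of "Suc j" i]
      by cases (auto simp: D_def)
  qed
  \<comment> \<open>Two fixed sets collect the signs on all humps at once; integrating over
    \<open>A\<close> minus \<open>A'\<close> recovers the absolute mass of \<open>k (n j)\<close> on
    \<open>D j\<close>.\<close>
  define A where "A = (\<Union>j. {x \<in> D j. k (n j) x > 0})"
  define A' where "A' = (\<Union>j. {x \<in> D j. k (n j) x < 0})"
  have [measurable]: "D j \<in> sets M" for j
    by (auto simp: D_def)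
  have D_space: "D j \<subseteq> space M" for j
    by (auto simp: D_def E_def)
  have *: "{x \<in> D j. k (n j) x > 0} = D j \<inter> {x \<in> space M. k (n j) x > 0}"
     "{x \<in> D j. k (n j) x < 0} = D j \<inter> {x \<in> space M. k (n j) x < 0}" for j
    using D_space by auto
  have [measurable]: "A \<in> sets M" "A' \<in> sets M"
    unfolding A_def A'_def * by measurable
  have int_ind: "integrable M (\<lambda>x. indicator B x * k i x)" "integrable M (\<lambda>x. indicator B x * \<bar>k i x\<bar>)"
    if "B \<in> sets M" for B i
    using that int by (auto intro!: integrable_real_mult_indicator integrable_abs simp: mult.commute[of "indicator _ _"])
  \<comment> \<open>Off \<open>D j\<close> nothing is known about \<open>A\<close> and
    \<open>A'\<close> beyond the trivial lower bound by minus the absolute value; the factor 2 below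
    produces this bound. The loss is at most
    \<open>2 * (\<epsilon> / 8 + \<epsilon> / 8) = \<epsilon> / 2\<close>.\<close>
  have gap: "(\<integral>x. indicator A x * k (n j) x \<partial>M) - (\<integral>x. indicator A' x * k (n j) x \<partial>M) \<ge> \<epsilon> / 2" for j
  proof -
    let ?k = "k (n j)"
    have "\<bar>?k x\<bar> - 2 * (indicator (E (m j)) x * \<bar>?k x\<bar> + indicator (space M - E (m (Suc j))) x * \<bar>?k x\<bar>)
        \<le> indicator A x * ?k x - indicator A' x * ?k x" if x: "x \<in> space M" for x
    proof (cases "x \<in> D j")
      case True
      then have "x \<in> A \<longleftrightarrow> ?k x > 0" "x \<in> A' \<longleftrightarrow> ?k x < 0"
        using disj unfolding A_def A'_def by blast+
      then show ?thesis by (auto simp: indicator_def)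
    next
      case False
      then have "x \<in> E (m j) \<or> x \<in> space M - E (m (Suc j))"
        using x by (auto simp: D_def)
      then show ?thesis by (auto simp: indicator_def)
    qed
    then have "(\<integral>x. \<bar>?k x\<bar> - 2 * (indicator (E (m j)) x * \<bar>?k x\<bar> + indicator (space M - E (m (Suc j))) x * \<bar>?k x\<bar>) \<partial>M)
       \<le> (\<integral>x. indicator A x * ?k x - indicator A' x * ?k x \<partial>M)"
      by (intro integral_mono Bochner_Integration.integrable_diff integrable_mult_right
          Bochner_Integration.integrable_add int_ind integrable_abs int) auto
    also have "\<dots> = (\<integral>x. indicator A x * ?k x \<partial>M) - (\<integral>x. indicator A' x * ?k x \<partial>M)"
      by (intro Bochner_Integration.integral_diff int_ind) auto
    also have "(\<integral>x. \<bar>?k x\<bar> - 2 * (indicator (E (m j)) x * \<bar>?k x\<bar> + indicator (space M - E (m (Suc j))) x * \<bar>?k x\<bar>) \<partial>M)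
      = (\<integral>x. \<bar>?k x\<bar> \<partial>M) - 2 * ((\<integral>x. indicator (E (m j)) x * \<bar>?k x\<bar> \<partial>M) + (\<integral>x. indicator (space M - E (m (Suc j))) x * \<bar>?k x\<bar> \<partial>M))"
      by (simp add: int_ind int integrable_abs)
    finally show ?thesis
      using f(1)[of "Suc j"] f(2)[of j] by (simp add: m_def n_def)
  qed
  have n_lim: "filterlim n at_top sequentially"
    by (rule filterlim_at_top_mono[OF filterlim_Suc]) (use f(1) in \<open>auto simp: n_def\<close>)
  have "(\<lambda>j. (\<integral>x. indicator A x * k (n j) x \<partial>M) - (\<integral>x. indicator A' x * k (n j) x \<partial>M)) \<longlonglongrightarrow> 0 - 0"
    by (intro tendsto_diff filterlim_compose[OF setwise n_lim]) auto
  then have "\<epsilon> / 2 \<le> 0"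
    by (intro tendsto_lowerbound[where F = sequentially]) (use gap in auto)
  with \<epsilon> show False by simp
qed

text \<open>The part of the Vitali--Hahn--Saks theorem that is needed when the densities
  also converge almost everywhere.\<close>

lemma (in sigma_finite_measure) setwise_Cauchy_imp_integral_tendsto:
  fixes h :: "nat \<Rightarrow> 'a \<Rightarrow> real"
  assumes int: "\<And>n. integrable M (h n)"
    and ae: "AE x in M. (\<lambda>n. h n x) \<longlonglongrightarrow> g x"
    and [measurable]: "g \<in> borel_measurable M"
    and setwise: "\<And>A. A \<in> sets M \<Longrightarrow> Cauchy (\<lambda>n. \<integral>x. indicator A x * h n x \<partial>M)"
  shows "integrable M g" "(\<lambda>n. \<integral>x. h n x \<partial>M) \<longlonglongrightarrow> (\<integral>x. g x \<partial>M)"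
proof -
  have [measurable]: "h n \<in> borel_measurable M" for n
    using int by auto
  \<comment> \<open>Failure of the Cauchy property in mean yields index sequences \<open>p\<close>
    and \<open>q\<close> whose differences are setwise null but not small in mean, against the
    preceding lemma.\<close>
  have L1: "\<exists>N. \<forall>p\<ge>N. \<forall>q\<ge>N. (\<integral>x. \<bar>h p x - h q x\<bar> \<partial>M) < \<epsilon>" if \<epsilon>: "\<epsilon> > 0" for \<epsilon>
  proof (rule ccontr)
    assume "\<not> ?thesis"
    then have "\<forall>N. \<exists>p q. p \<ge> N \<and> q \<ge> N \<and> (\<integral>x. \<bar>h p x - h q x\<bar> \<partial>M) \<ge> \<epsilon>"
      unfolding not_ex not_all not_imp not_less by blast
    then obtain p q where pq: "\<And>N. p N \<ge> N" "\<And>N. q N \<ge> N"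
      "\<And>N::nat. (\<integral>x. \<bar>h (p N) x - h (q N) x\<bar> \<partial>M) \<ge> \<epsilon>"
      by metis
    have lim: "filterlim p at_top sequentially" "filterlim q at_top sequentially"
      by (rule filterlim_at_top_mono[OF filterlim_ident], use pq in simp)+
    have "(\<lambda>N. \<integral>x. \<bar>h (p N) x - h (q N) x\<bar> \<partial>M) \<longlonglongrightarrow> 0"
    proof (rule setwise_null_imp_L1_null)
      show "AE x in M. (\<lambda>n. h (p n) x - h (q n) x) \<longlonglongrightarrow> 0"
        using ae
      proof eventually_elim
        case (elim x)
        show ?case
          using tendsto_diff[OF filterlim_compose[OF elim lim(1)] filterlim_compose[OF elim lim(2)]] by simp
      qed
      fix A assume A: "A \<in> sets M"
      have ii: "integrable M (\<lambda>x. indicator A x * h i x)" for i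
        using integrable_real_mult_indicator[OF A int[of i]] by (simp add: mult.commute)
      obtain l where l: "(\<lambda>n. \<integral>x. indicator A x * h n x \<partial>M) \<longlonglongrightarrow> l"
        using setwise[OF A] by (auto simp: real_Cauchy_convergent convergent_def Cauchy_convergent_iff)
      have "(\<lambda>n. (\<integral>x. indicator A x * h (p n) x \<partial>M) - (\<integral>x. indicator A x * h (q n) x \<partial>M)) \<longlonglongrightarrow> l - l"
        by (intro tendsto_diff filterlim_compose[OF l] lim)
      then show "(\<lambda>n. \<integral>x. indicator A x * (h (p n) x - h (q n) x) \<partial>M) \<longlonglongrightarrow> 0"
        by (simp add: right_diff_distrib ii)
    qed (use int in auto)
    then have "\<epsilon> \<le> 0"
      by (intro tendsto_lowerbound[where F = sequentially]) (use pq in auto)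
    with \<epsilon> show False by simp
  qed
  \<comment> \<open>Fatou's lemma in the second index replaces \<open>h n\<close> by its almost
    everywhere limit \<open>g\<close>.\<close>
  have dist: "(\<integral>\<^sup>+x. ennreal \<bar>h N x - g x\<bar> \<partial>M) \<le> ennreal \<epsilon>"
    if "\<forall>p\<ge>N. \<forall>q\<ge>N. (\<integral>x. \<bar>h p x - h q x\<bar> \<partial>M) < \<epsilon>" for \<epsilon> N
  proof -
    have "(\<integral>\<^sup>+x. ennreal \<bar>h N x - g x\<bar> \<partial>M) = (\<integral>\<^sup>+x. liminf (\<lambda>n. ennreal \<bar>h N x - h n x\<bar>) \<partial>M)"
    proof (rule nn_integral_cong_AE, use ae in eventually_elim)
      case (elim x)
      have "(\<lambda>n. ennreal \<bar>h N x - h n x\<bar>) \<longlonglongrightarrow> ennreal \<bar>h N x - g x\<bar>"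
        by (intro tendsto_ennrealI tendsto_rabs tendsto_diff tendsto_const elim)
      then show ?case by (intro lim_imp_Liminf[symmetric]) auto
    qed
    also have "\<dots> \<le> liminf (\<lambda>n. \<integral>\<^sup>+x. ennreal \<bar>h N x - h n x\<bar> \<partial>M)"
      by (rule nn_integral_liminf) simp
    also have "\<dots> \<le> limsup (\<lambda>n. \<integral>\<^sup>+x. ennreal \<bar>h N x - h n x\<bar> \<partial>M)"
      by (rule Liminf_le_Limsup) simp
    also have "\<dots> \<le> ennreal \<epsilon>"
    proof (rule Limsup_bounded)
      show "\<forall>\<^sub>F n in sequentially. (\<integral>\<^sup>+x. ennreal \<bar>h N x - h n x\<bar> \<partial>M) \<le> ennreal \<epsilon>"
        using eventually_ge_at_top[of N]
      proof eventually_elim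
        case (elim n)
        have "(\<integral>\<^sup>+x. ennreal \<bar>h N x - h n x\<bar> \<partial>M) = ennreal (\<integral>x. \<bar>h N x - h n x\<bar> \<partial>M)"
          by (intro nn_integral_eq_integral) (use int in auto)
        moreover have "(\<integral>x. \<bar>h N x - h n x\<bar> \<partial>M) \<le> \<epsilon>"
          using that[rule_format, of N n] elim by simp
        ultimately show ?case by (simp add: ennreal_leI)
      qed
    qed
    finally show ?thesis .
  qed
  obtain N0 where N0: "\<forall>p\<ge>N0. \<forall>q\<ge>N0. (\<integral>x. \<bar>h p x - h q x\<bar> \<partial>M) < 1"
    using L1[of 1] by auto
  have "integrable M (\<lambda>x. h N0 x - g x)"
    using dist[OF N0] by (intro integrableI_bounded) (auto simp: order_le_less_trans)
  from Bochner_Integration.integrable_diff[OF int[of N0] this]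
  show g: "integrable M g" by simp
  show "(\<lambda>n. \<integral>x. h n x \<partial>M) \<longlonglongrightarrow> (\<integral>x. g x \<partial>M)"
  proof (rule LIMSEQ_I)
    fix r :: real assume "r > 0"
    then obtain N where N: "\<forall>p\<ge>N. \<forall>q\<ge>N. (\<integral>x. \<bar>h p x - h q x\<bar> \<partial>M) < r / 2"
      using L1[of "r / 2"] by auto
    have "norm ((\<integral>x. h n x \<partial>M) - (\<integral>x. g x \<partial>M)) < r" if "n \<ge> N" for n
    proof -
      have "\<bar>(\<integral>x. h n x \<partial>M) - (\<integral>x. g x \<partial>M)\<bar> = \<bar>\<integral>x. h n x - g x \<partial>M\<bar>"
        using g int by simp
      also have "\<dots> \<le> (\<integral>x. \<bar>h n x - g x\<bar> \<partial>M)"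
        by (rule integral_abs_bound)
      also have "\<dots> \<le> r / 2"
      proof -
        have "ennreal (\<integral>x. \<bar>h n x - g x\<bar> \<partial>M) = (\<integral>\<^sup>+x. ennreal \<bar>h n x - g x\<bar> \<partial>M)"
          by (intro nn_integral_eq_integral[symmetric]) (use g int in auto)
        also have "\<dots> \<le> ennreal (r / 2)"
          by (rule dist) (use N that in auto)
        finally show ?thesis using \<open>r > 0\<close> by (subst (asm) ennreal_le_iff) auto
      qed
      finally show ?thesis using \<open>r > 0\<close> by simp
    qed
    then show "\<exists>N. \<forall>n\<ge>N. norm ((\<integral>x. h n x \<partial>M) - (\<integral>x. g x \<partial>M)) < r" by blast
  qed
qed

section \<open>Levy bases\<close>

locale levy_setting = prob_space M for M :: "'a measure" +
  fixes \<Lambda> :: "(real \<times> real) set \<Rightarrow> 'a \<Rightarrow> real" and \<gamma> :: real and \<nu> \<pi> :: "real measure"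
  assumes basis: "levy_basis M \<Lambda>"
    and quadruple: "generating_quadruple M \<Lambda> \<gamma> 0 \<nu> \<pi>"
begin

abbreviation control :: "(real \<times> real) measure" where
  "control \<equiv> \<pi> \<Otimes>\<^sub>M lborel"

abbreviation \<phi> :: "real \<Rightarrow> complex" where
  "\<phi> \<equiv> levy_exponent \<gamma> 0 \<nu>"

lemma sets_nu [measurable_cong]: "sets \<nu> = sets borel"
  using quadruple by (simp add: generating_quadruple_def levy_measure_def)

lemma sets_pi [measurable_cong]: "sets \<pi> = sets borel"
  using quadruple by (simp add: generating_quadruple_def)

lemma space_pi [simp]: "space \<pi> = UNIV"
  using sets_eq_imp_space_eq[OF sets_pi] by simp

lemma space_nu [simp]: "space \<nu> = UNIV"
  using sets_eq_imp_space_eq[OF sets_nu] by simp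

sublocale mean_reversion: prob_space \<pi>
  using quadruple by (simp add: generating_quadruple_def)

sublocale control: pair_sigma_finite \<pi> lborel
  by standard

lemma sets_control [measurable_cong]: "sets control = sets borel"
  by (subst borel_prod[symmetric]) (intro sets_pair_measure_cong sets_pi sets_lborel)

lemma space_control [simp]: "space control = UNIV"
  by (simp add: space_pair_measure)

lemma AE_pi_negative: "AE a in \<pi>. a < 0"
proof (rule AE_I[where N = "{0..}"])
  show "emeasure \<pi> {0..} = 0"
    using quadruple by (simp add: generating_quadruple_def)
qed (auto simp: sets_pi)

lemma bounded_borel_sets: "C \<in> bounded_borel \<Longrightarrow> C \<in> sets borel"
  by (simp add: bounded_borel_def)

lemma bounded_borel_subset:
  "C \<in> bounded_borel \<Longrightarrow> D \<in> sets borel \<Longrightarrow> D \<subseteq> C \<Longrightarrow> D \<in> bounded_borel"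
  by (auto simp: bounded_borel_def intro: bounded_subset)

lemma empty_bounded_borel: "{} \<in> bounded_borel"
  by (simp add: bounded_borel_def)

text \<open>A bounded set lies in a strip of bounded time, whose mass is the length of the time
  interval because \<pi> is a probability measure.\<close>

lemma emeasure_control_finite:
  assumes "C \<in> bounded_borel" shows "emeasure control C < \<infinity>"
proof -
  from assms obtain r where r: "\<And>x. x \<in> C \<Longrightarrow> norm x \<le> r"
    by (auto simp: bounded_borel_def bounded_iff)
  have "C \<subseteq> UNIV \<times> {-r..r}"
  proof
    fix x assume "x \<in> C"
    with r[of x] norm_snd_le[of "snd x" "fst x"] have "\<bar>snd x\<bar> \<le> r" by simp
    then show "x \<in> UNIV \<times> {-r..r}" by (cases x) auto
  qed
  moreover have "UNIV \<times> {-r..r} \<in> sets control"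
    by (auto intro!: pair_measureI simp: sets_pi)
  ultimately have "emeasure control C \<le> emeasure control (UNIV \<times> {-r..r})"
    by (intro emeasure_mono) auto
  also have "\<dots> = emeasure \<pi> UNIV * emeasure lborel {-r..r}"
    by (intro lborel.emeasure_pair_measure_Times) (auto simp: sets_pi)
  also have "\<dots> < \<infinity>"
    using mean_reversion.emeasure_space_1 by (simp add: emeasure_lborel_Icc_eq)
  finally show ?thesis .
qed

lemma basis_measurable: "C \<in> bounded_borel \<Longrightarrow> \<Lambda> C \<in> borel_measurable M"
  using basis by (auto simp: levy_basis_def)

lemma basis_indep:
  "range C \<subseteq> bounded_borel \<Longrightarrow> disjoint_family C \<Longrightarrow> indep_vars (\<lambda>_. borel) (\<lambda>i::nat. \<Lambda> (C i)) UNIV"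
  using basis by (auto simp: levy_basis_def)

lemma basis_additive:
  "range C \<subseteq> bounded_borel \<Longrightarrow> disjoint_family C \<Longrightarrow> bounded (\<Union>i. C i) \<Longrightarrow>
    AE \<omega> in M. (\<lambda>i::nat. \<Lambda> (C i) \<omega>) sums \<Lambda> (\<Union>i. C i) \<omega>"
  using basis by (auto simp: levy_basis_def)

lemma char_basis:
  "C \<in> bounded_borel \<Longrightarrow> char (distr M borel (\<Lambda> C)) u = exp (\<phi> u * of_real (measure control C))"
  using quadruple by (auto simp: generating_quadruple_def)

text \<open>A constant series converges only if its terms vanish. This permits padding finite
  families with empty sets.\<close>

lemma basis_empty: "AE \<omega> in M. \<Lambda> {} \<omega> = 0"
proof -
  have "AE \<omega> in M. (\<lambda>i::nat. \<Lambda> {} \<omega>) sums \<Lambda> (\<Union>i::nat. {}) \<omega>"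
    by (rule basis_additive) (auto simp: empty_bounded_borel disjoint_family_on_def)
  then show ?thesis
  proof eventually_elim
    case (elim \<omega>)
    then have "(\<lambda>i::nat. \<Lambda> {} \<omega>) \<longlonglongrightarrow> 0"
      by (intro summable_LIMSEQ_zero) (auto dest: sums_summable)
    then show ?case by (simp add: LIMSEQ_const_iff)
  qed
qed

text \<open>The axioms of a basis speak of sequences only; a finite family is enumerated and
  continued by empty sets.\<close>

lemma finite_family_as_sequence:
  assumes "finite I" "disjoint_family_on C I" "\<And>i. i \<in> I \<Longrightarrow> C i \<in> bounded_borel"
  obtains h n D where "bij_betw h {..<n::nat} I" "range D \<subseteq> bounded_borel" "disjoint_family D"
    "\<forall>k<n. D k = C (h k)" "\<forall>k\<ge>n. D k = {}" "(\<Union>k. D k) = (\<Union>i\<in>I. C i)"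
proof -
  obtain h where h: "bij_betw h {..<card I} I"
    using ex_bij_betw_nat_finite[OF assms(1)] by (auto simp: atLeast0LessThan)
  define D where "D k = (if k < card I then C (h k) else {})" for k
  have hI: "h k \<in> I" if "k < card I" for k
    using h that by (auto simp: bij_betw_def)
  show ?thesis
  proof (rule that[OF h, of D])
    show "range D \<subseteq> bounded_borel"
      using hI assms(3) empty_bounded_borel by (auto simp: D_def)
    show "disjoint_family D"
      unfolding disjoint_family_on_def
    proof (intro ballI impI)
      fix k l :: nat assume "k \<noteq> l"
      show "D k \<inter> D l = {}"
      proof (cases "k < card I \<and> l < card I")
        case True
        then have "h k \<noteq> h l"
          using h \<open>k \<noteq> l\<close> by (auto simp: bij_betw_def inj_on_def)
        then show ?thesis
          using True assms(2) hI by (simp add: D_def disjoint_family_on_def)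
      qed (auto simp: D_def)
    qed
    have "(\<Union>k. D k) = (\<Union>k\<in>{..<card I}. C (h k))"
      by (auto simp: D_def split: if_splits)
    also have "\<dots> = (\<Union>i\<in>h ` {..<card I}. C i)" by simp
    also have "h ` {..<card I} = I"
      using h by (simp add: bij_betw_def)
    finally show "(\<Union>k. D k) = (\<Union>i\<in>I. C i)" .
  qed (auto simp: D_def)
qed

lemma basis_finite_Union:
  assumes "finite I" "disjoint_family_on C I" "\<And>i. i \<in> I \<Longrightarrow> C i \<in> bounded_borel"
  shows "AE \<omega> in M. \<Lambda> (\<Union>i\<in>I. C i) \<omega> = (\<Sum>i\<in>I. \<Lambda> (C i) \<omega>)"
proof -
  obtain h n D where D: "bij_betw h {..<n::nat} I" "range D \<subseteq> bounded_borel" "disjoint_family D"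
    "\<forall>k<n. D k = C (h k)" "\<forall>k\<ge>n. D k = {}" "(\<Union>k. D k) = (\<Union>i\<in>I. C i)"
    using finite_family_as_sequence[OF assms] by metis
  have "bounded (\<Union>i\<in>I. C i)"
    using assms by (intro bounded_UN) (auto simp: bounded_borel_def)
  then have "AE \<omega> in M. (\<lambda>k. \<Lambda> (D k) \<omega>) sums \<Lambda> (\<Union>i\<in>I. C i) \<omega>"
    using basis_additive[OF D(2,3)] D(6) by simp
  with basis_empty show ?thesis
  proof eventually_elim
    case (elim \<omega>)
    have "(\<lambda>k. \<Lambda> (D k) \<omega>) sums (\<Sum>k<n. \<Lambda> (D k) \<omega>)"
      using elim(1) D(5) by (intro sums_finite) auto
    with elim(2) have "\<Lambda> (\<Union>i\<in>I. C i) \<omega> = (\<Sum>k<n. \<Lambda> (D k) \<omega>)"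
      by (rule sums_unique2)
    also have "\<dots> = (\<Sum>k<n. \<Lambda> (C (h k)) \<omega>)"
      by (intro sum.cong) (auto simp: D)
    also have "\<dots> = (\<Sum>i\<in>I. \<Lambda> (C i) \<omega>)"
      by (rule sum.reindex_bij_betw[OF D(1)])
    finally show ?case .
  qed
qed

text \<open>By independence the characteristic functions multiply, and a coefficient
  \<open>y i\<close> merely rescales the argument of the one of
  \<open>\<Lambda> (C i)\<close>.\<close>

lemma char_finite_sum:
  assumes "finite I" "disjoint_family_on C I" "\<And>i. i \<in> I \<Longrightarrow> C i \<in> bounded_borel"
  shows "char (distr M borel (\<lambda>\<omega>. \<Sum>i\<in>I. y i * \<Lambda> (C i) \<omega>)) u =
    exp (\<Sum>i\<in>I. \<phi> (u * y i) * of_real (measure control (C i)))"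
proof -
  obtain h n D where D: "bij_betw h {..<n::nat} I" "range D \<subseteq> bounded_borel" "disjoint_family D"
    "\<forall>k<n. D k = C (h k)" "\<forall>k\<ge>n. D k = {}" "(\<Union>k. D k) = (\<Union>i\<in>I. C i)"
    using finite_family_as_sequence[OF assms] by metis
  have D_bb: "D k \<in> bounded_borel" for k
    using D(2) by auto
  have sum_eq: "(\<Sum>i\<in>I. y i * \<Lambda> (C i) \<omega>) = (\<Sum>k<n. y (h k) * \<Lambda> (D k) \<omega>)" for \<omega>
    using sum.reindex_bij_betw[OF D(1), of "\<lambda>i. y i * \<Lambda> (C i) \<omega>"] by (simp add: D(4))
  have "indep_vars (\<lambda>_. borel) (\<lambda>k. \<Lambda> (D k)) {..<n}"
    using basis_indep[OF D(2,3)] by (rule indep_vars_subset) auto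
  then have "indep_vars (\<lambda>_. borel) (\<lambda>k \<omega>. y (h k) * \<Lambda> (D k) \<omega>) {..<n}"
    by (rule indep_vars_compose2[where Y = "\<lambda>k x. y (h k) * x"]) auto
  then have "char (distr M borel (\<lambda>\<omega>. \<Sum>k<n. y (h k) * \<Lambda> (D k) \<omega>)) u =
      (\<Prod>k<n. char (distr M borel (\<lambda>\<omega>. y (h k) * \<Lambda> (D k) \<omega>)) u)"
    by (rule char_distr_sum)
  also have "\<dots> = (\<Prod>k<n. exp (\<phi> (u * y (h k)) * of_real (measure control (D k))))"
  proof (rule prod.cong[OF refl])
    fix k
    have [measurable]: "\<Lambda> (D k) \<in> borel_measurable M"
      by (rule basis_measurable[OF D_bb])
    have "char (distr M borel (\<lambda>\<omega>. y (h k) * \<Lambda> (D k) \<omega>)) u = char (distr M borel (\<Lambda> (D k))) (u * y (h k))"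
      by (simp add: char_def integral_distr mult.assoc)
    then show "char (distr M borel (\<lambda>\<omega>. y (h k) * \<Lambda> (D k) \<omega>)) u = exp (\<phi> (u * y (h k)) * of_real (measure control (D k)))"
      by (simp only: char_basis[OF D_bb])
  qed
  also have "\<dots> = exp (\<Sum>k<n. \<phi> (u * y (h k)) * of_real (measure control (D k)))"
    by (simp add: exp_sum)
  also have "(\<Sum>k<n. \<phi> (u * y (h k)) * of_real (measure control (D k))) =
     (\<Sum>i\<in>I. \<phi> (u * y i) * of_real (measure control (C i)))"
    using sum.reindex_bij_betw[OF D(1), of "\<lambda>i. \<phi> (u * y i) * of_real (measure control (C i))"] by (simp add: D(4))
  finally show ?thesis
    by (simp only: sum_eq)
qed

section \<open>The characteristic exponent\<close>

lemma integrable_min_one_square: "integrable \<nu> (\<lambda>x. min 1 (x\<^sup>2))"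
  using quadruple
  by (intro integrableI_nonneg) (auto simp: generating_quadruple_def levy_measure_def)

text \<open>Taylor's bound \<open>(u * x)\<^sup>2 / 2\<close> handles small jumps and the trivial
  bound 2 handles large ones; \<open>2 + u\<^sup>2\<close> dominates both and is locally bounded in
  \<open>u\<close>, as needed for continuity.\<close>

lemma norm_levy_integrand_le:
  "cmod (iexp (u * x) - 1 - \<i> * of_real (u * x * indicator {x. \<bar>x\<bar> \<le> 1} x)) \<le> (2 + u\<^sup>2) * min 1 (x\<^sup>2)"
proof (cases "\<bar>x\<bar> \<le> 1")
  case True
  then have "x\<^sup>2 \<le> 1" by (simp add: abs_square_le_1)
  have "cmod (iexp (u * x) - 1 - \<i> * of_real (u * x)) \<le> \<bar>u * x\<bar>\<^sup>2 / 2"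
    using iexp_approx1[of "u * x" 1] by (simp add: algebra_simps numeral_2_eq_2)
  also have "\<dots> \<le> (2 + u\<^sup>2) * x\<^sup>2"
    by (simp add: power_mult_distrib algebra_simps)
  finally show ?thesis
    using True \<open>x\<^sup>2 \<le> 1\<close> by (simp add: min_absorb2)
next
  case False
  then have "x\<^sup>2 \<ge> 1"
    by (metis abs_square_le_1 linorder_le_cases linorder_not_le order.order_iff_strict)
  have "cmod (iexp (u * x) - 1) \<le> 2"
    using norm_triangle_ineq4[of "iexp (u * x)" 1] by simp
  also have "\<dots> \<le> 2 + u\<^sup>2" by simp
  finally show ?thesis
    using False \<open>x\<^sup>2 \<ge> 1\<close> by (simp add: min_absorb1)
qed

lemma integrable_levy_integrand:
  "complex_integrable \<nu> (\<lambda>x. iexp (u * x) - 1 - \<i> * of_real (u * x * indicator {x. \<bar>x\<bar> \<le> 1} x))"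
  by (rule Bochner_Integration.integrable_bound[OF integrable_mult_right[OF integrable_min_one_square, of "2 + u\<^sup>2"]])
     (simp_all add: order.trans[OF norm_levy_integrand_le] del: of_real_mult)

lemma phi_0 [simp]: "\<phi> 0 = 0"
  by (simp add: levy_exponent_def)

lemma integrable_one_minus_cos: "integrable \<nu> (\<lambda>x. 1 - cos (u * x))"
proof -
  have "integrable \<nu> (\<lambda>x. - Re (iexp (u * x) - 1 - \<i> * of_real (u * x * indicator {x. \<bar>x\<bar> \<le> 1} x)))"
    by (intro integrable_minus integrable_Re integrable_levy_integrand)
  then show ?thesis by (simp add: Re_exp)
qed

text \<open>Drift and compensator are purely imaginary and the Gaussian part is 0, so only the
  cosines survive in the real part.\<close>

lemma integral_one_minus_cos: "(\<integral>x. 1 - cos (u * x) \<partial>\<nu>) = - Re (\<phi> u)"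
proof -
  have "Re (\<phi> u) = (\<integral>x. Re (iexp (u * x) - 1 - \<i> * of_real (u * x * indicator {x. \<bar>x\<bar> \<le> 1} x)) \<partial>\<nu>)"
    using integral_Re[OF integrable_levy_integrand[of u]] by (simp add: levy_exponent_def)
  also have "\<dots> = - (\<integral>x. 1 - cos (u * x) \<partial>\<nu>)"
    by (subst Bochner_Integration.integral_minus[symmetric])
       (simp add: Re_exp)
  finally show ?thesis by simp
qed

lemma Re_phi_le_0: "Re (\<phi> u) \<le> 0"
proof -
  have "0 \<le> (\<integral>x. 1 - cos (u * x) \<partial>\<nu>)" by simp
  then show ?thesis by (simp only: integral_one_minus_cos neg_0_le_iff_le)
qed

lemma isCont_phi: "isCont \<phi> u"
  unfolding continuous_at_sequentially
proof safe
  fix X assume X: "X \<longlonglongrightarrow> u"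
  then obtain K where K: "\<And>n. \<bar>X n\<bar> \<le> K"
    by (metis convergent_imp_Bseq convergentI BseqE real_norm_def)
  have KX: "(X n)\<^sup>2 \<le> K\<^sup>2" for n
    using K[of n] by (simp add: abs_le_square_iff[symmetric])
  have "(\<lambda>n. CLINT x|\<nu>. iexp (X n * x) - 1 - \<i> * of_real (X n * x * indicator {x. \<bar>x\<bar> \<le> 1} x))
    \<longlonglongrightarrow> (CLINT x|\<nu>. iexp (u * x) - 1 - \<i> * of_real (u * x * indicator {x. \<bar>x\<bar> \<le> 1} x))"
  proof (rule integral_dominated_convergence[where w = "\<lambda>x. (2 + K\<^sup>2) * min 1 (x\<^sup>2)"])
    show "AE x in \<nu>. cmod (iexp (X n * x) - 1 - \<i> * of_real (X n * x * indicator {x. \<bar>x\<bar> \<le> 1} x))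
        \<le> (2 + K\<^sup>2) * min 1 (x\<^sup>2)" for n
      by (intro AE_I2 order.trans[OF norm_levy_integrand_le] mult_right_mono) (use KX in auto)
  qed (auto intro!: tendsto_intros X integrable_mult_right integrable_min_one_square)
  then show "(\<phi> \<circ> X) \<longlonglongrightarrow> \<phi> u"
    unfolding comp_def levy_exponent_def by (intro tendsto_intros X) auto
qed

lemma continuous_on_phi: "continuous_on S \<phi>"
  by (simp add: continuous_at_imp_continuous_on isCont_phi)

lemma phi_measurable [measurable]: "\<phi> \<in> borel_measurable borel"
  by (rule borel_measurable_continuous_onI[OF continuous_on_phi])

end

section \<open>Characteristic functions of Levy integrals\<close>

text \<open>The principal branch can be followed along the path because a continuous \<open>w\<close> would
  have to cross the lines \<open>\<bar>Im w\<bar> = \<pi>/2\<close>, where \<open>exp w\<close> is far from 1.\<close>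

lemma small_exponent_along_path:
  fixes w :: "real \<Rightarrow> complex"
  assumes cont: "continuous_on {-U..U} w" and "w 0 = 0" and "U \<ge> 0"
    and close: "\<And>u. u \<in> {-U..U} \<Longrightarrow> cmod (exp (w u) - 1) \<le> d" and "d < 1 / 2"
    and u: "u \<in> {-U..U}"
  shows "cmod (w u) \<le> 2 * d"
proof -
  have "\<bar>Im (w u)\<bar> < pi / 2"
  proof (rule ccontr)
    assume "\<not> ?thesis"
    then have "pi / 2 \<le> \<bar>Im (w u)\<bar>" by simp
    moreover have "connected ((\<lambda>u. \<bar>Im (w u)\<bar>) ` {-U..U})"
      by (intro connected_continuous_image continuous_intros cont connected_Icc)
    moreover have "0 \<in> (\<lambda>u. \<bar>Im (w u)\<bar>) ` {-U..U}"
      using \<open>w 0 = 0\<close> \<open>U \<ge> 0\<close> by (intro image_eqI[of _ _ 0]) auto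
    ultimately have "pi / 2 \<in> (\<lambda>u. \<bar>Im (w u)\<bar>) ` {-U..U}"
      using u by (meson connectedD_interval image_eqI pi_half_ge_zero)
    then obtain v where v: "v \<in> {-U..U}" "\<bar>Im (w v)\<bar> = pi / 2" by auto
    then have "cos (Im (w v)) = 0"
      by (metis cos_abs_real cos_pi_half)
    then have "Re (exp (w v) - 1) = -1"
      by (simp add: Re_exp)
    then have "1 \<le> cmod (exp (w v) - 1)"
      using abs_Re_le_cmod[of "exp (w v) - 1"] by simp
    with close[OF v(1)] \<open>d < 1 / 2\<close> show False by simp
  qed
  then have "Ln (exp (w u)) = w u"
    using pi_gt_zero by (intro Ln_exp) auto
  moreover have "cmod (Ln (1 + (exp (w u) - 1))) \<le> 2 * cmod (exp (w u) - 1)"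
    using close[OF u] \<open>d < 1 / 2\<close> by (intro norm_Ln_le) simp
  ultimately show ?thesis
    using close[OF u] by simp
qed

lemma norm_iexp_diff_le: "cmod (iexp a - iexp b) \<le> \<bar>a - b\<bar>" "cmod (iexp a - iexp b) \<le> 2"
proof -
  have "iexp a - iexp b = iexp b * (iexp (a - b) - 1)"
    by (simp add: right_diff_distrib exp_add[symmetric] algebra_simps)
  then have "cmod (iexp a - iexp b) = cmod (iexp (a - b) - 1)"
    by (simp add: norm_mult del: of_real_diff)
  also have "\<dots> \<le> \<bar>a - b\<bar>"
    using iexp_approx1[of "a - b" 0] by simp
  finally show "cmod (iexp a - iexp b) \<le> \<bar>a - b\<bar>" .
  show "cmod (iexp a - iexp b) \<le> 2"
    using norm_triangle_ineq4[of "iexp a" "iexp b"] by simp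
qed

text \<open>\<open>iexp\<close> is 1-Lipschitz and bounded, so the difference is small where the
  variables are close and at most 2 on an event of small probability. The estimate uses
  \<open>u\<close> only through its bound \<open>U\<close>, hence the uniformity.\<close>

lemma (in prob_space) tendsto_in_prob_char_uniform:
  assumes tendsto: "tendsto_in_prob M Y Z"
    and [measurable]: "\<And>n. Y n \<in> borel_measurable M" "Z \<in> borel_measurable M"
    and "e > 0"
  shows "\<forall>\<^sub>F n in sequentially. \<forall>u\<in>{-U..U}.
    cmod (char (distr M borel (Y n)) u - char (distr M borel Z) u) \<le> e"
proof -
  \<comment> \<open>Half of \<open>e\<close> is spent on the Lipschitz part, the other half on
    \<open>2 * (e / 4)\<close>; the summand 1 avoids division by zero at
    \<open>U = 0\<close>.\<close>
  define \<delta> where "\<delta> = e / (2 * (\<bar>U\<bar> + 1))"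
  have "\<delta> > 0" "\<bar>U\<bar> * \<delta> \<le> e / 2"
    using \<open>e > 0\<close> by (auto simp: \<delta>_def field_simps)
  let ?S = "\<lambda>n. {\<omega> \<in> space M. \<bar>Y n \<omega> - Z \<omega>\<bar> > \<delta>}"
  have "(\<lambda>n. prob (?S n)) \<longlonglongrightarrow> 0"
    using tendsto \<open>\<delta> > 0\<close> by (simp add: tendsto_in_prob_def)
  then have "\<forall>\<^sub>F n in sequentially. prob (?S n) < e / 4"
    using \<open>e > 0\<close> by (intro order_tendstoD(2)) auto
  then show ?thesis
  proof eventually_elim
    case (elim n)
    show ?case
    proof
      fix u assume u: "u \<in> {-U..U}"
      have ii: "integrable M (\<lambda>\<omega>. iexp (u * X \<omega>))" if "X \<in> borel_measurable M" for X
        using that by (intro integrable_iexp) auto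
      have "char (distr M borel (Y n)) u - char (distr M borel Z) u
          = (CLINT \<omega>|M. iexp (u * Y n \<omega>) - iexp (u * Z \<omega>))"
        by (simp add: char_def integral_distr ii del: of_real_mult)
      also have "cmod \<dots> \<le> (\<integral>\<omega>. cmod (iexp (u * Y n \<omega>) - iexp (u * Z \<omega>)) \<partial>M)"
        by (rule integral_norm_bound)
      also have "\<dots> \<le> (\<integral>\<omega>. \<bar>U\<bar> * \<delta> + 2 * indicator (?S n) \<omega> \<partial>M)"
      proof (rule integral_mono)
        show "integrable M (\<lambda>\<omega>. cmod (iexp (u * Y n \<omega>) - iexp (u * Z \<omega>)))"
          by (intro integrable_norm Bochner_Integration.integrable_diff ii) auto
        show "integrable M (\<lambda>\<omega>. \<bar>U\<bar> * \<delta> + 2 * indicator (?S n) \<omega>)"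
          by (intro Bochner_Integration.integrable_add integrable_mult_right integrable_real_indicator) (auto simp: less_top[symmetric])
        fix \<omega> assume "\<omega> \<in> space M"
        show "cmod (iexp (u * Y n \<omega>) - iexp (u * Z \<omega>)) \<le> \<bar>U\<bar> * \<delta> + 2 * indicator (?S n) \<omega>"
        proof (cases "\<omega> \<in> ?S n")
          case True
          have "cmod (iexp (u * Y n \<omega>) - iexp (u * Z \<omega>)) \<le> 2"
            by (rule norm_iexp_diff_le)
          also have "2 \<le> \<bar>U\<bar> * \<delta> + 2 * indicator (?S n) \<omega>"
            using True \<open>\<delta> > 0\<close> by simp
          finally show ?thesis .
        next
          case False
          have "cmod (iexp (u * Y n \<omega>) - iexp (u * Z \<omega>)) \<le> \<bar>u * Y n \<omega> - u * Z \<omega>\<bar>"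
            by (rule norm_iexp_diff_le)
          also have "\<dots> = \<bar>u\<bar> * \<bar>Y n \<omega> - Z \<omega>\<bar>"
            by (simp add: abs_mult[symmetric] right_diff_distrib)
          also have "\<dots> \<le> \<bar>U\<bar> * \<delta>"
            using u False \<open>\<omega> \<in> space M\<close> by (intro mult_mono) auto
          finally show ?thesis using False by simp
        qed
      qed
      also have "\<dots> = \<bar>U\<bar> * \<delta> + 2 * prob (?S n)"
        by (subst Bochner_Integration.integral_add) (auto simp: prob_space less_top[symmetric])
      also have "\<dots> \<le> e"
        using elim \<open>\<bar>U\<bar> * \<delta> \<le> e / 2\<close> by simp
      finally show "cmod (char (distr M borel (Y n)) u - char (distr M borel Z) u) \<le> e" .
    qed
  qed
qed

section \<open>Exponents of simple integrals and passage to the limit\<close>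

context levy_setting
begin

lemma bounded_borel_sets_control: "C \<in> bounded_borel \<Longrightarrow> C \<in> sets control"
  by (simp only: sets_control bounded_borel_sets)

lemma levy_simple_piece:
  assumes "levy_simple F" "A \<in> sets borel" "y \<noteq> 0"
  shows "A \<inter> F -` {y} \<in> bounded_borel"
proof -
  have "F -` {y} \<in> sets borel"
    using assms(1) measurable_sets[of F borel borel "{y}"] by (auto simp: levy_simple_def)
  then have "A \<inter> F -` {y} \<in> sets borel"
    using assms(2) by (rule sets.Int[rotated])
  moreover have "A \<inter> F -` {y} \<subseteq> {z. F z \<noteq> 0}"
    using assms(3) by auto
  moreover have "{z. F z \<noteq> 0} \<in> bounded_borel"
    using assms(1) by (simp add: levy_simple_def)
  ultimately show ?thesis
    using bounded_borel_subset by blast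
qed

lemma levy_simple_integral_measurable:
  assumes "levy_simple F" "A \<in> sets borel"
  shows "levy_simple_integral \<Lambda> F A \<in> borel_measurable M"
proof -
  have "(\<lambda>\<omega>. \<Sum>y\<in>range F - {0}. y * \<Lambda> (A \<inter> F -` {y}) \<omega>) \<in> borel_measurable M"
    by (intro borel_measurable_sum borel_measurable_times borel_measurable_const basis_measurable
        levy_simple_piece assms) auto
  then show ?thesis
    by (simp add: levy_simple_integral_def[abs_def])
qed

text \<open>This is the integral of \<open>\<phi> (u * F z)\<close> over \<open>A\<close> against
  the control measure. Written as a finite sum, it is a logarithm of the characteristic function
  that is continuous in \<open>u\<close> and vanishes at 0.\<close>

definition simple_exponent :: "(real \<times> real \<Rightarrow> real) \<Rightarrow> (real \<times> real) set \<Rightarrow> real \<Rightarrow> complex" where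
  "simple_exponent F A u = (\<Sum>y\<in>range F - {0}. \<phi> (u * y) * of_real (measure control (A \<inter> F -` {y})))"

lemma simple_exponent_0 [simp]: "simple_exponent F A 0 = 0"
  by (simp add: simple_exponent_def)

lemma char_levy_simple_integral:
  assumes "levy_simple F" "A \<in> sets borel"
  shows "char (distr M borel (levy_simple_integral \<Lambda> F A)) u = exp (simple_exponent F A u)"
  unfolding levy_simple_integral_def[abs_def] simple_exponent_def
  by (rule char_finite_sum)
     (use assms in \<open>auto simp: levy_simple_def disjoint_family_on_def intro: levy_simple_piece[OF assms]\<close>)

lemma continuous_on_simple_exponent: "continuous_on S (simple_exponent F A)"
  unfolding simple_exponent_def[abs_def]
  by (intro continuous_intros continuous_on_compose2[OF continuous_on_phi[of UNIV]]) auto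

text \<open>The level set of the value 0 may have infinite control measure, but it drops out because
  \<open>\<phi> 0 = 0\<close>.\<close>

lemma simple_exponent_integral:
  assumes F: "levy_simple F" and A: "A \<in> sets borel"
  shows "complex_integrable control (\<lambda>z. indicator A z *\<^sub>R \<phi> (u * F z))"
    and "(CLINT z|control. indicator A z *\<^sub>R \<phi> (u * F z)) = simple_exponent F A u"
proof -
  have fin: "finite (range F - {0})"
    using F by (simp add: levy_simple_def)
  have eq: "indicator A z *\<^sub>R \<phi> (u * F z) =
      (\<Sum>y\<in>range F - {0}. indicator (A \<inter> F -` {y}) z *\<^sub>R \<phi> (u * y))" for z
  proof (cases "F z = 0")
    case True
    then show ?thesis
      by (auto intro!: sum.neutral[symmetric] simp: indicator_def)
  next
    case False
    then have "(\<Sum>y\<in>range F - {0}. indicator (A \<inter> F -` {y}) z *\<^sub>R \<phi> (u * y))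
      = (\<Sum>y\<in>{F z}. indicator (A \<inter> F -` {y}) z *\<^sub>R \<phi> (u * y))"
      by (intro sum.mono_neutral_right fin) (auto simp: indicator_def)
    then show ?thesis by (simp add: indicator_def)
  qed
  have piece: "A \<inter> F -` {y} \<in> sets control" "emeasure control (A \<inter> F -` {y}) < \<infinity>" if "y \<in> range F - {0}" for y
    using levy_simple_piece[OF F A, of y] that bounded_borel_sets_control emeasure_control_finite by blast+
  have int: "complex_integrable control (\<lambda>z. indicator (A \<inter> F -` {y}) z *\<^sub>R \<phi> (u * y))"
    if "y \<in> range F - {0}" for y
    using piece[OF that] by (intro integrable_scaleR_left) auto
  show "complex_integrable control (\<lambda>z. indicator A z *\<^sub>R \<phi> (u * F z))"
    unfolding eq by (intro Bochner_Integration.integrable_sum int)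
  show "(CLINT z|control. indicator A z *\<^sub>R \<phi> (u * F z)) = simple_exponent F A u"
    unfolding eq simple_exponent_def
    by (subst Bochner_Integration.integral_sum[OF int])
       (use piece in \<open>auto intro!: sum.cong simp: scaleR_conv_of_real mult.commute\<close>)
qed

text \<open>This reconciles the limits in the definition of the integral, which exist over subsets
  of \<open>index_space\<close>, with the convergence theorem, which asks for all measurable sets of
  the plane.\<close>

lemma simple_exponent_Int_index_space:
  assumes "levy_simple F"
  shows "simple_exponent F (A \<inter> index_space) u = simple_exponent F A u"
proof -
  have "A \<inter> index_space \<inter> F -` {y} = A \<inter> F -` {y}" if "y \<noteq> 0" for y
    using assms that by (auto simp: levy_simple_def bounded_borel_def)
  then show ?thesis
    unfolding simple_exponent_def by (intro sum.cong) auto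
qed

text \<open>By \<open>Re_phi_le_0\<close> every piece can only lower the real part, and shrinking
  the set shrinks the pieces.\<close>

lemma Re_simple_exponent_mono:
  assumes "levy_simple F" "A \<in> sets borel"
  shows "Re (simple_exponent F UNIV u) \<le> Re (simple_exponent F A u)"
  unfolding simple_exponent_def Re_sum
proof (rule sum_mono)
  fix y assume "y \<in> range F - {0}"
  then have *: "UNIV \<inter> F -` {y} \<in> bounded_borel" "A \<inter> F -` {y} \<in> bounded_borel"
    by (auto intro!: levy_simple_piece[OF assms(1), of UNIV, simplified] levy_simple_piece[OF assms])
  then have "measure control (A \<inter> F -` {y}) \<le> measure control (UNIV \<inter> F -` {y})"
    by (intro measure_mono_fmeasurable fmeasurableI bounded_borel_sets_control emeasure_control_finite) auto
  from mult_left_mono_neg[OF this Re_phi_le_0[of "u * y"]]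
  show "Re (\<phi> (u * y) * of_real (measure control (UNIV \<inter> F -` {y})))
      \<le> Re (\<phi> (u * y) * of_real (measure control (A \<inter> F -` {y})))" by simp
qed

lemma index_space_sets: "index_space \<in> sets borel"
  unfolding index_space_def by (subst borel_prod[symmetric]) (intro pair_measureI; simp)

text \<open>The radius \<open>U\<close> must serve all sets \<open>A\<close> at once. This works because the characteristic
  function of the integral over \<open>A\<close> is bounded below in modulus by that of the full integral.\<close>

theorem has_levy_integral_char:
  assumes "has_levy_integral M \<Lambda> control f Y"
  obtains U where "U > 0"
    "\<And>u. \<bar>u\<bar> \<le> U \<Longrightarrow> complex_integrable control (\<lambda>z. \<phi> (u * f z))"
    "\<And>u. \<bar>u\<bar> \<le> U \<Longrightarrow> char (distr M borel Y) u = exp (CLINT z|control. \<phi> (u * f z))"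
proof -
  from assms obtain F where
    f [measurable]: "f \<in> borel_measurable borel" and Y [measurable]: "Y \<in> borel_measurable M" and
    F': "\<forall>n. levy_simple (F n)" and ae: "AE z in control. (\<lambda>n. F n z) \<longlonglongrightarrow> f z" and
    Z: "\<forall>A\<in>sets borel. A \<subseteq> index_space \<longrightarrow>
          (\<exists>Z\<in>borel_measurable M. tendsto_in_prob M (\<lambda>n. levy_simple_integral \<Lambda> (F n) A) Z)" and
    lim: "tendsto_in_prob M (\<lambda>n. levy_simple_integral \<Lambda> (F n) index_space) Y"
    unfolding has_levy_integral_def by blast
  from F' have F: "levy_simple (F n)" for n by simp
  interpret Y: real_distribution "distr M borel Y"
    by (rule real_distribution_distr) simp
  have "\<forall>\<^sub>F u in at 0. dist (char (distr M borel Y) u) 1 < 1 / 2"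
    using Y.isCont_char[of 0] unfolding isCont_def Y.char_zero by (rule tendstoD) simp
  then obtain e where e: "e > 0" "\<And>u. u \<noteq> 0 \<Longrightarrow> \<bar>u\<bar> < e \<Longrightarrow> dist (char (distr M borel Y) u) 1 < 1 / 2"
    unfolding eventually_at by (auto simp: dist_real_def)
  define U where "U = e / 2"
  have "U > 0" using e by (simp add: U_def)
  have half: "cmod (char (distr M borel Y) u) \<ge> 1 / 2" if "u \<in> {-U..U}" for u
  proof (cases "u = 0")
    case False
    then have "dist (char (distr M borel Y) u) 1 < 1 / 2"
      using that e \<open>U > 0\<close> by (intro e) (auto simp: U_def)
    then show ?thesis
      using norm_triangle_ineq2[of 1 "char (distr M borel Y) u"] by (simp add: dist_norm norm_minus_commute)
  qed (simp add: Y.char_zero)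
  note near = tendsto_in_prob_char_uniform[OF lim levy_simple_integral_measurable[OF F index_space_sets] Y, where U = U]
  have quarter: "(0::real) < 1 / 4" by simp
  \<comment> \<open>The limit has modulus at least 1/2 on the whole interval, and the approximation
    costs at most 1/4.\<close>
  have full: "\<forall>\<^sub>F n in sequentially. \<forall>u\<in>{-U..U}. 1 / 4 \<le> cmod (exp (simple_exponent (F n) UNIV u))"
    using near[OF quarter]
  proof (eventually_elim, intro ballI)
    fix n u assume *: "\<forall>u\<in>{-U..U}. cmod (char (distr M borel (levy_simple_integral \<Lambda> (F n) index_space)) u - char (distr M borel Y) u) \<le> 1 / 4"
      and u: "u \<in> {-U..U}"
    have "cmod (exp (simple_exponent (F n) UNIV u) - char (distr M borel Y) u) \<le> 1 / 4"
      using *[rule_format, OF u] simple_exponent_Int_index_space[OF F, where A = UNIV]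
      by (simp add: char_levy_simple_integral F index_space_sets)
    then show "1 / 4 \<le> cmod (exp (simple_exponent (F n) UNIV u))"
      using half[OF u] norm_triangle_ineq3[of "exp (simple_exponent (F n) UNIV u)" "char (distr M borel Y) u"] by linarith
  qed
  \<comment> \<open>The characteristic functions over \<open>A\<close> converge uniformly on the
    interval. Dividing by one of them, of modulus at least 1/4, shows that the difference of two
    exponents has exponential near 1 along the whole path from 0, so the difference itself is
    small.\<close>
  have Cauchy: "Cauchy (\<lambda>n. simple_exponent (F n) A u)" if A: "A \<in> sets borel" and u: "u \<in> {-U..U}" for A u
  proof (rule CauchyI)
    fix r :: real assume "r > 0"
    \<comment> \<open>Two errors of \<open>d / 8\<close> add up to \<open>d / 4\<close>, which the
      lower bound 1/4 turns into \<open>d\<close>; \<open>d \<le> 1 / 4\<close> meets the demand of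
      the path lemma, and \<open>d \<le> r / 4\<close> makes its conclusion \<open>2 * d\<close>
      smaller than \<open>r\<close>.\<close>
    define d where "d = min (r / 4) (1 / 4)"
    have d: "d > 0" "d < 1 / 2" "2 * d < r"
      using \<open>r > 0\<close> by (auto simp: d_def min_def)
    let ?A = "A \<inter> index_space"
    have A': "?A \<in> sets borel"
      using A index_space_sets by auto
    then obtain Z where Z: "Z \<in> borel_measurable M" "tendsto_in_prob M (\<lambda>n. levy_simple_integral \<Lambda> (F n) ?A) Z"
      using Z by (metis Int_lower2)
    have "\<forall>\<^sub>F n in sequentially. \<forall>u\<in>{-U..U}. cmod (exp (simple_exponent (F n) A u) - char (distr M borel Z) u) \<le> d / 8"
      using tendsto_in_prob_char_uniform[OF Z(2) levy_simple_integral_measurable[OF F A'] Z(1), of "d / 8" U] d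
      by (simp add: char_levy_simple_integral F A' simple_exponent_Int_index_space)
    with full have "\<forall>\<^sub>F n in sequentially. (\<forall>u\<in>{-U..U}. 1 / 4 \<le> cmod (exp (simple_exponent (F n) UNIV u))) \<and>
       (\<forall>u\<in>{-U..U}. cmod (exp (simple_exponent (F n) A u) - char (distr M borel Z) u) \<le> d / 8)"
      by eventually_elim blast
    then obtain N where N: "\<And>n u. n \<ge> N \<Longrightarrow> u \<in> {-U..U} \<Longrightarrow> 1 / 4 \<le> cmod (exp (simple_exponent (F n) UNIV u))"
        "\<And>n u. n \<ge> N \<Longrightarrow> u \<in> {-U..U} \<Longrightarrow> cmod (exp (simple_exponent (F n) A u) - char (distr M borel Z) u) \<le> d / 8"
      unfolding eventually_sequentially by blast
    have "cmod (simple_exponent (F m) A u - simple_exponent (F n) A u) \<le> 2 * d" if "m \<ge> N" "n \<ge> N" for m n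
    proof (rule small_exponent_along_path[where U = U and w = "\<lambda>u. simple_exponent (F m) A u - simple_exponent (F n) A u"])
      fix v assume v: "v \<in> {-U..U}"
      let ?m = "exp (simple_exponent (F m) A v)" and ?n = "exp (simple_exponent (F n) A v)"
      have "cmod (?m - ?n) \<le> cmod (?m - char (distr M borel Z) v) + cmod (?n - char (distr M borel Z) v)"
        by (metis norm_minus_commute norm_triangle_sub norm_diff_triangle_le order_refl)
      also have "\<dots> \<le> d / 4"
        using N(2)[OF \<open>m \<ge> N\<close> v] N(2)[OF \<open>n \<ge> N\<close> v] by simp
      finally have 1: "cmod (?m - ?n) \<le> d / 4" .
      have "1 / 4 \<le> cmod (exp (simple_exponent (F n) UNIV v))"
        by (rule N(1)[OF \<open>n \<ge> N\<close> v])
      also have "\<dots> \<le> cmod ?n"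
        using Re_simple_exponent_mono[OF F A] by simp
      finally have 2: "1 / 4 \<le> cmod ?n" .
      have "(exp (simple_exponent (F m) A v - simple_exponent (F n) A v) - 1) * ?n = ?m - ?n"
        by (simp add: exp_diff left_diff_distrib)
      then have "cmod (exp (simple_exponent (F m) A v - simple_exponent (F n) A v) - 1) * cmod ?n = cmod (?m - ?n)"
        by (simp only: norm_mult[symmetric])
      then have "cmod (exp (simple_exponent (F m) A v - simple_exponent (F n) A v) - 1) * (1 / 4) \<le> d / 4"
        using 1 mult_left_mono[OF 2 norm_ge_zero[of "exp (simple_exponent (F m) A v - simple_exponent (F n) A v) - 1"]]
        by linarith
      then show "cmod (exp (simple_exponent (F m) A v - simple_exponent (F n) A v) - 1) \<le> d" by simp
    qed (use u d \<open>U > 0\<close> in \<open>auto intro!: continuous_on_diff continuous_on_simple_exponent\<close>)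
    with d(3) show "\<exists>N. \<forall>m\<ge>N. \<forall>n\<ge>N. cmod (simple_exponent (F m) A u - simple_exponent (F n) A u) < r"
      by (meson order.strict_trans1)
  qed
  have main: "complex_integrable control (\<lambda>z. \<phi> (u * f z)) \<and>
      char (distr M borel Y) u = exp (CLINT z|control. \<phi> (u * f z))" if "\<bar>u\<bar> \<le> U" for u
  proof -
    have u: "u \<in> {-U..U}" using that by auto
    have [measurable]: "F n \<in> borel_measurable borel" for n
      using F by (simp add: levy_simple_def)
    have int: "complex_integrable control (\<lambda>z. \<phi> (u * F n z))" for n
      using simple_exponent_integral(1)[OF F, where A = UNIV and u = u] by simp
    have int_A: "complex_integrable control (\<lambda>z. indicator A z *\<^sub>R \<phi> (u * F n z))" if "A \<in> sets control" for A n
      by (rule simple_exponent_integral(1)[OF F that[unfolded sets_control]])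
    have tends: "AE z in control. (\<lambda>n. \<phi> (u * F n z)) \<longlonglongrightarrow> \<phi> (u * f z)"
      using ae
    proof eventually_elim
      case (elim z)
      show ?case
        by (rule isCont_tendsto_compose[OF isCont_phi]) (intro tendsto_intros elim)
    qed
    have setwise: "Cauchy (\<lambda>n. CLINT z|control. indicator A z *\<^sub>R \<phi> (u * F n z))" if "A \<in> sets control" for A
      using Cauchy[OF that[unfolded sets_control] u]
      by (simp only: simple_exponent_integral(2)[OF F that[unfolded sets_control]])
    \<comment> \<open>The convergence theorem concerns real densities, so it is applied to real and
      imaginary parts separately.\<close>
    have sRe: "Cauchy (\<lambda>n. \<integral>z. indicator A z * Re (\<phi> (u * F n z)) \<partial>control)" if "A \<in> sets control" for A
    proof -
      have "(\<integral>z. indicator A z * Re (\<phi> (u * F n z)) \<partial>control) = Re (CLINT z|control. indicator A z *\<^sub>R \<phi> (u * F n z))" for n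
        using integral_Re[OF int_A[OF that, of n]] by simp
      then show ?thesis
        using setwise[OF that] by (simp add: Cauchy_Re)
    qed
    have sIm: "Cauchy (\<lambda>n. \<integral>z. indicator A z * Im (\<phi> (u * F n z)) \<partial>control)" if "A \<in> sets control" for A
    proof -
      have "(\<integral>z. indicator A z * Im (\<phi> (u * F n z)) \<partial>control) = Im (CLINT z|control. indicator A z *\<^sub>R \<phi> (u * F n z))" for n
        using integral_Im[OF int_A[OF that, of n]] by simp
      then show ?thesis
        using setwise[OF that] by (simp add: Cauchy_Im)
    qed
    have tRe: "AE z in control. (\<lambda>n. Re (\<phi> (u * F n z))) \<longlonglongrightarrow> Re (\<phi> (u * f z))"
      using tends by eventually_elim (rule tendsto_Re)
    have tIm: "AE z in control. (\<lambda>n. Im (\<phi> (u * F n z))) \<longlonglongrightarrow> Im (\<phi> (u * f z))"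
      using tends by eventually_elim (rule tendsto_Im)
    have meas: "(\<lambda>z. Re (\<phi> (u * f z))) \<in> borel_measurable control"
        "(\<lambda>z. Im (\<phi> (u * f z))) \<in> borel_measurable control"
      by measurable
    note Re = control.setwise_Cauchy_imp_integral_tendsto[OF integrable_Re[OF int] tRe meas(1) sRe]
    note Im = control.setwise_Cauchy_imp_integral_tendsto[OF integrable_Im[OF int] tIm meas(2) sIm]
    have int_f: "complex_integrable control (\<lambda>z. \<phi> (u * f z))"
    proof -
      have "complex_integrable control (\<lambda>z. of_real (Re (\<phi> (u * f z))) + \<i> * of_real (Im (\<phi> (u * f z))))"
        by (intro Bochner_Integration.integrable_add integrable_mult_right integrable_of_real Re(1) Im(1))
      then show ?thesis by (simp add: complex_eq[symmetric])
    qed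
    have "(\<lambda>n. CLINT z|control. \<phi> (u * F n z)) \<longlonglongrightarrow> (CLINT z|control. \<phi> (u * f z))"
      using Re(2) Im(2) by (simp add: tendsto_complex_iff integral_Re[OF int] integral_Im[OF int]
          integral_Re[OF int_f] integral_Im[OF int_f])
    then have "(\<lambda>n. exp (simple_exponent (F n) UNIV u)) \<longlonglongrightarrow> exp (CLINT z|control. \<phi> (u * f z))"
      using simple_exponent_integral(2)[OF F, where A = UNIV] by (intro tendsto_exp) simp
    moreover have "(\<lambda>n. exp (simple_exponent (F n) UNIV u)) \<longlonglongrightarrow> char (distr M borel Y) u"
    proof (rule tendstoI)
      fix e :: real assume "e > 0"
      show "\<forall>\<^sub>F n in sequentially. dist (exp (simple_exponent (F n) UNIV u)) (char (distr M borel Y) u) < e"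
        using near[OF half_gt_zero[OF \<open>e > 0\<close>]]
      proof eventually_elim
        fix n assume "\<forall>u\<in>{-U..U}. cmod (char (distr M borel (levy_simple_integral \<Lambda> (F n) index_space)) u - char (distr M borel Y) u) \<le> e / 2"
        then show "dist (exp (simple_exponent (F n) UNIV u)) (char (distr M borel Y) u) < e"
          using u \<open>e > 0\<close> simple_exponent_Int_index_space[OF F, where A = UNIV]
          by (force simp: char_levy_simple_integral F index_space_sets dist_norm)
      qed
    qed
    ultimately show ?thesis
      using int_f LIMSEQ_unique by blast
  qed
  show ?thesis
    by (rule that[OF \<open>U > 0\<close>]) (use main in auto)
qed

end

section \<open>Additivity of the Levy integral\<close>

lemma (in prob_space) tendsto_in_prob_add:
  assumes "tendsto_in_prob M Y Z" "tendsto_in_prob M Y' Z'"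
    and [measurable]: "\<And>n. Y n \<in> borel_measurable M" "\<And>n. Y' n \<in> borel_measurable M"
      "Z \<in> borel_measurable M" "Z' \<in> borel_measurable M"
  shows "tendsto_in_prob M (\<lambda>n \<omega>. Y n \<omega> + Y' n \<omega>) (\<lambda>\<omega>. Z \<omega> + Z' \<omega>)"
  unfolding tendsto_in_prob_def
proof (intro allI impI)
  fix \<epsilon> :: real assume "\<epsilon> > 0"
  let ?A = "\<lambda>n. {\<omega> \<in> space M. \<bar>Y n \<omega> - Z \<omega>\<bar> > \<epsilon> / 2}"
  let ?B = "\<lambda>n. {\<omega> \<in> space M. \<bar>Y' n \<omega> - Z' \<omega>\<bar> > \<epsilon> / 2}"
  let ?C = "\<lambda>n. {\<omega> \<in> space M. \<bar>Y n \<omega> + Y' n \<omega> - (Z \<omega> + Z' \<omega>)\<bar> > \<epsilon>}"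
  have "(\<lambda>n. prob (?A n)) \<longlonglongrightarrow> 0" "(\<lambda>n. prob (?B n)) \<longlonglongrightarrow> 0"
    using assms(1,2) half_gt_zero[OF \<open>\<epsilon> > 0\<close>] unfolding tendsto_in_prob_def by blast+
  then have lim: "(\<lambda>n. prob (?A n) + prob (?B n)) \<longlonglongrightarrow> 0"
    using tendsto_add by fastforce
  have le: "prob (?C n) \<le> prob (?A n) + prob (?B n)" for n
  proof -
    have "prob (?C n) \<le> prob (?A n \<union> ?B n)"
    proof (rule finite_measure_mono)
      show "?C n \<subseteq> ?A n \<union> ?B n"
      proof safe
        fix \<omega> assume "\<epsilon> < \<bar>Y n \<omega> + Y' n \<omega> - (Z \<omega> + Z' \<omega>)\<bar>" "\<not> \<epsilon> / 2 < \<bar>Y' n \<omega> - Z' \<omega>\<bar>"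
        then show "\<epsilon> / 2 < \<bar>Y n \<omega> - Z \<omega>\<bar>" by linarith
      qed
    qed measurable
    also have "\<dots> \<le> prob (?A n) + prob (?B n)"
      by (rule measure_Un_le) measurable
    finally show ?thesis .
  qed
  show "(\<lambda>n. prob (?C n)) \<longlonglongrightarrow> 0"
    by (rule tendsto_sandwich[OF _ _ tendsto_const lim]) (use le in auto)
qed

lemma (in prob_space) tendsto_in_prob_cong_AE:
  assumes "tendsto_in_prob M Y Z" "\<And>n. AE \<omega> in M. Y n \<omega> = Y' n \<omega>"
    and [measurable]: "\<And>n. Y n \<in> borel_measurable M" "\<And>n. Y' n \<in> borel_measurable M"
      "Z \<in> borel_measurable M"
  shows "tendsto_in_prob M Y' Z"
  unfolding tendsto_in_prob_def
proof (intro allI impI)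
  fix \<epsilon> :: real assume "\<epsilon> > 0"
  have "prob {\<omega> \<in> space M. \<bar>Y' n \<omega> - Z \<omega>\<bar> > \<epsilon>} = prob {\<omega> \<in> space M. \<bar>Y n \<omega> - Z \<omega>\<bar> > \<epsilon>}" for n
    by (intro finite_measure_eq_AE) (use assms(2)[of n] in auto)
  then show "(\<lambda>n. prob {\<omega> \<in> space M. \<bar>Y' n \<omega> - Z \<omega>\<bar> > \<epsilon>}) \<longlonglongrightarrow> 0"
    using assms(1) \<open>\<epsilon> > 0\<close> by (simp add: tendsto_in_prob_def)
qed

context levy_setting
begin

text \<open>Several values \<open>q\<close> may share the same \<open>c q\<close>, so a level set of
  the composition is a finite union of level sets of \<open>H\<close>, on which the basis is
  additive almost surely. This evaluates a simple integral on a finer partition than its own;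
  \<open>qz\<close> marks the piece that may be unbounded.\<close>

lemma levy_simple_integral_compose:
  fixes c :: "'q \<Rightarrow> real"
  assumes fin: "finite (range H)" and c0: "c qz = 0"
    and piece: "\<And>q. q \<noteq> qz \<Longrightarrow> A \<inter> H -` {q} \<in> bounded_borel"
  shows "AE \<omega> in M. levy_simple_integral \<Lambda> (\<lambda>z. c (H z)) A \<omega> =
    (\<Sum>q\<in>range H - {qz}. c q * \<Lambda> (A \<inter> H -` {q}) \<omega>)"
proof -
  let ?R = "range (\<lambda>z. c (H z)) - {0}"
  let ?Q = "{q \<in> range H - {qz}. c q \<noteq> 0}"
  have finR: "finite ?R"
    using finite_imageI[OF fin, of c] by (simp add: image_image)
  have "AE \<omega> in M. \<forall>y\<in>?R. \<Lambda> (A \<inter> (\<lambda>z. c (H z)) -` {y}) \<omega> =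
      (\<Sum>q\<in>{q \<in> ?Q. c q = y}. \<Lambda> (A \<inter> H -` {q}) \<omega>)"
  proof (rule AE_finite_allI[OF finR])
    fix y assume y: "y \<in> ?R"
    have "A \<inter> (\<lambda>z. c (H z)) -` {y} = (\<Union>q\<in>{q \<in> ?Q. c q = y}. A \<inter> H -` {q})"
      using y c0 by auto
    moreover have "AE \<omega> in M. \<Lambda> (\<Union>q\<in>{q \<in> ?Q. c q = y}. A \<inter> H -` {q}) \<omega> =
      (\<Sum>q\<in>{q \<in> ?Q. c q = y}. \<Lambda> (A \<inter> H -` {q}) \<omega>)"
      by (rule basis_finite_Union) (use fin piece in \<open>auto simp: disjoint_family_on_def\<close>)
    ultimately show "AE \<omega> in M. \<Lambda> (A \<inter> (\<lambda>z. c (H z)) -` {y}) \<omega> =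
      (\<Sum>q\<in>{q \<in> ?Q. c q = y}. \<Lambda> (A \<inter> H -` {q}) \<omega>)" by simp
  qed
  then show ?thesis
  proof eventually_elim
    case (elim \<omega>)
    have "levy_simple_integral \<Lambda> (\<lambda>z. c (H z)) A \<omega> =
        (\<Sum>y\<in>?R. \<Sum>q\<in>{q \<in> ?Q. c q = y}. c q * \<Lambda> (A \<inter> H -` {q}) \<omega>)"
      unfolding levy_simple_integral_def
      by (intro sum.cong refl) (use elim in \<open>auto simp: sum_distrib_left intro!: sum.cong\<close>)
    also have "\<dots> = (\<Sum>q\<in>?Q. c q * \<Lambda> (A \<inter> H -` {q}) \<omega>)"
      by (rule sum.group) (use fin finR in auto)
    also have "\<dots> = (\<Sum>q\<in>range H - {qz}. c q * \<Lambda> (A \<inter> H -` {q}) \<omega>)"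
      by (rule sum.mono_neutral_left) (use fin in auto)
    finally show ?case .
  qed
qed

lemma levy_simple_add:
  assumes "levy_simple F" "levy_simple G"
  shows "levy_simple (\<lambda>z. F z + G z)"
  unfolding levy_simple_def
proof (intro conjI)
  have [measurable]: "F \<in> borel_measurable borel" "G \<in> borel_measurable borel"
    using assms by (auto simp: levy_simple_def)
  show m: "(\<lambda>z. F z + G z) \<in> borel_measurable borel" by measurable
  have "finite ((\<lambda>(a, b). a + b) ` (range F \<times> range G))"
    using assms by (auto simp: levy_simple_def)
  then show "finite (range (\<lambda>z. F z + G z))"
    by (rule finite_subset[rotated]) auto
  have "{z. F z \<noteq> 0} \<union> {z. G z \<noteq> 0} \<in> bounded_borel"
    using assms by (auto simp: levy_simple_def bounded_borel_def)
  moreover have "{z \<in> space borel. F z + G z \<noteq> 0} \<in> sets borel"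
    by measurable
  ultimately show "{z. F z + G z \<noteq> 0} \<in> bounded_borel"
    by (elim bounded_borel_subset) auto
qed

text \<open>The level sets of the pair \<open>(F z, G z)\<close> form a common refinement on which
  all three integrals are sums over the same pieces, with coefficients \<open>fst q\<close>,
  \<open>snd q\<close> and their sum.\<close>

lemma levy_simple_integral_add:
  assumes F: "levy_simple F" and G: "levy_simple G" and A: "A \<in> sets borel"
  shows "AE \<omega> in M. levy_simple_integral \<Lambda> F A \<omega> + levy_simple_integral \<Lambda> G A \<omega> =
    levy_simple_integral \<Lambda> (\<lambda>z. F z + G z) A \<omega>"
proof -
  define H where "H z = (F z, G z)" for z
  have [measurable]: "F \<in> borel_measurable borel" "G \<in> borel_measurable borel"
    using assms by (auto simp: levy_simple_def)
  have "finite (range F \<times> range G)"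
    using F G by (auto simp: levy_simple_def)
  then have fin: "finite (range H)"
    by (rule finite_subset[rotated]) (auto simp: H_def)
  have piece: "A \<inter> H -` {q} \<in> bounded_borel" if "q \<noteq> (0, 0)" for q
  proof -
    have *: "A \<inter> H -` {q} = (A \<inter> F -` {fst q}) \<inter> (A \<inter> G -` {snd q})"
      by (auto simp: H_def prod_eq_iff)
    have "F -` {fst q} \<inter> space borel \<in> sets borel" "G -` {snd q} \<inter> space borel \<in> sets borel"
      by (rule measurable_sets[of _ borel borel]; simp)+
    then have sets: "A \<inter> H -` {q} \<in> sets borel"
      unfolding * using A by auto
    from that consider "fst q \<noteq> 0" | "snd q \<noteq> 0" by (auto simp: prod_eq_iff)
    then show ?thesis
    proof cases
      case 1
      show ?thesis
        by (rule bounded_borel_subset[OF levy_simple_piece[OF F A 1] sets]) (auto simp: *)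
    next
      case 2
      show ?thesis
        by (rule bounded_borel_subset[OF levy_simple_piece[OF G A 2] sets]) (auto simp: *)
    qed
  qed
  note comp = levy_simple_integral_compose[where qz = "(0, 0)", OF fin _ piece]
  from comp[of fst] comp[of snd] comp[of "\<lambda>q. fst q + snd q"] show ?thesis
    by (auto elim!: AE_mp simp: H_def sum.distrib[symmetric] algebra_simps)
qed

text \<open>The approximating sequences are added. The purpose is polarization:
  \<open>X s + X t\<close> becomes the integral of the sum of the two kernels.\<close>

theorem has_levy_integral_add:
  assumes "has_levy_integral M \<Lambda> control f Y" "has_levy_integral M \<Lambda> control g Z"
  shows "has_levy_integral M \<Lambda> control (\<lambda>z. f z + g z) (\<lambda>\<omega>. Y \<omega> + Z \<omega>)"
proof -
  from assms obtain F G where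
    f [measurable]: "f \<in> borel_measurable borel" "Y \<in> borel_measurable M" and
    g [measurable]: "g \<in> borel_measurable borel" "Z \<in> borel_measurable M" and
    F: "\<forall>n. levy_simple (F n)" "AE z in control. (\<lambda>n. F n z) \<longlonglongrightarrow> f z"
      "\<forall>A\<in>sets borel. A \<subseteq> index_space \<longrightarrow>
          (\<exists>Z\<in>borel_measurable M. tendsto_in_prob M (\<lambda>n. levy_simple_integral \<Lambda> (F n) A) Z)"
      "tendsto_in_prob M (\<lambda>n. levy_simple_integral \<Lambda> (F n) index_space) Y" and
    G: "\<forall>n. levy_simple (G n)" "AE z in control. (\<lambda>n. G n z) \<longlonglongrightarrow> g z"
      "\<forall>A\<in>sets borel. A \<subseteq> index_space \<longrightarrow>
          (\<exists>Z\<in>borel_measurable M. tendsto_in_prob M (\<lambda>n. levy_simple_integral \<Lambda> (G n) A) Z)"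
      "tendsto_in_prob M (\<lambda>n. levy_simple_integral \<Lambda> (G n) index_space) Z"
    unfolding has_levy_integral_def by (elim conjE exE) blast
  have FG: "levy_simple (\<lambda>z. F n z + G n z)" for n
    using F(1) G(1) levy_simple_add by blast
  have sum: "tendsto_in_prob M (\<lambda>n. levy_simple_integral \<Lambda> (\<lambda>z. F n z + G n z) A) (\<lambda>\<omega>. Y \<omega> + Z \<omega>)"
    if "A \<in> sets borel" "tendsto_in_prob M (\<lambda>n. levy_simple_integral \<Lambda> (F n) A) Y"
      "tendsto_in_prob M (\<lambda>n. levy_simple_integral \<Lambda> (G n) A) Z"
      "Y \<in> borel_measurable M" "Z \<in> borel_measurable M" for A Y Z
  proof (rule tendsto_in_prob_cong_AE)
    note [measurable] = levy_simple_integral_measurable[OF F(1)[rule_format] that(1)]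
      levy_simple_integral_measurable[OF G(1)[rule_format] that(1)]
    show "tendsto_in_prob M (\<lambda>n \<omega>. levy_simple_integral \<Lambda> (F n) A \<omega> + levy_simple_integral \<Lambda> (G n) A \<omega>) (\<lambda>\<omega>. Y \<omega> + Z \<omega>)"
      by (rule tendsto_in_prob_add) (use that in measurable)
    show "AE \<omega> in M. levy_simple_integral \<Lambda> (F n) A \<omega> + levy_simple_integral \<Lambda> (G n) A \<omega>
        = levy_simple_integral \<Lambda> (\<lambda>z. F n z + G n z) A \<omega>" for n
      using F(1) G(1) that(1) by (intro levy_simple_integral_add) auto
    show "levy_simple_integral \<Lambda> (\<lambda>z. F n z + G n z) A \<in> borel_measurable M" for n
      by (rule levy_simple_integral_measurable[OF FG that(1)])
    show "(\<lambda>\<omega>. levy_simple_integral \<Lambda> (F n) A \<omega> + levy_simple_integral \<Lambda> (G n) A \<omega>) \<in> borel_measurable M" for n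
      by measurable
    show "(\<lambda>\<omega>. Y \<omega> + Z \<omega>) \<in> borel_measurable M"
      using that by measurable
  qed
  show ?thesis
    unfolding has_levy_integral_def
  proof (intro conjI exI[of _ "\<lambda>n z. F n z + G n z"] allI ballI impI)
    show "AE z in control. (\<lambda>n. F n z + G n z) \<longlonglongrightarrow> f z + g z"
      using F(2) G(2) by eventually_elim (rule tendsto_add)
    show "tendsto_in_prob M (\<lambda>n. levy_simple_integral \<Lambda> (\<lambda>z. F n z + G n z) index_space) (\<lambda>\<omega>. Y \<omega> + Z \<omega>)"
      by (rule sum[OF index_space_sets F(4) G(4)]) measurable
    fix A assume A: "A \<in> sets borel" "A \<subseteq> index_space"
    with F(3) G(3) obtain Y' Z' where
      "Y' \<in> borel_measurable M" "tendsto_in_prob M (\<lambda>n. levy_simple_integral \<Lambda> (F n) A) Y'"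
      "Z' \<in> borel_measurable M" "tendsto_in_prob M (\<lambda>n. levy_simple_integral \<Lambda> (G n) A) Z'"
      by blast
    then show "\<exists>Z\<in>borel_measurable M. tendsto_in_prob M (\<lambda>n. levy_simple_integral \<Lambda> (\<lambda>z. F n z + G n z) A) Z"
      using sum[OF A(1)] by (intro bexI[of _ "\<lambda>\<omega>. Y' \<omega> + Z' \<omega>"]) auto
  qed (use FG in measurable)
qed

end

section \<open>Moments of Levy integrals\<close>

lemma iexp_second_order_bound: "cmod (iexp x - 1 - \<i> * of_real x) \<le> x\<^sup>2 / 2"
  using iexp_approx1[of x 1] by (simp add: algebra_simps numeral_2_eq_2)

lemma iexp_second_order_tendsto:
  fixes u :: "nat \<Rightarrow> real"
  assumes u: "u \<longlonglongrightarrow> 0" "\<And>n. u n \<noteq> 0"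
  shows "(\<lambda>n. (iexp (u n * y) - 1 - \<i> * of_real (u n * y)) / of_real ((u n)\<^sup>2)) \<longlonglongrightarrow> of_real (- y\<^sup>2 / 2)"
proof (rule LIM_zero_cancel)
  show "(\<lambda>n. (iexp (u n * y) - 1 - \<i> * of_real (u n * y)) / of_real ((u n)\<^sup>2) - of_real (- y\<^sup>2 / 2)) \<longlonglongrightarrow> 0"
  proof (rule Lim_null_comparison)
    show "\<forall>\<^sub>F n in sequentially. cmod ((iexp (u n * y) - 1 - \<i> * of_real (u n * y)) / of_real ((u n)\<^sup>2) - of_real (- y\<^sup>2 / 2))
        \<le> \<bar>u n\<bar> * \<bar>y\<bar> ^ 3 / 6"
    proof (rule always_eventually, rule allI)
      fix n
      have "(iexp (u n * y) - 1 - \<i> * of_real (u n * y)) / of_real ((u n)\<^sup>2) - of_real (- y\<^sup>2 / 2)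
          = (iexp (u n * y) - (\<Sum>k\<le>2. (\<i> * of_real (u n * y)) ^ k / fact k)) / of_real ((u n)\<^sup>2)"
        using u(2)[of n] by (simp add: numeral_2_eq_2 field_simps)
      then have "cmod ((iexp (u n * y) - 1 - \<i> * of_real (u n * y)) / of_real ((u n)\<^sup>2) - of_real (- y\<^sup>2 / 2))
          = cmod (iexp (u n * y) - (\<Sum>k\<le>2. (\<i> * of_real (u n * y)) ^ k / fact k)) / (u n)\<^sup>2"
        by (simp only: norm_divide norm_of_real abs_power2)
      also have "\<dots> \<le> \<bar>u n * y\<bar> ^ 3 / 6 / (u n)\<^sup>2"
        using iexp_approx1[of "u n * y" 2] by (intro divide_right_mono) (auto simp: fact_numeral eval_nat_numeral)
      also have "\<dots> = \<bar>u n\<bar> * \<bar>y\<bar> ^ 3 / 6"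
        using u(2)[of n] by (simp add: abs_mult power_mult_distrib power3_eq_cube power2_eq_square field_simps)
      finally show "cmod ((iexp (u n * y) - 1 - \<i> * of_real (u n * y)) / of_real ((u n)\<^sup>2) - of_real (- y\<^sup>2 / 2))
        \<le> \<bar>u n\<bar> * \<bar>y\<bar> ^ 3 / 6" .
    qed
    show "(\<lambda>n. \<bar>u n\<bar> * \<bar>y\<bar> ^ 3 / 6) \<longlonglongrightarrow> 0"
      using u(1) by (auto intro!: tendsto_eq_intros)
  qed
qed

text \<open>The square appears as a limit of nonnegative bounded functions whose integrals are
  visible in a characteristic function or exponent, so that Fatou's lemma can establish second
  moments.\<close>

lemma cos_second_order_tendsto:
  fixes u :: "nat \<Rightarrow> real"
  assumes u: "u \<longlonglongrightarrow> 0" "\<And>n. u n \<noteq> 0"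
  shows "(\<lambda>n. 2 * (1 - cos (u n * y)) / (u n)\<^sup>2) \<longlonglongrightarrow> y\<^sup>2"
proof -
  have "(\<lambda>n. - 2 * Re ((iexp (u n * y) - 1 - \<i> * of_real (u n * y)) / of_real ((u n)\<^sup>2))) \<longlonglongrightarrow> - 2 * Re (of_real (- y\<^sup>2 / 2))"
    by (intro tendsto_intros iexp_second_order_tendsto u)
  moreover have "- 2 * Re ((iexp x - 1 - \<i> * of_real x) / of_real c) = 2 * (1 - cos x) / c" for x c
  proof -
    have "Re (iexp x - 1 - \<i> * of_real x) = cos x - 1"
      by (simp add: Re_exp)
    then show ?thesis
      unfolding Re_divide_of_real by (simp add: diff_divide_distrib right_diff_distrib)
  qed
  moreover have "- 2 * Re (of_real (- y\<^sup>2 / 2)) = y\<^sup>2" by simp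
  ultimately show ?thesis by (simp only:)
qed

text \<open>The quotient is dominated by \<open>(g x)\<^sup>2 / 2\<close>. The terms
  \<open>1\<close> and \<open>w * g x\<close> stay under the integral since \<open>N\<close> may be
  an infinite measure such as \<nu>, for which they need not be integrable on their own.\<close>

lemma iexp_second_order_integral:
  fixes g :: "'a \<Rightarrow> real" and u :: "nat \<Rightarrow> real"
  assumes [measurable]: "g \<in> borel_measurable N" and g2: "integrable N (\<lambda>x. (g x)\<^sup>2)"
  shows "complex_integrable N (\<lambda>x. iexp (w * g x) - 1 - \<i> * of_real (w * g x))"
    and "cmod (CLINT x|N. iexp (w * g x) - 1 - \<i> * of_real (w * g x)) \<le> w\<^sup>2 / 2 * (\<integral>x. (g x)\<^sup>2 \<partial>N)"
    and "u \<longlonglongrightarrow> 0 \<Longrightarrow> (\<And>n. u n \<noteq> 0) \<Longrightarrow>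
      (\<lambda>n. (CLINT x|N. iexp (u n * g x) - 1 - \<i> * of_real (u n * g x)) / of_real ((u n)\<^sup>2))
        \<longlonglongrightarrow> of_real (- (\<integral>x. (g x)\<^sup>2 \<partial>N) / 2)"
proof -
  have bound: "cmod (iexp (w * g x) - 1 - \<i> * of_real (w * g x)) \<le> w\<^sup>2 / 2 * (g x)\<^sup>2" for w x
    using iexp_second_order_bound[of "w * g x"] by (simp add: power_mult_distrib)
  show int: "complex_integrable N (\<lambda>x. iexp (w * g x) - 1 - \<i> * of_real (w * g x))" for w
    by (rule Bochner_Integration.integrable_bound[OF integrable_mult_right[OF g2, of "w\<^sup>2 / 2"]])
       (use bound[of w] in \<open>auto simp del: of_real_mult\<close>)
  show "cmod (CLINT x|N. iexp (w * g x) - 1 - \<i> * of_real (w * g x)) \<le> w\<^sup>2 / 2 * (\<integral>x. (g x)\<^sup>2 \<partial>N)"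
  proof -
    have "cmod (CLINT x|N. iexp (w * g x) - 1 - \<i> * of_real (w * g x))
        \<le> (\<integral>x. cmod (iexp (w * g x) - 1 - \<i> * of_real (w * g x)) \<partial>N)"
      by (rule integral_norm_bound)
    also have "\<dots> \<le> (\<integral>x. w\<^sup>2 / 2 * (g x)\<^sup>2 \<partial>N)"
      by (intro integral_mono integrable_norm int integrable_mult_right g2 bound)
    finally show ?thesis by simp
  qed
  assume u: "u \<longlonglongrightarrow> 0" "\<And>n. u n \<noteq> 0"
  have "(\<lambda>n. CLINT x|N. (iexp (u n * g x) - 1 - \<i> * of_real (u n * g x)) / of_real ((u n)\<^sup>2))
      \<longlonglongrightarrow> (CLINT x|N. of_real (- (g x)\<^sup>2 / 2))"
  proof (rule integral_dominated_convergence[where w = "\<lambda>x. (g x)\<^sup>2 / 2"])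
    show "AE x in N. (\<lambda>n. (iexp (u n * g x) - 1 - \<i> * of_real (u n * g x)) / of_real ((u n)\<^sup>2))
        \<longlonglongrightarrow> of_real (- (g x)\<^sup>2 / 2)"
      by (intro AE_I2 iexp_second_order_tendsto u)
    show "AE x in N. cmod ((iexp (u n * g x) - 1 - \<i> * of_real (u n * g x)) / of_real ((u n)\<^sup>2)) \<le> (g x)\<^sup>2 / 2" for n
    proof (rule AE_I2)
      fix x
      have "cmod ((iexp (u n * g x) - 1 - \<i> * of_real (u n * g x)) / of_real ((u n)\<^sup>2))
          = cmod (iexp (u n * g x) - 1 - \<i> * of_real (u n * g x)) / (u n)\<^sup>2"
        by (simp only: norm_divide norm_of_real abs_power2)
      also have "\<dots> \<le> ((u n)\<^sup>2 / 2 * (g x)\<^sup>2) / (u n)\<^sup>2"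
        by (intro divide_right_mono bound) simp
      finally show "cmod ((iexp (u n * g x) - 1 - \<i> * of_real (u n * g x)) / of_real ((u n)\<^sup>2)) \<le> (g x)\<^sup>2 / 2"
        using u(2)[of n] by simp
    qed
  qed (use g2 in auto)
  moreover have "(CLINT x|N. of_real (- (g x)\<^sup>2 / 2)) = of_real (- (\<integral>x. (g x)\<^sup>2 \<partial>N) / 2)"
    by (subst integral_complex_of_real) simp
  ultimately show "(\<lambda>n. (CLINT x|N. iexp (u n * g x) - 1 - \<i> * of_real (u n * g x)) / of_real ((u n)\<^sup>2))
        \<longlonglongrightarrow> of_real (- (\<integral>x. (g x)\<^sup>2 \<partial>N) / 2)"
    by (simp del: of_real_mult)
qed

text \<open>Multiplied by \<open>u n\<close>, the difference of the two quotients is the constant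
  \<open>\<i> * (m' - m)\<close> and tends to 0.\<close>

lemma second_order_expansion_unique:
  fixes c :: "nat \<Rightarrow> complex" and u :: "nat \<Rightarrow> real" and m m' a b :: real
  assumes u: "u \<longlonglongrightarrow> 0" "\<And>n. u n \<noteq> 0"
    and 1: "(\<lambda>n. (c n - \<i> * of_real (u n * m)) / of_real ((u n)\<^sup>2)) \<longlonglongrightarrow> of_real a"
    and 2: "(\<lambda>n. (c n - \<i> * of_real (u n * m')) / of_real ((u n)\<^sup>2)) \<longlonglongrightarrow> of_real b"
  shows "m = m'" "a = b"
proof -
  have "(\<lambda>n. of_real (u n) * ((c n - \<i> * of_real (u n * m)) / of_real ((u n)\<^sup>2) - (c n - \<i> * of_real (u n * m')) / of_real ((u n)\<^sup>2)))
     \<longlonglongrightarrow> of_real 0 * (of_real a - of_real b :: complex)"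
    by (intro tendsto_intros 1 2 u)
  moreover have "of_real (u n) * ((c n - \<i> * of_real (u n * m)) / of_real ((u n)\<^sup>2) - (c n - \<i> * of_real (u n * m')) / of_real ((u n)\<^sup>2))
      = \<i> * of_real (m' - m)" for n
    using u(2)[of n] by (simp add: field_simps power2_eq_square)
  ultimately have "\<i> * of_real (m' - m) = 0"
    by (simp add: LIMSEQ_const_iff)
  then show "m = m'"
    by (metis complex_i_not_zero eq_iff_diff_eq_0 mult_eq_0_iff of_real_eq_0_iff)
  with 1 2 show "a = b"
    using LIMSEQ_unique of_real_eq_iff by blast
qed

text \<open>Integrability of \<open>Y\<close> is part of the conclusion. The real part of the
  expansion says that the means of \<open>2 * (1 - cos (u n * Y)) / (u n)\<^sup>2\<close> tend to
  \<open>s\<close>, so Fatou's lemma bounds the second moment. Then the expansion also holds with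
  the true moments, and uniqueness identifies them.\<close>

lemma (in prob_space) moments_from_char_expansion:
  assumes Y [measurable]: "Y \<in> borel_measurable M"
    and u: "u \<longlonglongrightarrow> 0" "\<And>n. u n \<noteq> 0"
    and expansion: "(\<lambda>n. (char (distr M borel Y) (u n) - 1 - \<i> * of_real (u n * m)) / of_real ((u n)\<^sup>2))
      \<longlonglongrightarrow> of_real (- s / 2)"
  shows "integrable M (\<lambda>\<omega>. (Y \<omega>)\<^sup>2)" "expectation Y = m" "expectation (\<lambda>\<omega>. (Y \<omega>)\<^sup>2) = s"
proof -
  let ?q = "\<lambda>n \<omega>. 2 * (1 - cos (u n * Y \<omega>)) / (u n)\<^sup>2"
  have int_iexp: "complex_integrable M (\<lambda>\<omega>. iexp (t * Y \<omega>))" for t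
    by (intro integrable_iexp) auto
  have char: "char (distr M borel Y) t = (CLINT \<omega>|M. iexp (t * Y \<omega>))" for t
    by (simp add: char_def integral_distr)
  have int_cos: "integrable M (\<lambda>\<omega>. cos (t * Y \<omega>))" for t
    by (rule integrable_const_bound[of _ 1]) auto
  have int_q: "integrable M (?q n)" for n
    by (intro integrable_divide integrable_mult_right Bochner_Integration.integrable_diff int_cos) auto
  have Re_char: "Re (char (distr M borel Y) t) = (\<integral>\<omega>. cos (t * Y \<omega>) \<partial>M)" for t
    using integral_Re[OF int_iexp[of t]] by (simp add: char Re_exp)
  have "(\<lambda>n. - 2 * Re ((char (distr M borel Y) (u n) - 1 - \<i> * of_real (u n * m)) / of_real ((u n)\<^sup>2))) \<longlonglongrightarrow> - 2 * Re (of_real (- s / 2))"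
    by (intro tendsto_intros expansion)
  moreover have "- 2 * Re ((char (distr M borel Y) (u n) - 1 - \<i> * of_real (u n * m)) / of_real ((u n)\<^sup>2)) = expectation (?q n)" for n
  proof -
    have "Re ((char (distr M borel Y) (u n) - 1 - \<i> * of_real (u n * m)) / of_real ((u n)\<^sup>2))
        = ((\<integral>\<omega>. cos (u n * Y \<omega>) \<partial>M) - 1) / (u n)\<^sup>2"
      unfolding Re_divide_of_real by (simp add: Re_char)
    moreover have "expectation (?q n) = 2 * (1 - (\<integral>\<omega>. cos (u n * Y \<omega>) \<partial>M)) / (u n)\<^sup>2"
      by (simp add: int_cos prob_space)
    ultimately show ?thesis
      by (simp add: diff_divide_distrib right_diff_distrib)
  qed
  moreover have "- 2 * Re (of_real (- s / 2)) = s" by simp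
  ultimately have lim_q: "(\<lambda>n. expectation (?q n)) \<longlonglongrightarrow> s" by (simp only:)
  have q_lim: "(\<lambda>n. ?q n \<omega>) \<longlonglongrightarrow> (Y \<omega>)\<^sup>2" for \<omega>
    by (rule cos_second_order_tendsto[OF u])
  have "(\<integral>\<^sup>+\<omega>. ennreal ((Y \<omega>)\<^sup>2) \<partial>M) = (\<integral>\<^sup>+\<omega>. liminf (\<lambda>n. ennreal (?q n \<omega>)) \<partial>M)"
    by (intro nn_integral_cong lim_imp_Liminf[symmetric] tendsto_ennrealI q_lim) simp
  also have "\<dots> \<le> liminf (\<lambda>n. \<integral>\<^sup>+\<omega>. ennreal (?q n \<omega>) \<partial>M)"
    by (rule nn_integral_liminf) simp
  also have "\<dots> = liminf (\<lambda>n. ennreal (expectation (?q n)))"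
    by (intro arg_cong[where f = liminf] ext nn_integral_eq_integral int_q) auto
  also have "\<dots> = ennreal s"
    by (intro lim_imp_Liminf tendsto_ennrealI lim_q) simp
  finally show Y2: "integrable M (\<lambda>\<omega>. (Y \<omega>)\<^sup>2)"
    by (intro integrableI_nonneg) (auto simp: order_le_less_trans)
  then have Y1: "integrable M Y"
    by (rule square_integrable_imp_integrable[rotated]) simp
  have "(\<lambda>n. (char (distr M borel Y) (u n) - 1 - \<i> * of_real (u n * expectation Y)) / of_real ((u n)\<^sup>2))
      \<longlonglongrightarrow> of_real (- expectation (\<lambda>\<omega>. (Y \<omega>)\<^sup>2) / 2)"
  proof -
    have "(CLINT \<omega>|M. iexp (t * Y \<omega>) - 1 - \<i> * of_real (t * Y \<omega>)) = char (distr M borel Y) t - 1 - \<i> * of_real (t * expectation Y)" for t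
    proof -
      have "complex_integrable M (\<lambda>\<omega>. \<i> * of_real (t * Y \<omega>))"
        using Y1 by (intro integrable_mult_right integrable_of_real) auto
      moreover have "(CLINT \<omega>|M. \<i> * of_real (t * Y \<omega>)) = \<i> * of_real (t * expectation Y)"
        using integral_complex_of_real[of M "\<lambda>\<omega>. t * Y \<omega>"] by (simp del: of_real_mult)
      ultimately show ?thesis
        using int_iexp[of t] by (simp add: char prob_space del: of_real_mult)
    qed
    with iexp_second_order_integral(3)[OF Y Y2 u] show ?thesis by simp
  qed
  from second_order_expansion_unique[OF u this expansion]
  show "expectation Y = m" "expectation (\<lambda>\<omega>. (Y \<omega>)\<^sup>2) = s" by auto
qed

text \<open>Since \<open>p n / u n\<close> tends to \<open>\<i> * m\<close>, the quadratic term of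
  the exponential contributes \<open>- m\<^sup>2 / 2\<close> and the cubic remainder is negligible
  against \<open>(u n)\<^sup>2\<close>.\<close>

lemma exp_second_order_tendsto:
  fixes p :: "nat \<Rightarrow> complex" and u :: "nat \<Rightarrow> real"
  assumes u: "u \<longlonglongrightarrow> 0" "\<And>n. u n \<noteq> 0"
    and p: "(\<lambda>n. (p n - \<i> * of_real (u n * m)) / of_real ((u n)\<^sup>2)) \<longlonglongrightarrow> of_real a"
  shows "(\<lambda>n. (exp (p n) - 1 - \<i> * of_real (u n * m)) / of_real ((u n)\<^sup>2)) \<longlonglongrightarrow> of_real (a - m\<^sup>2 / 2)"
proof -
  have "(\<lambda>n. of_real (u n) * ((p n - \<i> * of_real (u n * m)) / of_real ((u n)\<^sup>2)) + \<i> * of_real m) \<longlonglongrightarrow> of_real 0 * of_real a + \<i> * of_real m"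
    by (intro tendsto_intros u p)
  moreover have "of_real (u n) * ((p n - \<i> * of_real (u n * m)) / of_real ((u n)\<^sup>2)) + \<i> * of_real m = p n / of_real (u n)" for n
    using u(2)[of n] by (simp add: field_simps power2_eq_square)
  ultimately have pu: "(\<lambda>n. p n / of_real (u n)) \<longlonglongrightarrow> \<i> * of_real m" by simp
  have "(\<lambda>n. of_real (u n) * (p n / of_real (u n))) \<longlonglongrightarrow> of_real 0 * (\<i> * of_real m)"
    by (intro tendsto_intros u pu)
  then have p0: "p \<longlonglongrightarrow> 0" using u(2) by simp
  have rest: "(\<lambda>n. (exp (p n) - 1 - p n - (p n)\<^sup>2 / 2) / of_real ((u n)\<^sup>2)) \<longlonglongrightarrow> 0"
  proof (rule Lim_null_comparison)
    show "\<forall>\<^sub>F n in sequentially. cmod ((exp (p n) - 1 - p n - (p n)\<^sup>2 / 2) / of_real ((u n)\<^sup>2))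
        \<le> exp \<bar>Re (p n)\<bar> * (cmod (p n / of_real (u n)))\<^sup>2 * cmod (p n) / 2"
    proof (rule always_eventually, rule allI)
      fix n
      have "cmod (exp (p n) - 1 - p n - (p n)\<^sup>2 / 2) \<le> exp \<bar>Re (p n)\<bar> * (cmod (p n)) ^ 3 / 2"
        using Taylor_exp[of "p n" 2] by (simp add: numeral_2_eq_2 numeral_3_eq_3 algebra_simps)
      then have "cmod (exp (p n) - 1 - p n - (p n)\<^sup>2 / 2) / (u n)\<^sup>2 \<le> exp \<bar>Re (p n)\<bar> * (cmod (p n)) ^ 3 / 2 / (u n)\<^sup>2"
        by (intro divide_right_mono) auto
      also have "\<dots> = exp \<bar>Re (p n)\<bar> * (cmod (p n / of_real (u n)))\<^sup>2 * cmod (p n) / 2"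
        by (simp add: norm_divide power_divide power3_eq_cube power2_eq_square)
      finally show "cmod ((exp (p n) - 1 - p n - (p n)\<^sup>2 / 2) / of_real ((u n)\<^sup>2))
        \<le> exp \<bar>Re (p n)\<bar> * (cmod (p n / of_real (u n)))\<^sup>2 * cmod (p n) / 2"
        by (simp only: norm_divide norm_of_real abs_power2)
    qed
    have "(\<lambda>n. exp \<bar>Re (p n)\<bar> * (cmod (p n / of_real (u n)))\<^sup>2 * cmod (p n) / 2)
        \<longlonglongrightarrow> exp \<bar>Re 0\<bar> * (cmod (\<i> * of_real m))\<^sup>2 * cmod 0 / 2"
      by (intro tendsto_intros p0 pu) auto
    then show "(\<lambda>n. exp \<bar>Re (p n)\<bar> * (cmod (p n / of_real (u n)))\<^sup>2 * cmod (p n) / 2) \<longlonglongrightarrow> 0" by simp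
  qed
  have "(\<lambda>n. (exp (p n) - 1 - p n - (p n)\<^sup>2 / 2) / of_real ((u n)\<^sup>2) + (p n - \<i> * of_real (u n * m)) / of_real ((u n)\<^sup>2)
      + (p n / of_real (u n))\<^sup>2 / 2) \<longlonglongrightarrow> 0 + of_real a + (\<i> * of_real m)\<^sup>2 / 2"
    by (intro tendsto_intros rest p pu) auto
  moreover have "(exp (p n) - 1 - p n - (p n)\<^sup>2 / 2) / of_real ((u n)\<^sup>2) + (p n - \<i> * of_real (u n * m)) / of_real ((u n)\<^sup>2)
      + (p n / of_real (u n))\<^sup>2 / 2 = (exp (p n) - 1 - \<i> * of_real (u n * m)) / of_real ((u n)\<^sup>2)" for n
    using u(2)[of n] by (simp add: field_simps)
  ultimately show ?thesis
    by (simp add: power_mult_distrib)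
qed

section \<open>Moments from the generating quadruple\<close>

context levy_setting
begin

text \<open>The mean per unit of control measure: the truncation in \<open>\<phi>\<close>
  compensates jumps up to 1, so only the larger ones add to \<gamma>.\<close>

definition levy_mean :: real where
  "levy_mean = \<gamma> + (\<integral>x. x * indicator {x. \<bar>x\<bar> > 1} x \<partial>\<nu>)"

definition levy_variance :: real where
  "levy_variance = (\<integral>x. x\<^sup>2 \<partial>\<nu>)"

lemma phi_expansion:
  assumes nu2: "integrable \<nu> (\<lambda>x. x\<^sup>2)"
  shows "\<phi> u = \<i> * of_real (u * levy_mean) + (CLINT x|\<nu>. iexp (u * x) - 1 - \<i> * of_real (u * x))"
proof -
  have int1: "integrable \<nu> (\<lambda>x. x * indicator {x. \<bar>x\<bar> > 1} x)"
  proof (rule Bochner_Integration.integrable_bound[OF nu2])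
    show "AE x in \<nu>. norm (x * indicator {x. \<bar>x\<bar> > 1} x) \<le> norm (x\<^sup>2)"
    proof (rule AE_I2)
      fix x :: real
      have "\<bar>x\<bar> \<le> x\<^sup>2" if "\<bar>x\<bar> > 1"
        using mult_left_mono[of 1 "\<bar>x\<bar>" "\<bar>x\<bar>"] that by (simp add: power2_eq_square abs_mult[symmetric])
      then show "norm (x * indicator {x. \<bar>x\<bar> > 1} x) \<le> norm (x\<^sup>2)"
        by (auto simp: indicator_def)
    qed
  qed measurable
  have meas: "(\<lambda>x::real. x) \<in> borel_measurable \<nu>" by measurable
  note int2 = iexp_second_order_integral(1)[OF meas nu2, of u]
  have int3: "complex_integrable \<nu> (\<lambda>x. \<i> * of_real (u * (x * indicator {x. \<bar>x\<bar> > 1} x)))"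
    by (intro integrable_mult_right integrable_of_real int1)
  have "(CLINT x|\<nu>. iexp (u * x) - 1 - \<i> * of_real (u * x * indicator {x. \<bar>x\<bar> \<le> 1} x))
     = (CLINT x|\<nu>. (iexp (u * x) - 1 - \<i> * of_real (u * x)) + \<i> * of_real (u * (x * indicator {x. \<bar>x\<bar> > 1} x)))"
    by (intro Bochner_Integration.integral_cong refl) (auto simp: indicator_def)
  also have "\<dots> = (CLINT x|\<nu>. iexp (u * x) - 1 - \<i> * of_real (u * x)) + \<i> * of_real (u * (\<integral>x. x * indicator {x. \<bar>x\<bar> > 1} x \<partial>\<nu>))"
    by (subst Bochner_Integration.integral_add[OF int2 int3])
       (simp del: of_real_mult add: integral_complex_of_real)
  finally show ?thesis
    by (simp add: levy_exponent_def levy_mean_def algebra_simps)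
qed

text \<open>Integrability of \<open>f\<close> lets the linear part of \<open>\<phi>\<close> be
  integrated exactly; the remainder is quadratic and dominated by a multiple of
  \<open>(f z)\<^sup>2\<close>. Exponentiating the resulting expansion gives that of the
  characteristic function.\<close>

theorem has_levy_integral_moments:
  assumes nu2: "integrable \<nu> (\<lambda>x. x\<^sup>2)"
    and Y: "has_levy_integral M \<Lambda> control f Y"
    and f1: "integrable control f" and f2: "integrable control (\<lambda>z. (f z)\<^sup>2)"
  shows "integrable M (\<lambda>\<omega>. (Y \<omega>)\<^sup>2)"
    and "expectation Y = levy_mean * (\<integral>z. f z \<partial>control)"
    and "expectation (\<lambda>\<omega>. (Y \<omega>)\<^sup>2) =
      levy_variance * (\<integral>z. (f z)\<^sup>2 \<partial>control) + (levy_mean * (\<integral>z. f z \<partial>control))\<^sup>2"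
proof -
  obtain U where U: "U > 0"
    "\<And>u. \<bar>u\<bar> \<le> U \<Longrightarrow> complex_integrable control (\<lambda>z. \<phi> (u * f z))"
    "\<And>u. \<bar>u\<bar> \<le> U \<Longrightarrow> char (distr M borel Y) u = exp (CLINT z|control. \<phi> (u * f z))"
    using has_levy_integral_char[OF Y] by metis
  have [measurable]: "Y \<in> borel_measurable M" "f \<in> borel_measurable borel"
    using Y by (auto simp: has_levy_integral_def)
  \<comment> \<open>A null sequence of nonzero points in the range where the exponent formula is
    available.\<close>
  define u where "u n = U / real (Suc n)" for n
  have u0: "u \<longlonglongrightarrow> 0"
    unfolding u_def by (rule LIMSEQ_Suc[OF lim_const_over_n]) 
  have un: "u n \<noteq> 0" "\<bar>u n\<bar> \<le> U" for n
    using U(1) by (auto simp: u_def field_simps)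
  \<comment> \<open>The fully compensated exponent, of order \<open>w\<^sup>2\<close> at every scale
    and not only near 0.\<close>
  define \<eta> where "\<eta> w = (CLINT x|\<nu>. iexp (w * x) - 1 - \<i> * of_real (w * x))" for w
  have meas: "(\<lambda>x::real. x) \<in> borel_measurable \<nu>" by measurable
  have \<eta>_bound: "cmod (\<eta> w) \<le> w\<^sup>2 / 2 * levy_variance" for w
    unfolding \<eta>_def levy_variance_def by (rule iexp_second_order_integral(2)[OF meas nu2])
  have \<eta>_lim: "(\<lambda>n. \<eta> (v n) / of_real ((v n)\<^sup>2)) \<longlonglongrightarrow> of_real (- levy_variance / 2)"
    if "v \<longlonglongrightarrow> 0" "\<And>n. v n \<noteq> 0" for v
    unfolding \<eta>_def levy_variance_def by (rule iexp_second_order_integral(3)[OF meas nu2 that])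
  have \<phi>_\<eta>: "\<phi> w = \<i> * of_real (w * levy_mean) + \<eta> w" for w
    unfolding \<eta>_def by (rule phi_expansion[OF nu2])
  have \<eta>_eq: "\<eta> = (\<lambda>w. \<phi> w - \<i> * of_real (w * levy_mean))"
    by (simp add: \<phi>_\<eta> fun_eq_iff)
  have [measurable]: "\<eta> \<in> borel_measurable borel"
    unfolding \<eta>_eq by measurable
  let ?m = "levy_mean * (\<integral>z. f z \<partial>control)"
  have int_lin: "complex_integrable control (\<lambda>z. \<i> * of_real (w * f z * levy_mean))" for w
    by (intro integrable_mult_right integrable_of_real integrable_mult_left f1)
  have rest: "(CLINT z|control. \<phi> (u n * f z)) - \<i> * of_real (u n * ?m) = (CLINT z|control. \<eta> (u n * f z))" for n
  proof -
    have "(CLINT z|control. \<eta> (u n * f z)) = (CLINT z|control. \<phi> (u n * f z)) - (CLINT z|control. \<i> * of_real (u n * f z * levy_mean))"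
      unfolding \<eta>_eq by (rule Bochner_Integration.integral_diff[OF U(2)[OF un(2)] int_lin])
    also have "(CLINT z|control. \<i> * of_real (u n * f z * levy_mean)) = \<i> * of_real (u n * ?m)"
      by (simp del: of_real_mult add: integral_complex_of_real)
    finally show ?thesis by simp
  qed
  have "(\<lambda>n. CLINT z|control. \<eta> (u n * f z) / of_real ((u n)\<^sup>2)) \<longlonglongrightarrow> (CLINT z|control. of_real (- levy_variance / 2 * (f z)\<^sup>2))"
  proof (rule integral_dominated_convergence[where w = "\<lambda>z. levy_variance / 2 * (f z)\<^sup>2"])
    show "AE z in control. (\<lambda>n. \<eta> (u n * f z) / of_real ((u n)\<^sup>2)) \<longlonglongrightarrow> of_real (- levy_variance / 2 * (f z)\<^sup>2)"
    proof (rule AE_I2)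
      fix z
      show "(\<lambda>n. \<eta> (u n * f z) / of_real ((u n)\<^sup>2)) \<longlonglongrightarrow> of_real (- levy_variance / 2 * (f z)\<^sup>2)"
      proof (cases "f z = 0")
        case True
        then show ?thesis by (simp add: \<eta>_def)
      next
        case False
        have "(\<lambda>n. \<eta> (u n * f z) / of_real ((u n * f z)\<^sup>2) * of_real ((f z)\<^sup>2)) \<longlonglongrightarrow> of_real (- levy_variance / 2) * of_real ((f z)\<^sup>2)"
          by (intro tendsto_mult tendsto_const \<eta>_lim) (use u0 un False in \<open>auto intro!: tendsto_eq_intros\<close>)
        with False show ?thesis
          by (simp add: power_mult_distrib)
      qed
    qed
    show "AE z in control. cmod (\<eta> (u n * f z) / of_real ((u n)\<^sup>2)) \<le> levy_variance / 2 * (f z)\<^sup>2" for n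
    proof (rule AE_I2)
      fix z
      have "cmod (\<eta> (u n * f z) / of_real ((u n)\<^sup>2)) = cmod (\<eta> (u n * f z)) / (u n)\<^sup>2"
        by (simp only: norm_divide norm_of_real abs_power2)
      also have "\<dots> \<le> ((u n * f z)\<^sup>2 / 2 * levy_variance) / (u n)\<^sup>2"
        by (intro divide_right_mono \<eta>_bound) simp
      finally show "cmod (\<eta> (u n * f z) / of_real ((u n)\<^sup>2)) \<le> levy_variance / 2 * (f z)\<^sup>2"
        using un(1)[of n] by (simp add: power_mult_distrib mult_ac)
    qed
  qed (use f2 in \<open>auto intro!: integrable_mult_right\<close>)
  then have "(\<lambda>n. (CLINT z|control. \<eta> (u n * f z)) / of_real ((u n)\<^sup>2)) \<longlonglongrightarrow> of_real (- levy_variance / 2 * (\<integral>z. (f z)\<^sup>2 \<partial>control))"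
    by (subst (asm) integral_complex_of_real) (simp del: of_real_mult)
  then have "(\<lambda>n. ((CLINT z|control. \<phi> (u n * f z)) - \<i> * of_real (u n * ?m)) / of_real ((u n)\<^sup>2)) \<longlonglongrightarrow> of_real (- levy_variance / 2 * (\<integral>z. (f z)\<^sup>2 \<partial>control))"
    by (simp only: rest)
  from exp_second_order_tendsto[OF u0 un(1) this]
  have "(\<lambda>n. (char (distr M borel Y) (u n) - 1 - \<i> * of_real (u n * ?m)) / of_real ((u n)\<^sup>2))
    \<longlonglongrightarrow> of_real (- (levy_variance * (\<integral>z. (f z)\<^sup>2 \<partial>control) + ?m\<^sup>2) / 2)"
    by (simp only: U(3)[OF un(2)]) (simp add: diff_divide_distrib add_divide_distrib)
  from moments_from_char_expansion[OF _ u0 un(1) this]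
  show "integrable M (\<lambda>\<omega>. (Y \<omega>)\<^sup>2)" "expectation Y = ?m"
    "expectation (\<lambda>\<omega>. (Y \<omega>)\<^sup>2) = levy_variance * (\<integral>z. (f z)\<^sup>2 \<partial>control) + ?m\<^sup>2"
    by auto
qed

text \<open>Over a set of control measure 1 the exponent is \<open>\<phi>\<close> itself. The second
  moment of \<open>Y\<close> keeps the characteristic function near 1 to second order, which bounds
  \<open>- Re (\<phi> u)\<close> by a multiple of \<open>u\<^sup>2\<close>; Fatou's lemma turns this
  into a bound on the second moment of \<nu>.\<close>

lemma levy_second_moment:
  assumes Y: "has_levy_integral M \<Lambda> control (indicator S) Y"
    and S: "S \<in> sets borel" "measure control S = 1"
    and Y2: "integrable M (\<lambda>\<omega>. (Y \<omega>)\<^sup>2)"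
  shows "integrable \<nu> (\<lambda>x. x\<^sup>2)"
proof -
  obtain U where U: "U > 0"
    "\<And>u. \<bar>u\<bar> \<le> U \<Longrightarrow> char (distr M borel Y) u = exp (CLINT z|control. \<phi> (u * indicator S z))"
    using has_levy_integral_char[OF Y] by metis
  have [measurable]: "Y \<in> borel_measurable M"
    using Y by (auto simp: has_levy_integral_def)
  let ?E = "expectation (\<lambda>\<omega>. (Y \<omega>)\<^sup>2)"
  have char: "char (distr M borel Y) t = (CLINT \<omega>|M. iexp (t * Y \<omega>))" for t
    by (simp add: char_def integral_distr)
  have int_iexp: "complex_integrable M (\<lambda>\<omega>. iexp (t * Y \<omega>))" for t
    by (intro integrable_iexp) auto
  have Re_char: "Re (char (distr M borel Y) u) \<ge> 1 - u\<^sup>2 / 2 * ?E" for u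
  proof -
    have "(\<integral>\<omega>. 1 - u\<^sup>2 / 2 * (Y \<omega>)\<^sup>2 \<partial>M) \<le> (\<integral>\<omega>. Re (iexp (u * Y \<omega>)) \<partial>M)"
    proof (rule integral_mono)
      show "1 - u\<^sup>2 / 2 * (Y \<omega>)\<^sup>2 \<le> Re (iexp (u * Y \<omega>))" for \<omega>
        using abs_Re_le_cmod[of "iexp (u * Y \<omega>) - 1 - \<i> * of_real (u * Y \<omega>)"]
          iexp_second_order_bound[of "u * Y \<omega>"] by (simp add: power_mult_distrib abs_le_iff)
    qed (use Y2 int_iexp in \<open>auto intro!: integrable_Re\<close>)
    then show ?thesis
      using Y2 integral_Re[OF int_iexp[of u]] by (simp add: char prob_space)
  qed
  \<comment> \<open>The condition \<open>u\<^sup>2 * ?E \<le> 1\<close> keeps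
    \<open>exp (Re (\<phi> u))\<close> above 1/2, so that
    \<open>- x \<le> (1 - exp x) / exp x\<close> is usable with a bounded denominator.\<close>
  have exponent: "- Re (\<phi> u) \<le> u\<^sup>2 * ?E" if u: "\<bar>u\<bar> \<le> U" "u\<^sup>2 * ?E \<le> 1" for u
  proof -
    have S': "S \<in> sets control"
      by (simp only: sets_control S)
    have "emeasure control S \<noteq> \<infinity>"
      using S(2) by (auto simp: measure_def)
    then have "integrable control (indicator S :: _ \<Rightarrow> real)"
      using S' by (simp add: less_top[symmetric])
    moreover have "\<phi> (u * indicator S z) = indicator S z *\<^sub>R \<phi> u" for z
      by (auto simp: indicator_def)
    ultimately have "(CLINT z|control. \<phi> (u * indicator S z)) = (\<integral>z. indicator S z \<partial>control) *\<^sub>R \<phi> u"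
      by (simp only: integral_scaleR_left)
    also have "\<dots> = \<phi> u"
      using S(2) by (simp only: Bochner_Integration.integral_indicator space_control Int_UNIV_right scaleR_one)
    finally have "(CLINT z|control. \<phi> (u * indicator S z)) = \<phi> u" .
    then have "cmod (char (distr M borel Y) u) = exp (Re (\<phi> u))"
      by (simp add: U(2)[OF u(1)])
    then have q: "1 - u\<^sup>2 / 2 * ?E \<le> exp (Re (\<phi> u))"
      using Re_char[of u] complex_Re_le_cmod[of "char (distr M borel Y) u"] by simp
    then have "1 / 2 \<le> exp (Re (\<phi> u))"
      using u(2) by simp
    have "- Re (\<phi> u) \<le> exp (- Re (\<phi> u)) - 1"
      using exp_ge_add_one_self[of "- Re (\<phi> u)"] by simp
    also have "\<dots> = (1 - exp (Re (\<phi> u))) / exp (Re (\<phi> u))"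
      by (simp add: exp_minus field_simps)
    also have "\<dots> \<le> (u\<^sup>2 / 2 * ?E) / (1 / 2)"
      by (rule frac_le) (use q \<open>1 / 2 \<le> exp (Re (\<phi> u))\<close> in auto)
    finally show ?thesis by simp
  qed
  define u where "u n = U / real (Suc n)" for n
  have u0: "u \<longlonglongrightarrow> 0"
    unfolding u_def by (rule LIMSEQ_Suc[OF lim_const_over_n])
  have un: "u n \<noteq> 0" "\<bar>u n\<bar> \<le> U" for n
    using U(1) by (auto simp: u_def field_simps)
  have "(\<lambda>n. (u n)\<^sup>2 * ?E) \<longlonglongrightarrow> 0"
    using u0 by (auto intro!: tendsto_eq_intros)
  then have ev: "\<forall>\<^sub>F n in sequentially. (u n)\<^sup>2 * ?E < 1"
    by (rule order_tendstoD) simp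
  let ?q = "\<lambda>n x. 2 * (1 - cos (u n * x)) / (u n)\<^sup>2"
  have q_lim: "(\<lambda>n. ?q n x) \<longlonglongrightarrow> x\<^sup>2" for x
    by (rule cos_second_order_tendsto[OF u0 un(1)])
  have "(\<integral>\<^sup>+x. ennreal (x\<^sup>2) \<partial>\<nu>) = (\<integral>\<^sup>+x. liminf (\<lambda>n. ennreal (?q n x)) \<partial>\<nu>)"
    by (intro nn_integral_cong lim_imp_Liminf[symmetric] tendsto_ennrealI q_lim) simp
  also have "\<dots> \<le> liminf (\<lambda>n. \<integral>\<^sup>+x. ennreal (?q n x) \<partial>\<nu>)"
    by (rule nn_integral_liminf) simp
  also have "\<dots> \<le> limsup (\<lambda>n. \<integral>\<^sup>+x. ennreal (?q n x) \<partial>\<nu>)"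
    by (rule Liminf_le_Limsup) simp
  also have "\<dots> \<le> ennreal (2 * ?E)"
  proof (rule Limsup_bounded)
    show "\<forall>\<^sub>F n in sequentially. (\<integral>\<^sup>+x. ennreal (?q n x) \<partial>\<nu>) \<le> ennreal (2 * ?E)"
      using ev
    proof eventually_elim
      case (elim n)
      have "(\<integral>\<^sup>+x. ennreal (?q n x) \<partial>\<nu>) = ennreal (\<integral>x. ?q n x \<partial>\<nu>)"
        by (intro nn_integral_eq_integral integrable_divide integrable_mult_right integrable_one_minus_cos) auto
      also have "(\<integral>x. ?q n x \<partial>\<nu>) = 2 * (- Re (\<phi> (u n))) / (u n)\<^sup>2"
        by (simp only: integral_divide_zero integral_mult_right_zero integral_one_minus_cos)
      also have "\<dots> \<le> 2 * ((u n)\<^sup>2 * ?E) / (u n)\<^sup>2"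
        using exponent[OF un(2)[of n]] elim by (intro divide_right_mono mult_left_mono) auto
      also have "\<dots> = 2 * ?E"
        using un(1)[of n] by simp
      finally show ?case by (simp add: ennreal_leI)
    qed
  qed
  finally show ?thesis
    by (intro integrableI_nonneg) (auto simp: order_le_less_trans)
qed

end

section \<open>The supOU kernel\<close>

lemma nn_integral_exp_kernel:
  fixes a t :: real
  assumes "a < 0"
  shows "(\<integral>\<^sup>+r. ennreal (indicator {..t} r * exp (a * (t - r))) \<partial>lborel) = ennreal (- 1 / a)"
proof -
  have "(\<integral>\<^sup>+r. ennreal (indicator {..t} r * exp (a * (t - r))) \<partial>lborel)
      = (\<integral>\<^sup>+x. ennreal (exp (a * x)) * indicator {0..} x \<partial>lborel)"
    by (subst nn_integral_real_affine[where c = "-1" and t = t])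
       (auto intro!: nn_integral_cong simp: indicator_def)
  also have "\<dots> = ennreal (0 - exp (a * 0) / a)"
  proof (rule nn_integral_FTC_atLeast[where F = "\<lambda>x. exp (a * x) / a"])
    show "DERIV (\<lambda>x. exp (a * x) / a) x :> exp (a * x)" for x
      using assms by (auto intro!: derivative_eq_intros)
    have "filterlim (\<lambda>x. a * x) at_bot at_top"
      using assms by (intro filterlim_tendsto_neg_mult_at_bot[OF tendsto_const]) (auto simp: filterlim_ident)
    then show "((\<lambda>x. exp (a * x) / a) \<longlongrightarrow> 0) at_top"
      by (intro tendsto_divide_zero filterlim_compose[OF exp_at_bot])
  qed auto
  finally show ?thesis by simp
qed

lemma nn_integral_powr_exp:
  fixes p c :: real
  assumes "p > 0" "c > 0"
  shows "(\<integral>\<^sup>+x. ennreal (indicator {0..} x * x powr (p - 1) * exp (- (c * x))) \<partial>lborel) = ennreal (Gamma p * c powr - p)"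
proof -
  let ?I = "\<integral>\<^sup>+x. ennreal (indicator {0..} x * x powr (p - 1) * exp (- (c * x))) \<partial>lborel"
  have "ennreal (Gamma p) = (\<integral>\<^sup>+t. ennreal (indicator {0..} t * t powr (p - 1) / exp t) \<partial>lborel)"
    by (rule Gamma_conv_nn_integral_real[OF assms(1)])
  also have "\<dots> = ennreal \<bar>c\<bar> * (\<integral>\<^sup>+x. ennreal (indicator {0..} (0 + c * x) * (0 + c * x) powr (p - 1) / exp (0 + c * x)) \<partial>lborel)"
    by (rule nn_integral_real_affine) (use assms in auto)
  also have "(\<integral>\<^sup>+x. ennreal (indicator {0..} (0 + c * x) * (0 + c * x) powr (p - 1) / exp (0 + c * x)) \<partial>lborel)
      = (\<integral>\<^sup>+x. ennreal (c powr (p - 1)) * ennreal (indicator {0..} x * x powr (p - 1) * exp (- (c * x))) \<partial>lborel)"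
  proof (rule nn_integral_cong)
    fix x :: real
    show "ennreal (indicator {0..} (0 + c * x) * (0 + c * x) powr (p - 1) / exp (0 + c * x))
      = ennreal (c powr (p - 1)) * ennreal (indicator {0..} x * x powr (p - 1) * exp (- (c * x)))"
    proof (cases "x \<ge> 0")
      case True
      with assms show ?thesis
        by (simp add: ennreal_mult'[symmetric] powr_mult exp_minus field_simps)
    next
      case False
      with assms show ?thesis
        by (simp add: zero_le_mult_iff)
    qed
  qed
  also have "\<dots> = ennreal (c powr (p - 1)) * ?I"
    by (rule nn_integral_cmult) simp
  finally have *: "ennreal (Gamma p) = ennreal c * (ennreal (c powr (p - 1)) * ?I)"
    using assms by simp
  have "c * c powr (p - 1) = c powr p"
    using assms by (simp add: powr_diff)
  then have "ennreal (Gamma p) = ennreal (c powr p) * ?I"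
    using * assms by (simp add: mult.assoc[symmetric] ennreal_mult''[symmetric])
  then have "ennreal (c powr - p) * ennreal (Gamma p) = ennreal (c powr - p) * ennreal (c powr p) * ?I"
    by (simp add: mult.assoc)
  also have "ennreal (c powr - p) * ennreal (c powr p) = 1"
    using assms by (simp add: ennreal_mult''[symmetric] powr_add[symmetric])
  finally show ?thesis
    using assms by (simp add: ennreal_mult''[symmetric] mult.commute)
qed

text \<open>Dividing by \<open>- a\<close> lowers the power in the Gamma density by one; the
  remaining Gamma integral is finite as \<alpha> exceeds 1 and leaves the factor
  \<open>\<alpha> - 1\<close>. The exponential raises the rate from 1 to
  \<open>1 - B * \<tau>\<close>.\<close>

lemma nn_integral_mean_reversion_law:
  fixes \<alpha> B \<tau> :: real
  assumes "\<alpha> > 1" "B < 0" "\<tau> \<ge> 0"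
  shows "(\<integral>\<^sup>+a. ennreal (exp (a * \<tau>) / - a) \<partial>mean_reversion_law \<alpha> B) =
    ennreal ((1 - B * \<tau>) powr (1 - \<alpha>) / (- B * (\<alpha> - 1)))"
proof -
  let ?c = "1 - B * \<tau>"
  have c: "?c > 0"
    using assms mult_nonpos_nonneg[of B \<tau>] by linarith
  have G: "Gamma \<alpha> = (\<alpha> - 1) * Gamma (\<alpha> - 1)" "Gamma (\<alpha> - 1) > 0" "Gamma \<alpha> > 0"
    using Gamma_plus1[of "\<alpha> - 1"] assms by (auto simp: nonpos_Ints_def)
  have "(\<integral>\<^sup>+a. ennreal (exp (a * \<tau>) / - a) \<partial>mean_reversion_law \<alpha> B)
      = (\<integral>\<^sup>+x. ennreal (exp (B * x * \<tau>) / - (B * x)) \<partial>gamma_distribution \<alpha>)"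
    unfolding mean_reversion_law_def
    by (subst nn_integral_distr) (auto simp: gamma_distribution_def)
  also have "\<dots> = (\<integral>\<^sup>+x. ennreal (if x > 0 then x powr (\<alpha> - 1) * exp (- x) / Gamma \<alpha> else 0) *
      ennreal (exp (B * x * \<tau>) / - (B * x)) \<partial>lborel)"
    unfolding gamma_distribution_def by (subst nn_integral_density) auto
  also have "\<dots> = (\<integral>\<^sup>+x. ennreal (1 / (- B * Gamma \<alpha>)) *
      ennreal (indicator {0..} x * x powr (\<alpha> - 1 - 1) * exp (- (?c * x))) \<partial>lborel)"
  proof (rule nn_integral_cong)
    fix x :: real
    consider "x < 0" | "x = 0" | "x > 0" by linarith
    then show "ennreal (if x > 0 then x powr (\<alpha> - 1) * exp (- x) / Gamma \<alpha> else 0) *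
      ennreal (exp (B * x * \<tau>) / - (B * x)) = ennreal (1 / (- B * Gamma \<alpha>)) *
      ennreal (indicator {0..} x * x powr (\<alpha> - 1 - 1) * exp (- (?c * x)))"
    proof cases
      case 3
      have e: "exp (- (?c * x)) = exp (- x) * exp (B * x * \<tau>)"
        by (simp add: exp_add[symmetric] algebra_simps)
      have p: "x powr (\<alpha> - 1) = x * x powr (\<alpha> - 1 - 1)"
        using 3 powr_diff[of x "\<alpha> - 1" 1] by simp
      have "x powr (\<alpha> - 1) * exp (- x) / Gamma \<alpha> * (exp (B * x * \<tau>) / - (B * x))
          = 1 / (- B * Gamma \<alpha>) * (x powr (\<alpha> - 1 - 1) * exp (- (?c * x)))"
        unfolding e p using 3 assms G(3) by (simp add: field_simps)
      moreover have "exp (B * x * \<tau>) / - (B * x) \<ge> 0" "1 / (- B * Gamma \<alpha>) \<ge> 0"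
        using 3 assms G(3) by (auto intro!: divide_nonneg_nonneg simp: mult_nonpos_nonneg divide_nonneg_neg mult_neg_pos)
      ultimately show ?thesis
        using 3 G(3) by (simp only: ennreal_mult'[symmetric] if_True indicator_simps atLeast_iff less_imp_le mult_1 ennreal_mult''[symmetric])
    qed auto
  qed
  also have "\<dots> = ennreal (1 / (- B * Gamma \<alpha>)) * ennreal (Gamma (\<alpha> - 1) * ?c powr - (\<alpha> - 1))"
  proof -
    have "\<alpha> - 1 > 0" using assms by simp
    from nn_integral_powr_exp[OF this c] show ?thesis
      by (subst nn_integral_cmult) auto
  qed
  also have "\<dots> = ennreal (1 / (- B * Gamma \<alpha>) * (Gamma (\<alpha> - 1) * ?c powr - (\<alpha> - 1)))"
    using G by (intro ennreal_mult''[symmetric]) simp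
  also have "1 / (- B * Gamma \<alpha>) * (Gamma (\<alpha> - 1) * ?c powr - (\<alpha> - 1)) = ?c powr (1 - \<alpha>) / (- B * (\<alpha> - 1))"
    unfolding G(1) using less_imp_neq[OF G(2)] assms by (simp add: divide_simps)
  finally show ?thesis .
qed

lemma supOU_kernel_nonneg: "0 \<le> supOU_kernel t z"
  by (cases z) (simp add: supOU_kernel_def)

lemma supOU_kernel_measurable [measurable]: "supOU_kernel t \<in> borel_measurable borel"
proof -
  have "(\<lambda>z::real \<times> real. if fst z < 0 \<and> snd z \<le> t then exp (fst z * (t - snd z)) else 0) \<in> borel_measurable borel"
    by (subst borel_prod[symmetric]) measurable
  then show ?thesis
    by (simp add: supOU_kernel_def[abs_def] case_prod_unfold)
qed

context levy_setting
begin

lemma nn_integral_control: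
  assumes [measurable]: "f \<in> borel_measurable borel"
  shows "(\<integral>\<^sup>+z. f z \<partial>control) = (\<integral>\<^sup>+a. \<integral>\<^sup>+r. f (a, r) \<partial>lborel \<partial>\<pi>)"
  by (subst lborel.nn_integral_fst[symmetric]) auto

lemma nn_integral_supOU_kernel:
  "(\<integral>\<^sup>+z. ennreal (supOU_kernel t z) \<partial>control) = (\<integral>\<^sup>+a. ennreal (1 / - a) \<partial>\<pi>)"
proof -
  have "(\<integral>\<^sup>+z. ennreal (supOU_kernel t z) \<partial>control) = (\<integral>\<^sup>+a. \<integral>\<^sup>+r. ennreal (supOU_kernel t (a, r)) \<partial>lborel \<partial>\<pi>)"
    by (rule nn_integral_control) measurable
  also have "\<dots> = (\<integral>\<^sup>+a. ennreal (1 / - a) \<partial>\<pi>)"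
  proof (rule nn_integral_cong_AE, use AE_pi_negative in eventually_elim)
    case (elim a)
    have "(\<integral>\<^sup>+r. ennreal (supOU_kernel t (a, r)) \<partial>lborel) = (\<integral>\<^sup>+r. ennreal (indicator {..t} r * exp (a * (t - r))) \<partial>lborel)"
      using elim by (intro nn_integral_cong) (auto simp: supOU_kernel_def)
    then show ?case
      using nn_integral_exp_kernel[OF elim, of t] by simp
  qed
  finally show ?thesis .
qed

text \<open>The product lives on times up to \<open>s\<close>, where it splits into
  \<open>exp (a * (t - s))\<close> and \<open>exp (2 * a * (s - r))\<close>; the doubled rate is the
  origin of the factor 1/2.\<close>

lemma nn_integral_supOU_kernel_mult:
  assumes "s \<le> t"
  shows "(\<integral>\<^sup>+z. ennreal (supOU_kernel s z * supOU_kernel t z) \<partial>control) =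
    (\<integral>\<^sup>+a. ennreal (exp (a * (t - s)) / - a) \<partial>\<pi>) * ennreal (1 / 2)"
proof -
  have "(\<integral>\<^sup>+z. ennreal (supOU_kernel s z * supOU_kernel t z) \<partial>control)
      = (\<integral>\<^sup>+a. \<integral>\<^sup>+r. ennreal (supOU_kernel s (a, r) * supOU_kernel t (a, r)) \<partial>lborel \<partial>\<pi>)"
    by (rule nn_integral_control) measurable
  also have "\<dots> = (\<integral>\<^sup>+a. ennreal (exp (a * (t - s)) / - a) * ennreal (1 / 2) \<partial>\<pi>)"
  proof (rule nn_integral_cong_AE, use AE_pi_negative in eventually_elim)
    case (elim a)
    have "(\<integral>\<^sup>+r. ennreal (supOU_kernel s (a, r) * supOU_kernel t (a, r)) \<partial>lborel)
        = (\<integral>\<^sup>+r. ennreal (exp (a * (t - s))) * ennreal (indicator {..s} r * exp (2 * a * (s - r))) \<partial>lborel)"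
      using elim assms
      by (intro nn_integral_cong)
         (auto simp: supOU_kernel_def indicator_def ennreal_mult'[symmetric] exp_add[symmetric] algebra_simps)
    also have "\<dots> = ennreal (exp (a * (t - s))) * ennreal (- 1 / (2 * a))"
      using elim by (subst nn_integral_cmult) (auto simp: nn_integral_exp_kernel)
    also have "\<dots> = ennreal (exp (a * (t - s)) / - a) * ennreal (1 / 2)"
    proof -
      have "exp (a * (t - s)) * (- 1 / (2 * a)) = exp (a * (t - s)) / - a * (1 / 2)"
        using elim by simp
      moreover have "0 \<le> - 1 / (2 * a)"
        using elim by (simp add: divide_nonpos_neg)
      ultimately show ?thesis
        by (metis ennreal_mult'' zero_le_divide_1_iff zero_le_numeral)
    qed
    finally show ?case .
  qed
  also have "\<dots> = (\<integral>\<^sup>+a. ennreal (exp (a * (t - s)) / - a) \<partial>\<pi>) * ennreal (1 / 2)"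
    by (rule nn_integral_multc) measurable
  finally show ?thesis .
qed

end

section \<open>Moments of the supOU process with Gamma mean reversion\<close>

locale gamma_supOU = levy_setting +
  fixes \<alpha> B :: real and X :: "real \<Rightarrow> 'a \<Rightarrow> real"
  assumes pi_eq: "\<pi> = mean_reversion_law \<alpha> B" and \<alpha>: "\<alpha> > 1" and B: "B < 0"
    and X: "\<And>t. has_levy_integral M \<Lambda> control (supOU_kernel t) (X t)"
    and nu2: "integrable \<nu> (\<lambda>x. x\<^sup>2)"
begin

lemmas nn_integral_pi = nn_integral_mean_reversion_law[OF \<alpha> B, folded pi_eq]

lemma kernel_integral: "has_bochner_integral control (supOU_kernel t) (1 / (- B * (\<alpha> - 1)))"
proof (rule has_bochner_integral_nn_integral)
  show "(\<integral>\<^sup>+z. ennreal (supOU_kernel t z) \<partial>control) = ennreal (1 / (- B * (\<alpha> - 1)))"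
    using nn_integral_pi[of 0] by (simp add: nn_integral_supOU_kernel)
  show "0 \<le> 1 / (- B * (\<alpha> - 1))"
    using \<alpha> B by (intro divide_nonneg_nonneg mult_nonneg_nonneg) auto
qed (auto simp: supOU_kernel_nonneg)

lemma kernel_mult_integral:
  "has_bochner_integral control (\<lambda>z. supOU_kernel s z * supOU_kernel t z)
    ((1 - B * \<bar>t - s\<bar>) powr (1 - \<alpha>) / (- B * (\<alpha> - 1)) / 2)"
proof -
  have *: "has_bochner_integral control (\<lambda>z. supOU_kernel s z * supOU_kernel t z)
    ((1 - B * (t - s)) powr (1 - \<alpha>) / (- B * (\<alpha> - 1)) / 2)" if "s \<le> t" for s t
  proof (rule has_bochner_integral_nn_integral)
    have nonneg: "0 \<le> (1 - B * (t - s)) powr (1 - \<alpha>) / (- B * (\<alpha> - 1))"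
      using \<alpha> B by (intro divide_nonneg_nonneg mult_nonneg_nonneg) auto
    then show "0 \<le> (1 - B * (t - s)) powr (1 - \<alpha>) / (- B * (\<alpha> - 1)) / 2"
      by (rule divide_nonneg_nonneg) simp
    have "(\<integral>\<^sup>+z. ennreal (supOU_kernel s z * supOU_kernel t z) \<partial>control)
       = ennreal ((1 - B * (t - s)) powr (1 - \<alpha>) / (- B * (\<alpha> - 1))) * ennreal (1 / 2)"
      using nn_integral_pi[of "t - s"] that
      by (simp only: nn_integral_supOU_kernel_mult[OF that] diff_ge_0_iff_ge)
    also have "\<dots> = ennreal ((1 - B * (t - s)) powr (1 - \<alpha>) / (- B * (\<alpha> - 1)) * (1 / 2))"
      by (rule ennreal_mult[symmetric, OF nonneg]) simp
    finally show "(\<integral>\<^sup>+z. ennreal (supOU_kernel s z * supOU_kernel t z) \<partial>control)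
       = ennreal ((1 - B * (t - s)) powr (1 - \<alpha>) / (- B * (\<alpha> - 1)) / 2)" by simp
  qed (auto simp: supOU_kernel_nonneg)
  show ?thesis
  proof (cases "s \<le> t")
    case True
    with *[OF True] show ?thesis by simp
  next
    case False
    then have "(\<lambda>z. supOU_kernel s z * supOU_kernel t z) = (\<lambda>z. supOU_kernel t z * supOU_kernel s z)"
        "t \<le> s" "\<bar>t - s\<bar> = s - t"
      by (auto simp: mult.commute)
    with *[of t s] show ?thesis by simp
  qed
qed

lemma X_measurable [measurable]: "X t \<in> borel_measurable M"
  using X[of t] by (simp add: has_levy_integral_def)

lemma kernel_square_integral:
  "has_bochner_integral control (\<lambda>z. (supOU_kernel t z)\<^sup>2) (1 / (- B * (\<alpha> - 1)) / 2)"
  using kernel_mult_integral[of t t] by (simp add: power2_eq_square)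

lemma X_moments:
  shows "integrable M (\<lambda>\<omega>. (X t \<omega>)\<^sup>2)"
    and "expectation (X t) = levy_mean / (- B * (\<alpha> - 1))"
    and "expectation (\<lambda>\<omega>. (X t \<omega>)\<^sup>2) = levy_variance / (- B * (\<alpha> - 1)) / 2 + (levy_mean / (- B * (\<alpha> - 1)))\<^sup>2"
  using has_levy_integral_moments[OF nu2 X, of t]
    has_bochner_integral_integral_eq[OF kernel_integral[of t]]
    has_bochner_integral_integral_eq[OF kernel_square_integral[of t]]
    kernel_integral[of t] kernel_square_integral[of t]
  by (auto simp: has_bochner_integral_iff)

lemma X_product_moment:
  shows "integrable M (\<lambda>\<omega>. X s \<omega> * X t \<omega>)"
    and "expectation (\<lambda>\<omega>. X s \<omega> * X t \<omega>) =
      levy_variance * ((1 - B * \<bar>t - s\<bar>) powr (1 - \<alpha>) / (- B * (\<alpha> - 1)) / 2) + (levy_mean / (- B * (\<alpha> - 1)))\<^sup>2"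
proof -
  let ?k = "\<lambda>z. supOU_kernel s z + supOU_kernel t z"
  \<comment> \<open>\<open>?K\<close> is the integral of one kernel and twice the integral of its
    square; \<open>?J\<close> is the integral of the product. Hence the squared sum integrates to
    \<open>?K + 2 * ?J\<close>.\<close>
  let ?K = "1 / (- B * (\<alpha> - 1))" and ?J = "(1 - B * \<bar>t - s\<bar>) powr (1 - \<alpha>) / (- B * (\<alpha> - 1)) / 2"
  have 1: "has_bochner_integral control ?k (?K + ?K)"
    by (intro has_bochner_integral_add kernel_integral)
  have "has_bochner_integral control (\<lambda>z. (supOU_kernel s z)\<^sup>2 + (supOU_kernel t z)\<^sup>2 + 2 * (supOU_kernel s z * supOU_kernel t z))
     (?K / 2 + ?K / 2 + 2 * ?J)"
    by (intro has_bochner_integral_add has_bochner_integral_mult_right kernel_square_integral kernel_mult_integral)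
  moreover have "(?k z)\<^sup>2 = (supOU_kernel s z)\<^sup>2 + (supOU_kernel t z)\<^sup>2 + 2 * (supOU_kernel s z * supOU_kernel t z)" for z
    by (simp add: power2_sum)
  ultimately have 2: "has_bochner_integral control (\<lambda>z. (?k z)\<^sup>2) (?K + 2 * ?J)" by simp
  note mom = has_levy_integral_moments[OF nu2 has_levy_integral_add[OF X[of s] X[of t]]]
  have sq: "integrable M (\<lambda>\<omega>. (X s \<omega> + X t \<omega>)\<^sup>2)"
    "expectation (\<lambda>\<omega>. (X s \<omega> + X t \<omega>)\<^sup>2) = levy_variance * (?K + 2 * ?J) + (levy_mean * (?K + ?K))\<^sup>2"
    using mom(1,3) 1 2 by (simp_all only: has_bochner_integral_iff)
  have eq: "X s \<omega> * X t \<omega> = ((X s \<omega> + X t \<omega>)\<^sup>2 - (X s \<omega>)\<^sup>2 - (X t \<omega>)\<^sup>2) / 2" for \<omega>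
    by (simp add: power2_sum)
  show "integrable M (\<lambda>\<omega>. X s \<omega> * X t \<omega>)"
    unfolding eq by (intro integrable_divide Bochner_Integration.integrable_diff sq X_moments)
  have alg: "(v * (K + 2 * J) + (m * (K + K))\<^sup>2 - (v * K / 2 + (m * K)\<^sup>2) - (v * K / 2 + (m * K)\<^sup>2)) / 2 = v * J + (m * K)\<^sup>2"
    for v m K J :: real
    by (simp add: power2_eq_square field_simps)
  have "expectation (\<lambda>\<omega>. X s \<omega> * X t \<omega>) = (levy_variance * (?K + 2 * ?J) + (levy_mean * (?K + ?K))\<^sup>2
      - (levy_variance * ?K / 2 + (levy_mean * ?K)\<^sup>2) - (levy_variance * ?K / 2 + (levy_mean * ?K)\<^sup>2)) / 2"
    unfolding eq using sq X_moments by simp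
  also have "\<dots> = levy_variance * ?J + (levy_mean * ?K)\<^sup>2"
    by (rule alg)
  finally show "expectation (\<lambda>\<omega>. X s \<omega> * X t \<omega>) = levy_variance * ?J + (levy_mean / (- B * (\<alpha> - 1)))\<^sup>2"
    by simp
qed

end

section \<open>The autocovariance integral\<close>

text \<open>Up to a factor, this is the autocovariance at lag \<open>h\<close> of the integrated process. It is
  continuous in \<open>a\<close>, hence it provides the continuous extensions at \<open>a = 2\<close> and \<open>a = 3\<close>.\<close>

definition memory_integral :: "real \<Rightarrow> real \<Rightarrow> real \<Rightarrow> nat \<Rightarrow> real" where
  "memory_integral \<Delta> b a h =
    integral {0..\<Delta>} (\<lambda>s. integral {real h * \<Delta>..real (h + 1) * \<Delta>} (\<lambda>t. (1 + b * \<bar>t - s\<bar>) powr (1 - a)))"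

lemma continuous_on_memory_integrand:
  fixes b :: real
  assumes "b > 0"
  shows "continuous_on S (\<lambda>t. (1 + b * \<bar>t - s\<bar>) powr p)"
  by (intro continuous_intros) (use assms in \<open>auto simp: add_nonneg_eq_0_iff\<close>)

lemma continuous_on_memory_kernel:
  fixes b c d :: real
  assumes "b > 0"
  shows "continuous_on S (\<lambda>s. integral {c..d} (\<lambda>t. (1 + b * \<bar>t - s\<bar>) powr (1 - a)))"
proof -
  have "continuous_on (S \<times> cbox c d) (\<lambda>(s, t). (1 + b * \<bar>t - s\<bar>) powr (1 - a))"
    unfolding case_prod_unfold
    by (intro continuous_intros) (use assms in \<open>auto simp: add_nonneg_eq_0_iff\<close>)
  from integral_continuous_on_param[OF this] show ?thesis by simp
qed

text \<open>The slope \<open>k\<close> may be negative, so both sides of the diagonal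
  \<open>t = s\<close> are covered. The excluded power is the logarithmic case, met at exponents 2
  and 3 only.\<close>

lemma has_integral_affine_powr:
  fixes k c d e p :: real
  assumes "c \<le> d" "k \<noteq> 0" "p \<noteq> -1" and pos: "\<And>t. t \<in> {c..d} \<Longrightarrow> e + k * t > 0"
  shows "((\<lambda>t. (e + k * t) powr p) has_integral
    ((e + k * d) powr (p + 1) - (e + k * c) powr (p + 1)) / (k * (p + 1))) {c..d}"
proof -
  have "((\<lambda>t. (e + k * t) powr p) has_integral
     (e + k * d) powr (p + 1) / (k * (p + 1)) - (e + k * c) powr (p + 1) / (k * (p + 1))) {c..d}"
  proof (rule fundamental_theorem_of_calculus[OF \<open>c \<le> d\<close>])
    fix t assume "t \<in> {c..d}"
    then have "e + k * t > 0" by (rule pos)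
    then have "((\<lambda>t. (e + k * t) powr (p + 1)) has_real_derivative (p + 1) * (e + k * t) powr (p + 1 - 1) * k) (at t within {c..d})"
      by (auto intro!: derivative_eq_intros)
    from DERIV_cdivide[OF this, of "k * (p + 1)"]
    have "((\<lambda>t. (e + k * t) powr (p + 1) / (k * (p + 1))) has_real_derivative (e + k * t) powr p) (at t within {c..d})"
      using \<open>k \<noteq> 0\<close> \<open>p \<noteq> -1\<close> by (simp add: eq_neg_iff_add_eq_0)
    then show "((\<lambda>t. (e + k * t) powr (p + 1) / (k * (p + 1))) has_vector_derivative (e + k * t) powr p) (at t within {c..d})"
      by (simp add: has_real_derivative_iff_has_vector_derivative)
  qed
  then show ?thesis by (simp add: diff_divide_distrib)
qed

text \<open>For positive lag \<open>t\<close> stays above \<open>s\<close> and the absolute value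
  disappears. Two antiderivatives give four corner values, two of which coincide because the
  intervals have equal length: this is the second difference.\<close>

lemma memory_integral_second_difference:
  assumes "\<Delta> > 0" "b > 0" "a \<noteq> 2" "a \<noteq> 3" "h \<ge> 1"
  shows "memory_integral \<Delta> b a h =
    (phi \<Delta> a (- b) (h + 1) - 2 * phi \<Delta> a (- b) h + phi \<Delta> a (- b) (h - 1)) / (b\<^sup>2 * (2 - a) * (3 - a))"
proof -
  let ?c = "real h * \<Delta>" and ?d = "real (h + 1) * \<Delta>"
  have c: "\<Delta> \<le> ?c" "?c \<le> ?d"
    using assms by auto
  have inner: "integral {?c..?d} (\<lambda>t. (1 + b * \<bar>t - s\<bar>) powr (1 - a)) =
      (((1 + b * ?d) + - b * s) powr (2 - a) - ((1 + b * ?c) + - b * s) powr (2 - a)) / (b * (2 - a))"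
    if s: "s \<in> {0..\<Delta>}" for s
  proof -
    have eq: "(1 + b * \<bar>t - s\<bar>) powr (1 - a) = ((1 - b * s) + b * t) powr (1 - a)" if "t \<in> {?c..?d}" for t
      using that s c by (simp add: algebra_simps)
    have "((\<lambda>t. ((1 - b * s) + b * t) powr (1 - a)) has_integral
       (((1 - b * s) + b * ?d) powr ((1 - a) + 1) - ((1 - b * s) + b * ?c) powr ((1 - a) + 1)) / (b * ((1 - a) + 1))) {?c..?d}"
    proof (rule has_integral_affine_powr)
      fix t assume "t \<in> {?c..?d}"
      then have "s \<le> t" using s c by auto
      then have "b * s \<le> b * t" using assms by simp
      then show "1 - b * s + b * t > 0" by simp
    qed (use c assms in auto)
    then have "((\<lambda>t. (1 + b * \<bar>t - s\<bar>) powr (1 - a)) has_integral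
       (((1 - b * s) + b * ?d) powr ((1 - a) + 1) - ((1 - b * s) + b * ?c) powr ((1 - a) + 1)) / (b * ((1 - a) + 1))) {?c..?d}"
      by (rule has_integral_eq[rotated]) (simp add: eq)
    then have "integral {?c..?d} (\<lambda>t. (1 + b * \<bar>t - s\<bar>) powr (1 - a)) = 
       (((1 - b * s) + b * ?d) powr ((1 - a) + 1) - ((1 - b * s) + b * ?c) powr ((1 - a) + 1)) / (b * ((1 - a) + 1))"
      by (rule integral_unique)
    moreover have "(1 - a) + 1 = 2 - a" "(1 - b * s) + b * ?d = (1 + b * ?d) + - b * s" "(1 - b * s) + b * ?c = (1 + b * ?c) + - b * s"
      by simp_all
    ultimately show ?thesis by (simp only:)
  qed
  have outer: "((\<lambda>s. ((1 + b * e) + - b * s) powr (2 - a)) has_integral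
      ((1 + b * e) powr (3 - a) - (1 + b * (e - \<Delta>)) powr (3 - a)) / (b * (3 - a))) {0..\<Delta>}" if "e \<ge> \<Delta>" for e
  proof -
    have "((\<lambda>s. ((1 + b * e) + - b * s) powr (2 - a)) has_integral
      (((1 + b * e) + - b * \<Delta>) powr (2 - a + 1) - ((1 + b * e) + - b * 0) powr (2 - a + 1)) / (- b * (2 - a + 1))) {0..\<Delta>}"
    proof (rule has_integral_affine_powr)
      fix s assume "s \<in> {0..\<Delta>}"
      then have "b * s \<le> b * e" using assms that by simp
      then show "1 + b * e + - b * s > 0" by simp
    qed (use assms in auto)
    moreover have "(1 + b * e) + - b * \<Delta> = 1 + b * (e - \<Delta>)" "(1 + b * e) + - b * 0 = 1 + b * e" "2 - a + 1 = 3 - a"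
      by (simp_all add: algebra_simps)
    moreover have "(x - y) / (- b * (3 - a)) = (y - x) / (b * (3 - a))" for x y
      by (simp add: minus_divide_left[symmetric] minus_divide_right[symmetric] divide_simps)
    ultimately show ?thesis by (simp only:)
  qed
  have "memory_integral \<Delta> b a h = integral {0..\<Delta>} (\<lambda>s. (((1 + b * ?d) + - b * s) powr (2 - a) - ((1 + b * ?c) + - b * s) powr (2 - a)) / (b * (2 - a)))"
    unfolding memory_integral_def by (intro Henstock_Kurzweil_Integration.integral_cong inner)
  also have "\<dots> = (((1 + b * ?d) powr (3 - a) - (1 + b * (?d - \<Delta>)) powr (3 - a)) / (b * (3 - a))
      - ((1 + b * ?c) powr (3 - a) - (1 + b * (?c - \<Delta>)) powr (3 - a)) / (b * (3 - a))) / (b * (2 - a))"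
    by (intro integral_unique has_integral_divide has_integral_diff outer) (use c in auto)
  also have "\<dots> = (phi \<Delta> a (- b) (h + 1) - 2 * phi \<Delta> a (- b) h + phi \<Delta> a (- b) (h - 1)) / (b\<^sup>2 * (2 - a) * (3 - a))"
  proof -
    have "1 + b * ?d = 1 - - b * \<Delta> * real (h + 1)" "1 + b * (?d - \<Delta>) = 1 - - b * \<Delta> * real h"
      "1 + b * ?c = 1 - - b * \<Delta> * real h" "1 + b * (?c - \<Delta>) = 1 - - b * \<Delta> * real (h - 1)"
      using \<open>h \<ge> 1\<close> by (auto simp: algebra_simps of_nat_diff)
    then have "(1 + b * ?d) powr (3 - a) = phi \<Delta> a (- b) (h + 1)" "(1 + b * (?d - \<Delta>)) powr (3 - a) = phi \<Delta> a (- b) h"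
      "(1 + b * ?c) powr (3 - a) = phi \<Delta> a (- b) h" "(1 + b * (?c - \<Delta>)) powr (3 - a) = phi \<Delta> a (- b) (h - 1)"
      unfolding phi_def by (simp_all only:)
    then show ?thesis
      using assms by (simp only:) (simp add: divide_simps power2_eq_square)
  qed
  finally show ?thesis .
qed

text \<open>At lag 0 the square contains the diagonal and the inner integral is split there. The
  boundary value 1 on the diagonal, taken twice, leaves the linear term in
  \<open>\<Delta>\<close>.\<close>

lemma memory_integral_0:
  assumes "\<Delta> > 0" "b > 0" "a \<noteq> 2" "a \<noteq> 3"
  shows "memory_integral \<Delta> b a 0 =
    2 * ((1 + b * \<Delta>) powr (3 - a) - 1 - \<Delta> * b * (3 - a)) / (b\<^sup>2 * (2 - a) * (3 - a))"
proof -
  have inner: "integral {0..\<Delta>} (\<lambda>t. (1 + b * \<bar>t - s\<bar>) powr (1 - a)) =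
      ((1 + b * s) powr (2 - a) + ((1 + b * \<Delta>) + - b * s) powr (2 - a) - 2) / (b * (2 - a))"
    if s: "s \<in> {0..\<Delta>}" for s
  proof -
    have "((\<lambda>t. ((1 + b * s) + - b * t) powr (1 - a)) has_integral
       (((1 + b * s) + - b * s) powr ((1 - a) + 1) - ((1 + b * s) + - b * 0) powr ((1 - a) + 1)) / (- b * ((1 - a) + 1))) {0..s}"
    proof (rule has_integral_affine_powr)
      fix t assume "t \<in> {0..s}"
      then have "b * t \<le> b * s" using assms by simp
      then show "1 + b * s + - b * t > 0" by simp
    qed (use s assms in auto)
    then have 1: "((\<lambda>t. (1 + b * \<bar>t - s\<bar>) powr (1 - a)) has_integral
       (((1 + b * s) + - b * s) powr ((1 - a) + 1) - ((1 + b * s) + - b * 0) powr ((1 - a) + 1)) / (- b * ((1 - a) + 1))) {0..s}"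
      by (rule has_integral_eq[rotated]) (auto simp: algebra_simps)
    have "((\<lambda>t. ((1 - b * s) + b * t) powr (1 - a)) has_integral
       (((1 - b * s) + b * \<Delta>) powr ((1 - a) + 1) - ((1 - b * s) + b * s) powr ((1 - a) + 1)) / (b * ((1 - a) + 1))) {s..\<Delta>}"
    proof (rule has_integral_affine_powr)
      fix t assume "t \<in> {s..\<Delta>}"
      then have "b * s \<le> b * t" using assms by simp
      then show "1 - b * s + b * t > 0" by simp
    qed (use s assms in auto)
    then have 2: "((\<lambda>t. (1 + b * \<bar>t - s\<bar>) powr (1 - a)) has_integral
       (((1 - b * s) + b * \<Delta>) powr ((1 - a) + 1) - ((1 - b * s) + b * s) powr ((1 - a) + 1)) / (b * ((1 - a) + 1))) {s..\<Delta>}"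
      by (rule has_integral_eq[rotated]) (auto simp: algebra_simps)
    have "integral {0..\<Delta>} (\<lambda>t. (1 + b * \<bar>t - s\<bar>) powr (1 - a)) =
       (((1 + b * s) + - b * s) powr ((1 - a) + 1) - ((1 + b * s) + - b * 0) powr ((1 - a) + 1)) / (- b * ((1 - a) + 1))
       + (((1 - b * s) + b * \<Delta>) powr ((1 - a) + 1) - ((1 - b * s) + b * s) powr ((1 - a) + 1)) / (b * ((1 - a) + 1))"
      by (rule integral_unique, rule has_integral_combine[OF _ _ 1 2]) (use s in auto)
    moreover have "(1 - a) + 1 = 2 - a" "(1 - b * s) + b * \<Delta> = (1 + b * \<Delta>) + - b * s" by simp_all
    ultimately show ?thesis
      using assms by (simp add: divide_simps)
  qed
  have 1: "((\<lambda>s. (1 + b * s) powr (2 - a)) has_integral ((1 + b * \<Delta>) powr (2 - a + 1) - (1 + b * 0) powr (2 - a + 1)) / (b * (2 - a + 1))) {0..\<Delta>}"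
    by (rule has_integral_affine_powr) (use assms in \<open>auto intro!: add_pos_nonneg\<close>)
  have 2: "((\<lambda>s. ((1 + b * \<Delta>) + - b * s) powr (2 - a)) has_integral
      (((1 + b * \<Delta>) + - b * \<Delta>) powr (2 - a + 1) - ((1 + b * \<Delta>) + - b * 0) powr (2 - a + 1)) / (- b * (2 - a + 1))) {0..\<Delta>}"
  proof (rule has_integral_affine_powr)
    fix s assume "s \<in> {0..\<Delta>}"
    then have "b * s \<le> b * \<Delta>" using assms by simp
    then show "1 + b * \<Delta> + - b * s > 0" by simp
  qed (use assms in auto)
  have 3: "((\<lambda>s. 2) has_integral 2 * \<Delta>) {0..\<Delta>}"
    using has_integral_const_real[of "2::real" 0 \<Delta>] assms by (simp add: mult.commute)
  have "memory_integral \<Delta> b a 0 = integral {0..\<Delta>} (\<lambda>s. ((1 + b * s) powr (2 - a) + ((1 + b * \<Delta>) + - b * s) powr (2 - a) - 2) / (b * (2 - a)))"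
    unfolding memory_integral_def using inner by (intro Henstock_Kurzweil_Integration.integral_cong) simp
  also have "\<dots> = (((1 + b * \<Delta>) powr (2 - a + 1) - (1 + b * 0) powr (2 - a + 1)) / (b * (2 - a + 1)) +
      (((1 + b * \<Delta>) + - b * \<Delta>) powr (2 - a + 1) - ((1 + b * \<Delta>) + - b * 0) powr (2 - a + 1)) / (- b * (2 - a + 1)) - 2 * \<Delta>) / (b * (2 - a))"
    by (intro integral_unique has_integral_divide has_integral_diff has_integral_add 1 2 3)
  also have "\<dots> = 2 * ((1 + b * \<Delta>) powr (3 - a) - 1 - \<Delta> * b * (3 - a)) / (b\<^sup>2 * (2 - a) * (3 - a))"
  proof -
    have alg: "((P - 1) / (b * z) + (1 - P) / (- b * z) - 2 * \<Delta>) / (b * y) = 2 * (P - 1 - \<Delta> * b * z) / (b\<^sup>2 * y * z)"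
      if "y \<noteq> 0" "z \<noteq> 0" for P y z
    proof -
      have "(1 - P) / (- b * z) = (P - 1) / (b * z)"
        using that assms by (simp add: divide_simps)
      then have "(P - 1) / (b * z) + (1 - P) / (- b * z) - 2 * \<Delta> = 2 * (P - 1 - \<Delta> * b * z) / (b * z)"
        using that assms by (simp add: field_simps)
      then show ?thesis
        by (simp add: power2_eq_square mult_ac)
    qed
    have eqs: "2 - a + 1 = 3 - a" "1 + b * \<Delta> + - b * \<Delta> = 1" "1 + b * 0 = 1" "1 + b * \<Delta> + - b * 0 = 1 + b * \<Delta>"
      and nz: "2 - a \<noteq> 0" "3 - a \<noteq> 0"
      using assms by simp_all
    show ?thesis
      unfolding eqs powr_one_eq_one by (rule alg[OF nz])
  qed
  finally show ?thesis .
qed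

section \<open>Continuous extensions at the removable singularities\<close>

lemma continuous_on_memory_integral:
  assumes "b > 0"
  shows "continuous_on S (\<lambda>a. memory_integral \<Delta> b a h)"
proof -
  let ?c = "real h * \<Delta>" and ?d = "real (h + 1) * \<Delta>"
  \<comment> \<open>The inner integral is treated as a function of exponent and \<open>s\<close>
    jointly, so the same theorem on parameter integrals applies again to the outer one.\<close>
  have "continuous_on ((UNIV :: (real \<times> real) set) \<times> cbox ?c ?d) (\<lambda>(p, t). (1 + b * \<bar>t - snd p\<bar>) powr (1 - fst p))"
    unfolding case_prod_unfold
    by (intro continuous_intros) (use assms in \<open>auto simp: add_nonneg_eq_0_iff\<close>)
  from integral_continuous_on_param[OF this]
  have "continuous_on UNIV (\<lambda>p::real \<times> real. integral {?c..?d} (\<lambda>t. (1 + b * \<bar>t - snd p\<bar>) powr (1 - fst p)))"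
    by simp
  then have "continuous_on (S \<times> cbox 0 \<Delta>) (\<lambda>p. integral {?c..?d} (\<lambda>t. (1 + b * \<bar>t - snd p\<bar>) powr (1 - fst p)))"
    by (rule continuous_on_subset) simp
  then have "continuous_on (S \<times> cbox 0 \<Delta>) (\<lambda>(a, s). integral {?c..?d} (\<lambda>t. (1 + b * \<bar>t - s\<bar>) powr (1 - a)))"
    by (simp add: case_prod_unfold)
  from integral_continuous_on_param[OF this] show ?thesis
    by (simp add: memory_integral_def)
qed

text \<open>The limit defining the extension ignores the value at \<alpha> itself, and the remaining
  exceptional points keep a distance from \<alpha>. The point 1 is exempted because the formulas
  have a pole there.\<close>

lemma cont_ext_eq:
  assumes eq: "\<And>a. a \<noteq> 1 \<Longrightarrow> a \<noteq> 2 \<Longrightarrow> a \<noteq> 3 \<Longrightarrow> g a = G a"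
    and "isCont G \<alpha>" "\<alpha> > 1"
  shows "cont_ext g \<alpha> = G \<alpha>"
proof (cases "\<alpha> \<in> {2, 3}")
  case True
  have "\<forall>\<^sub>F a in at \<alpha>. a \<notin> {1, 2, 3}"
  proof -
    have "\<forall>\<^sub>F a in at \<alpha>. a \<in> - ({1, 2, 3} - {\<alpha>})"
      by (rule eventually_at_in_open'[OF open_Compl]) (auto intro: finite_imp_closed)
    moreover have "\<forall>\<^sub>F a in at \<alpha>. a \<noteq> \<alpha>"
      by (simp add: eventually_at_filter)
    ultimately show ?thesis
      by eventually_elim auto
  qed
  then have "\<forall>\<^sub>F a in at \<alpha>. g a = G a"
    by eventually_elim (simp add: eq)
  then have "(g \<longlongrightarrow> G \<alpha>) (at \<alpha>)"
    using \<open>isCont G \<alpha>\<close> by (simp add: isCont_def tendsto_cong)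
  then show ?thesis
    using True by (simp add: cont_ext_def tendsto_Lim)
next
  case False
  then show ?thesis
    using eq[of \<alpha>] \<open>\<alpha> > 1\<close> by (simp add: cont_ext_def)
qed

lemma isCont_memory_integral:
  assumes "b > 0" "\<alpha> > 1"
  shows "isCont (\<lambda>a. - s2 / (2 * b * (a - 1)) * memory_integral \<Delta> b a h) \<alpha>"
proof -
  have "isCont (\<lambda>a. memory_integral \<Delta> b a h) \<alpha>"
    using continuous_on_memory_integral[OF assms(1), of UNIV] by (simp add: continuous_on_eq_continuous_at)
  then show ?thesis
    using assms by (intro continuous_intros) auto
qed

text \<open>With \<open>- B\<close> positive, \<open>B ^ 3\<close> contributes a minus sign: the
  parametric term is minus the autocovariance belonging to the parameter vector.\<close>

lemma cont_ext_cov: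
  assumes "\<Delta> > 0" "B < 0" "\<alpha> > 1" "h \<ge> 1"
  shows "cont_ext (\<lambda>a. s2 * (phi \<Delta> a B (h + 1) - 2 * phi \<Delta> a B h + phi \<Delta> a B (h - 1))
      / (2 * B ^ 3 * (a - 1) * (a - 2) * (a - 3))) \<alpha> = - s2 / (2 * - B * (\<alpha> - 1)) * memory_integral \<Delta> (- B) \<alpha> h"
proof (rule cont_ext_eq)
  fix a :: real assume a: "a \<noteq> 1" "a \<noteq> 2" "a \<noteq> 3"
  have alg: "s2 * N / (2 * B ^ 3 * x * y * z) = - s2 / (2 * - B * x) * (N / ((- B)\<^sup>2 * (- y) * (- z)))"
    if "x \<noteq> 0" "y \<noteq> 0" "z \<noteq> 0" for N x y z
    using assms that by (simp add: divide_simps power2_eq_square power3_eq_cube)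
  show "s2 * (phi \<Delta> a B (h + 1) - 2 * phi \<Delta> a B h + phi \<Delta> a B (h - 1)) / (2 * B ^ 3 * (a - 1) * (a - 2) * (a - 3))
      = - s2 / (2 * - B * (a - 1)) * memory_integral \<Delta> (- B) a h"
    using memory_integral_second_difference[of \<Delta> "- B" a h] alg[of "a - 1" "a - 2" "a - 3"] a assms by simp
qed (use isCont_memory_integral[of "- B"] assms in auto)

text \<open>The factor 2 in \<open>memory_integral_0\<close> makes up for the missing 2 in the
  denominator, so the variance entry has the same form as the others, at lag 0.\<close>

lemma cont_ext_var:
  assumes "\<Delta> > 0" "B < 0" "\<alpha> > 1"
  shows "s2 * cont_ext (\<lambda>a. ((1 - B * \<Delta>) powr (3 - a) - 1 - \<Delta> * B * (a - 3))
      / (B ^ 3 * (a - 1) * (a - 2) * (a - 3))) \<alpha> = - s2 / (2 * - B * (\<alpha> - 1)) * memory_integral \<Delta> (- B) \<alpha> 0"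
proof -
  have "cont_ext (\<lambda>a. ((1 - B * \<Delta>) powr (3 - a) - 1 - \<Delta> * B * (a - 3))
      / (B ^ 3 * (a - 1) * (a - 2) * (a - 3))) \<alpha> = - 1 / (2 * - B * (\<alpha> - 1)) * memory_integral \<Delta> (- B) \<alpha> 0"
  proof (rule cont_ext_eq)
    fix a :: real assume a: "a \<noteq> 1" "a \<noteq> 2" "a \<noteq> 3"
    have alg: "N / (B ^ 3 * x * y * z) = - 1 / (2 * - B * x) * (2 * N / ((- B)\<^sup>2 * (- y) * (- z)))"
      if "x \<noteq> 0" "y \<noteq> 0" "z \<noteq> 0" for N x y z
      using assms that by (simp add: divide_simps power2_eq_square power3_eq_cube)
    have sign: "\<Delta> * - B * (3 - a) = \<Delta> * B * (a - 3)" by (simp add: algebra_simps)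
    have "memory_integral \<Delta> (- B) a 0 =
        2 * ((1 - B * \<Delta>) powr (3 - a) - 1 - \<Delta> * B * (a - 3)) / ((- B)\<^sup>2 * - (a - 2) * - (a - 3))"
      using memory_integral_0[of \<Delta> "- B" a, unfolded sign] a assms by simp
    note mem = this
    have nz: "a - 1 \<noteq> 0" "a - 2 \<noteq> 0" "a - 3 \<noteq> 0" using a by auto
    show "((1 - B * \<Delta>) powr (3 - a) - 1 - \<Delta> * B * (a - 3)) / (B ^ 3 * (a - 1) * (a - 2) * (a - 3))
        = - 1 / (2 * - B * (a - 1)) * memory_integral \<Delta> (- B) a 0"
      unfolding mem by (rule alg[OF nz])
  \<comment> \<open>Continuity is used with \<open>s2 = 1\<close>, since here \<open>s2\<close>
    stands outside the extension.\<close>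
  qed (use isCont_memory_integral[of "- B" \<alpha> 1] assms in auto)
  then show ?thesis by simp
qed

section \<open>Decay in the lag and identification of the parameters\<close>

text \<open>The integrand decreases in the distance of \<open>s\<close> and \<open>t\<close>, which
  lies between \<open>\<Delta> * (h - 1)\<close> and \<open>\<Delta> * (h + 1)\<close>, and the
  domain has area \<open>\<Delta>\<^sup>2\<close>.\<close>

lemma memory_integral_bounds:
  assumes "\<Delta> > 0" "b > 0" "a > 1" "h \<ge> 1"
  shows "\<Delta>\<^sup>2 * (1 + b * \<Delta> * (real h + 1)) powr (1 - a) \<le> memory_integral \<Delta> b a h"
    and "memory_integral \<Delta> b a h \<le> \<Delta>\<^sup>2 * (1 + b * \<Delta> * (real h - 1)) powr (1 - a)"
proof -
  let ?c = "real h * \<Delta>" and ?d = "real (h + 1) * \<Delta>"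
  let ?f = "\<lambda>s. integral {?c..?d} (\<lambda>t. (1 + b * \<bar>t - s\<bar>) powr (1 - a))"
  let ?l = "(1 + b * \<Delta> * (real h + 1)) powr (1 - a)" and ?u = "(1 + b * \<Delta> * (real h - 1)) powr (1 - a)"
  have c: "\<Delta> \<le> ?c" "?c \<le> ?d" "?d - ?c = \<Delta>"
    using assms by (auto simp: algebra_simps)
  have pt: "?l \<le> (1 + b * \<bar>t - s\<bar>) powr (1 - a)" "(1 + b * \<bar>t - s\<bar>) powr (1 - a) \<le> ?u"
    if "s \<in> {0..\<Delta>}" "t \<in> {?c..?d}" for s t
  proof -
    have d: "\<Delta> * (real h - 1) \<le> \<bar>t - s\<bar>" "\<bar>t - s\<bar> \<le> \<Delta> * (real h + 1)" "0 \<le> \<Delta> * (real h - 1)"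
    proof -
      have "0 \<le> s" "s \<le> \<Delta>" "\<Delta> * real h \<le> t" "t \<le> \<Delta> * real h + \<Delta>" "\<Delta> \<le> \<Delta> * real h"
        using that c(1) by (auto simp: algebra_simps)
      then show "\<Delta> * (real h - 1) \<le> \<bar>t - s\<bar>" "\<bar>t - s\<bar> \<le> \<Delta> * (real h + 1)" "0 \<le> \<Delta> * (real h - 1)"
        unfolding right_diff_distrib distrib_left mult_1_right by linarith+
    qed
    have "b * (\<Delta> * (real h - 1)) \<le> b * \<bar>t - s\<bar>" "b * \<bar>t - s\<bar> \<le> b * (\<Delta> * (real h + 1))" "0 \<le> b * (\<Delta> * (real h - 1))"
      using d assms by (auto intro!: mult_left_mono)
    note bd = this
    show "?l \<le> (1 + b * \<bar>t - s\<bar>) powr (1 - a)"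
      unfolding mult.assoc by (rule powr_mono2') (use bd assms in linarith)+
    show "(1 + b * \<bar>t - s\<bar>) powr (1 - a) \<le> ?u"
      unfolding mult.assoc by (rule powr_mono2') (use bd assms in linarith)+
  qed
  have int_in: "(\<lambda>t. (1 + b * \<bar>t - s\<bar>) powr (1 - a)) integrable_on {?c..?d}" for s
    by (intro integrable_continuous_interval continuous_on_memory_integrand assms)
  have int_out: "?f integrable_on {0..\<Delta>}"
    by (intro integrable_continuous_interval continuous_on_memory_kernel assms)
  have "\<Delta> * ?l \<le> ?f s" if "s \<in> {0..\<Delta>}" for s
    using integral_le[OF integrable_const_ivl int_in pt(1)[OF that]] c by simp
  from integral_le[OF integrable_const_ivl int_out this] 
  show "\<Delta>\<^sup>2 * ?l \<le> memory_integral \<Delta> b a h"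
    using assms by (simp add: memory_integral_def power2_eq_square mult.assoc)
  have "?f s \<le> \<Delta> * ?u" if "s \<in> {0..\<Delta>}" for s
    using integral_le[OF int_in integrable_const_ivl pt(2)[OF that]] c by simp
  from integral_le[OF int_out integrable_const_ivl this] 
  show "memory_integral \<Delta> b a h \<le> \<Delta>\<^sup>2 * ?u"
    using assms by (simp add: memory_integral_def power2_eq_square mult.assoc)
qed

text \<open>The scaled integrand is \<open>(b / (1 + b * w)) powr (a - 1)\<close>, and
  \<open>b / (1 + b * w)\<close> increases in \<open>b\<close>.\<close>

lemma scaled_memory_integral_strict_mono:
  assumes "\<Delta> > 0" "b > 0" "b < b'" "a > 1"
  shows "b powr (a - 1) * memory_integral \<Delta> b a h < b' powr (a - 1) * memory_integral \<Delta> b' a h"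
proof -
  let ?I = "{real h * \<Delta>..real (h + 1) * \<Delta>}"
  have b': "b' > 0" using assms by simp
  have pt: "b powr (a - 1) * (1 + b * w) powr (1 - a) < b' powr (a - 1) * (1 + b' * w) powr (1 - a)"
    if "w \<ge> 0" for w
  proof -
    have pos: "1 + b * w > 0" "1 + b' * w > 0"
      using assms that by (auto intro!: add_pos_nonneg)
    have "b / (1 + b * w) < b' / (1 + b' * w)"
      using pos assms by (simp add: divide_simps algebra_simps)
    then have "(b / (1 + b * w)) powr (a - 1) < (b' / (1 + b' * w)) powr (a - 1)"
      using pos assms by (intro powr_less_mono2) auto
    moreover have "c powr (a - 1) * (1 + c * w) powr (1 - a) = (c / (1 + c * w)) powr (a - 1)"
      if "c > 0" "1 + c * w > 0" for c
      using that powr_minus_divide[of "1 + c * w" "a - 1"] by (simp add: powr_divide)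
    ultimately show ?thesis using pos assms by simp
  qed
  have inner: "b powr (a - 1) * integral ?I (\<lambda>t. (1 + b * \<bar>t - s\<bar>) powr (1 - a))
      < b' powr (a - 1) * integral ?I (\<lambda>t. (1 + b' * \<bar>t - s\<bar>) powr (1 - a))" for s
  proof -
    have "integral ?I (\<lambda>t. b powr (a - 1) * (1 + b * \<bar>t - s\<bar>) powr (1 - a))
      < integral ?I (\<lambda>t. b' powr (a - 1) * (1 + b' * \<bar>t - s\<bar>) powr (1 - a))"
      by (rule integral_less_real)
        (use assms b' pt in \<open>auto intro!: continuous_on_mult continuous_on_const continuous_on_memory_integrand\<close>)
    then show ?thesis by simp
  qed
  have "integral {0..\<Delta>} (\<lambda>s. b powr (a - 1) * integral ?I (\<lambda>t. (1 + b * \<bar>t - s\<bar>) powr (1 - a)))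
     < integral {0..\<Delta>} (\<lambda>s. b' powr (a - 1) * integral ?I (\<lambda>t. (1 + b' * \<bar>t - s\<bar>) powr (1 - a)))"
  proof (rule integral_less_real)
    show "{0<..<\<Delta>} \<noteq> {}" using assms by simp
  qed (intro inner continuous_on_mult continuous_on_const continuous_on_memory_kernel assms b')+
  then show ?thesis by (simp add: memory_integral_def)
qed

text \<open>This is the quotient of a lower and an upper bound from
  \<open>memory_integral_bounds\<close>; the opposite shifts of \<open>h\<close> do not affect the
  limit.\<close>

lemma powr_ratio_tendsto:
  fixes c c' p :: real
  assumes "c > 0" "c' > 0"
  shows "(\<lambda>h. (1 + c' * (real h - 1)) powr p * (1 + c * (real h + 1)) powr - p) \<longlonglongrightarrow> (c' / c) powr p"
  using assms by (real_asymp simp: powr_divide powr_minus divide_simps)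

lemma powr_ratio_at_top:
  fixes c c' p p' :: real
  assumes "c > 0" "c' > 0" "p < p'"
  shows "filterlim (\<lambda>h. (1 + c' * (real h - 1)) powr p' * (1 + c * (real h + 1)) powr - p) at_top sequentially"
  using assms by real_asymp

text \<open>The decay rate in \<open>h\<close> yields \<open>a\<close>, the leading coefficient then yields
  \<open>s / (2 * b * (a - 1)) * b powr (1 - a)\<close>, and with that product fixed the value at \<open>h = 1\<close> is strictly
  monotone in \<open>b\<close>.\<close>

theorem memory_integral_identifies:
  assumes \<Delta>: "\<Delta> > 0" and pos: "s > 0" "b > 0" "a > 1" "s' > 0" "b' > 0" "a' > 1"
    and eq: "\<And>h. h \<ge> 1 \<Longrightarrow> s / (2 * b * (a - 1)) * memory_integral \<Delta> b a h =
      s' / (2 * b' * (a' - 1)) * memory_integral \<Delta> b' a' h"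
  shows "s = s'" "b = b'" "a = a'"
proof -
  \<comment> \<open>The lower bound of one side is set against the upper bound of the other, and
    \<open>\<Delta>\<^sup>2\<close> cancels. All data are generalized so that the two sides can be
    exchanged.\<close>
  have le: "k / k' \<ge> (1 + b' * \<Delta> * (real h - 1)) powr (a' - 1) * (1 + b * \<Delta> * (real h + 1)) powr - (a - 1)"
    if "\<And>h. h \<ge> 1 \<Longrightarrow> k' * memory_integral \<Delta> b a h = k * memory_integral \<Delta> b' a' h"
      "k > 0" "k' > 0" "b > 0" "a > 1" "b' > 0" "a' > 1" "h \<ge> 1" for k k' b a b' a' h
  proof -
    let ?x = "1 + b' * \<Delta> * (real h - 1)"
    have x: "?x > 0"
      using that \<Delta> by (intro add_pos_nonneg mult_nonneg_nonneg) auto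
    have "k' * (\<Delta>\<^sup>2 * (1 + b * \<Delta> * (real h + 1)) powr (1 - a)) \<le> k' * memory_integral \<Delta> b a h"
      using that \<Delta> by (intro mult_left_mono memory_integral_bounds) auto
    also have "\<dots> = k * memory_integral \<Delta> b' a' h"
      using that by simp
    also have "\<dots> \<le> k * (\<Delta>\<^sup>2 * ?x powr (1 - a'))"
      using that \<Delta> by (intro mult_left_mono memory_integral_bounds) auto
    finally have "\<Delta>\<^sup>2 * (k' * (1 + b * \<Delta> * (real h + 1)) powr (1 - a)) \<le> \<Delta>\<^sup>2 * (k * ?x powr (1 - a'))"
      by (simp add: mult_ac)
    then have "k' * (1 + b * \<Delta> * (real h + 1)) powr (1 - a) \<le> k * ?x powr (1 - a')"
      using \<Delta> by simp
    then have "?x powr (a' - 1) * (k' * (1 + b * \<Delta> * (real h + 1)) powr (1 - a)) \<le> ?x powr (a' - 1) * (k * ?x powr (1 - a'))"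
      by (intro mult_left_mono) auto
    also have "\<dots> = k * (?x powr (a' - 1) * ?x powr (1 - a'))" by simp
    also have "?x powr (a' - 1) * ?x powr (1 - a') = 1"
      using x by (simp add: powr_add[symmetric])
    finally show ?thesis
      using that by (simp add: field_simps)
  qed
  \<comment> \<open>Were the decay rates different, the left factor in \<open>le\<close> would be
    unbounded in \<open>h\<close>, while \<open>k / k'\<close> is fixed.\<close>
  have not_less: "\<not> a < a'"
    if *: "\<And>h. h \<ge> 1 \<Longrightarrow> k' * memory_integral \<Delta> b a h = k * memory_integral \<Delta> b' a' h"
      "k > 0" "k' > 0" "b > 0" "a > 1" "b' > 0" "a' > 1" for k k' b a b' a'
  proof
    assume "a < a'"
    then have "filterlim (\<lambda>h. (1 + b' * \<Delta> * (real h - 1)) powr (a' - 1) * (1 + b * \<Delta> * (real h + 1)) powr - (a - 1)) at_top sequentially"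
      using that \<Delta> by (intro powr_ratio_at_top) auto
    then have "\<forall>\<^sub>F h in sequentially. k / k' < (1 + b' * \<Delta> * (real h - 1)) powr (a' - 1) * (1 + b * \<Delta> * (real h + 1)) powr - (a - 1)"
      by (simp add: filterlim_at_top_dense)
    with eventually_ge_at_top[of 1] have "\<forall>\<^sub>F h::nat in sequentially. False"
      by eventually_elim (use le[OF that] in \<open>force simp: not_less[symmetric]\<close>)
    then show False by simp
  qed
  define k where "k = s / (2 * b * (a - 1))"
  define k' where "k' = s' / (2 * b' * (a' - 1))"
  have k: "k > 0" "k' > 0"
    using pos by (auto simp: k_def k'_def)
  have E: "k * memory_integral \<Delta> b a h = k' * memory_integral \<Delta> b' a' h" if "h \<ge> 1" for h
    using eq[OF that] by (simp add: k_def k'_def)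
  have "\<not> a < a'" "\<not> a' < a"
    using not_less[OF E] not_less[OF E[symmetric]] k pos by auto
  then show a: "a = a'" by simp
  have lim_le: "(d' / d) powr (a - 1) \<le> l / l'"
    if "\<And>h. h \<ge> 1 \<Longrightarrow> l' * memory_integral \<Delta> d a h = l * memory_integral \<Delta> d' a h"
      "l > 0" "l' > 0" "d > 0" "d' > 0" for l l' d d'
  proof -
    have "(\<lambda>h. (1 + d' * \<Delta> * (real h - 1)) powr (a - 1) * (1 + d * \<Delta> * (real h + 1)) powr - (a - 1))
       \<longlonglongrightarrow> (d' * \<Delta> / (d * \<Delta>)) powr (a - 1)"
      using that \<Delta> by (intro powr_ratio_tendsto) auto
    then have "(d' * \<Delta> / (d * \<Delta>)) powr (a - 1) \<le> l / l'"
      by (rule tendsto_upperbound)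
         (use le[OF that(1-4) pos(3) that(5) pos(3)] in \<open>auto intro!: eventually_sequentiallyI[of 1]\<close>)
    then show ?thesis using \<Delta> by simp
  qed
  have "(b' / b) powr (a - 1) \<le> k' / k" "(b / b') powr (a - 1) \<le> k / k'"
    using lim_le[where l = k' and l' = k and d = b and d' = b'] lim_le[where l = k and l' = k' and d = b' and d' = b] E k pos
    by (auto simp: a)
  then have "b' powr (a - 1) * k \<le> k' * b powr (a - 1)" "b powr (a - 1) * k' \<le> k * b' powr (a - 1)"
    using k pos by (simp_all add: powr_divide divide_simps)
  \<comment> \<open>Equality of the leading coefficients, \<open>k * b powr (1 - a)\<close> and its
    primed counterpart, cleared of negative powers.\<close>
  then have scale: "k * b' powr (a - 1) = k' * b powr (a - 1)"
    by (simp add: mult.commute)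
  have E1: "k * memory_integral \<Delta> b a 1 = k' * memory_integral \<Delta> b' a 1"
    using E[of 1] by (simp add: a)
  have "k * (b' powr (a - 1) * (b powr (a - 1) * memory_integral \<Delta> b a 1)) =
      b' powr (a - 1) * b powr (a - 1) * (k * memory_integral \<Delta> b a 1)" by simp
  also have "\<dots> = (k' * b powr (a - 1)) * (b' powr (a - 1) * memory_integral \<Delta> b' a 1)"
    unfolding E1 by simp
  also have "\<dots> = k * (b' powr (a - 1) * (b' powr (a - 1) * memory_integral \<Delta> b' a 1))"
    unfolding scale[symmetric] by simp
  finally have "b powr (a - 1) * memory_integral \<Delta> b a 1 = b' powr (a - 1) * memory_integral \<Delta> b' a 1"
    using k pos by simp
  then show b: "b = b'"
    using scaled_memory_integral_strict_mono[OF \<Delta>, of b b' a 1] scaled_memory_integral_strict_mono[OF \<Delta>, of b' b a 1] pos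
    by (cases b b' rule: linorder_cases) auto
  have "k = k'"
    using scale b pos by simp
  then show "s = s'"
    using pos by (simp add: k_def k'_def a b)
qed

section \<open>Integrated supOU processes\<close>

text \<open>The uniform bound on second moments dominates the products on a finite time interval, so
  Fubini's theorem applies. The factor \<open>Z\<close> is general so that the two path integrals in
  a product can be resolved one after the other.\<close>

lemma (in prob_space) expectation_path_integral_mult:
  fixes X :: "real \<Rightarrow> 'a \<Rightarrow> real"
  assumes joint [measurable]: "(\<lambda>(s, \<omega>). X s \<omega>) \<in> borel_measurable (borel \<Otimes>\<^sub>M M)"
    and X2: "\<And>s. integrable M (\<lambda>\<omega>. (X s \<omega>)\<^sup>2)" "\<And>s. expectation (\<lambda>\<omega>. (X s \<omega>)\<^sup>2) \<le> K"
    and Z [measurable]: "Z \<in> borel_measurable M" and Z2: "integrable M (\<lambda>\<omega>. (Z \<omega>)\<^sup>2)"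
  shows "expectation (\<lambda>\<omega>. (LINT s:{a..b}|lborel. X s \<omega>) * Z \<omega>) =
    (LINT s:{a..b}|lborel. expectation (\<lambda>\<omega>. X s \<omega> * Z \<omega>))"
proof -
  interpret pair_sigma_finite lborel M ..
  have joint' [measurable]: "(\<lambda>(s, \<omega>). X s \<omega>) \<in> borel_measurable (lborel \<Otimes>\<^sub>M M)"
    using joint by (simp cong: measurable_cong_sets sets_pair_measure_cong)
  have Xm [measurable]: "X s \<in> borel_measurable M" for s
    using measurable_compose[OF measurable_Pair1' joint, of s] by simp
  let ?f = "\<lambda>(s, \<omega>). indicator {a..b} s * (X s \<omega> * Z \<omega>) :: real"
  have bound: "\<bar>X s \<omega> * Z \<omega>\<bar> \<le> ((X s \<omega>)\<^sup>2 + (Z \<omega>)\<^sup>2) / 2" for s \<omega>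
    using sum_squares_bound[of "\<bar>X s \<omega>\<bar>" "\<bar>Z \<omega>\<bar>"] by (simp add: abs_mult)
  have dom: "integrable M (\<lambda>\<omega>. ((X s \<omega>)\<^sup>2 + (Z \<omega>)\<^sup>2) / 2)" for s
    by (intro integrable_divide Bochner_Integration.integrable_add X2 Z2)
  have int_XZ: "integrable M (\<lambda>\<omega>. X s \<omega> * Z \<omega>)" for s
    by (rule Bochner_Integration.integrable_bound[OF dom[of s]]) (use bound in \<open>auto intro!: AE_I2 order.trans[OF bound]\<close>)
  have abs_le: "(\<integral>\<omega>. \<bar>X s \<omega> * Z \<omega>\<bar> \<partial>M) \<le> (K + expectation (\<lambda>\<omega>. (Z \<omega>)\<^sup>2)) / 2" for s
  proof -
    have "(\<integral>\<omega>. \<bar>X s \<omega> * Z \<omega>\<bar> \<partial>M) \<le> (\<integral>\<omega>. ((X s \<omega>)\<^sup>2 + (Z \<omega>)\<^sup>2) / 2 \<partial>M)"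
      by (intro integral_mono integrable_abs int_XZ dom bound)
    also have "\<dots> = (expectation (\<lambda>\<omega>. (X s \<omega>)\<^sup>2) + expectation (\<lambda>\<omega>. (Z \<omega>)\<^sup>2)) / 2"
      using X2 Z2 by simp
    finally show ?thesis using X2(2)[of s] by simp
  qed
  have int: "integrable (lborel \<Otimes>\<^sub>M M) ?f"
  proof (rule Fubini_integrable)
    show "AE s in lborel. integrable M (\<lambda>\<omega>. ?f (s, \<omega>))"
      using int_XZ by (auto intro!: AE_I2 integrable_mult_right)
    let ?C = "(K + expectation (\<lambda>\<omega>. (Z \<omega>)\<^sup>2)) / 2"
    show "integrable lborel (\<lambda>s. \<integral>\<omega>. norm (?f (s, \<omega>)) \<partial>M)"
    proof (rule Bochner_Integration.integrable_bound)
      show "integrable lborel (\<lambda>s. indicator {a..b} s * ?C)"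
        by (intro integrable_mult_left integrable_real_indicator) (auto simp: emeasure_lborel_Icc_eq)
      show "AE s in lborel. norm (\<integral>\<omega>. norm (?f (s, \<omega>)) \<partial>M) \<le> norm (indicator {a..b} s * ?C)"
      proof (rule AE_I2)
        fix s
        have "(\<integral>\<omega>. norm (?f (s, \<omega>)) \<partial>M) = indicator {a..b} s * (\<integral>\<omega>. \<bar>X s \<omega> * Z \<omega>\<bar> \<partial>M)"
          by (simp add: abs_mult)
        also have "\<dots> \<le> indicator {a..b} s * ?C"
          by (intro mult_left_mono abs_le) auto
        finally show "norm (\<integral>\<omega>. norm (?f (s, \<omega>)) \<partial>M) \<le> norm (indicator {a..b} s * ?C)"
          by (simp only: real_norm_def abs_of_nonneg integral_nonneg_AE AE_I2 norm_ge_zero abs_ge_zero)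
      qed
    qed measurable
  qed measurable
  have "expectation (\<lambda>\<omega>. (LINT s:{a..b}|lborel. X s \<omega>) * Z \<omega>) = (\<integral>\<omega>. (\<integral>s. ?f (s, \<omega>) \<partial>lborel) \<partial>M)"
    by (simp add: set_lebesgue_integral_def mult.assoc[symmetric])
  also have "\<dots> = (\<integral>s. (\<integral>\<omega>. ?f (s, \<omega>) \<partial>M) \<partial>lborel)"
    using Fubini_integral[OF int] by simp
  also have "\<dots> = (LINT s:{a..b}|lborel. expectation (\<lambda>\<omega>. X s \<omega> * Z \<omega>))"
    by (simp add: set_lebesgue_integral_def)
  finally show ?thesis .
qed

text \<open>Fubini's theorem yields Lebesgue integrals, while \<open>memory_integral\<close> uses
  gauge integrals; for continuous integrands they agree.\<close>

lemma set_integral_affine: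
  fixes g :: "real \<Rightarrow> real"
  assumes "continuous_on {c..d} g" "c \<le> d"
  shows "(LINT t:{c..d}|lborel. C * g t + D) = C * integral {c..d} g + D * (d - c)"
proof -
  have "(LINT t:{c..d}|lborel. C * g t + D) = integral {c..d} (\<lambda>t. C * g t + D)"
    by (intro set_borel_integral_eq_integral borel_integrable_atLeastAtMost' continuous_intros assms)
  also have "\<dots> = integral {c..d} (\<lambda>t. C * g t) + integral {c..d} (\<lambda>t. D)"
    by (intro Henstock_Kurzweil_Integration.integral_add integrable_continuous_interval continuous_intros assms)
  also have "\<dots> = C * integral {c..d} g + D * (d - c)"
    using assms(2) by simp
  finally show ?thesis .
qed

locale gamma_integrated_supOU = gamma_supOU +
  fixes \<Delta> :: real and V :: "nat \<Rightarrow> 'a \<Rightarrow> real"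
  assumes \<Delta>: "\<Delta> > 0"
    and joint: "(\<lambda>(s, \<omega>). X s \<omega>) \<in> borel_measurable (borel \<Otimes>\<^sub>M M)"
    and V: "\<And>n. n \<ge> 1 \<Longrightarrow> V n \<in> borel_measurable M"
      "\<And>n. n \<ge> 1 \<Longrightarrow> AE \<omega> in M. V n \<omega> = (LINT s:{(real n - 1) * \<Delta>..real n * \<Delta>}|lborel. X s \<omega>)"
    and V2: "\<And>n. n \<ge> 1 \<Longrightarrow> integrable M (\<lambda>\<omega>. (V n \<omega>)\<^sup>2)"
begin

abbreviation X_mean :: real where
  "X_mean \<equiv> levy_mean / (- B * (\<alpha> - 1))"

lemma expectation_V_mult:
  assumes n: "n \<ge> 1" and Z [measurable]: "Z \<in> borel_measurable M" "integrable M (\<lambda>\<omega>. (Z \<omega>)\<^sup>2)"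
  shows "expectation (\<lambda>\<omega>. V n \<omega> * Z \<omega>) =
    (LINT s:{(real n - 1) * \<Delta>..real n * \<Delta>}|lborel. expectation (\<lambda>\<omega>. X s \<omega> * Z \<omega>))"
proof -
  have "expectation (\<lambda>\<omega>. V n \<omega> * Z \<omega>) = expectation (\<lambda>\<omega>. (LINT s:{(real n - 1) * \<Delta>..real n * \<Delta>}|lborel. X s \<omega>) * Z \<omega>)"
  proof (rule integral_cong_AE)
    \<comment> \<open>Joint measurability is given with time as the first coordinate; integrating
      time out calls for the opposite order.\<close>
    have "(\<lambda>(\<omega>, s). indicator {(real n - 1) * \<Delta>..real n * \<Delta>} s *\<^sub>R X s \<omega>) \<in> borel_measurable (M \<Otimes>\<^sub>M lborel)"
    proof -
      have "(\<lambda>x. X (snd x) (fst x)) \<in> borel_measurable (M \<Otimes>\<^sub>M lborel)"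
        using measurable_compose[OF measurable_Pair[OF measurable_snd measurable_fst] joint]
        by (simp cong: measurable_cong_sets sets_pair_measure_cong)
      then show ?thesis by (simp add: case_prod_unfold)
    qed
    then have "(\<lambda>\<omega>. \<integral>s. indicator {(real n - 1) * \<Delta>..real n * \<Delta>} s *\<^sub>R X s \<omega> \<partial>lborel) \<in> borel_measurable M"
      by (rule lborel.borel_measurable_lebesgue_integral)
    then show "(\<lambda>\<omega>. (LINT s:{(real n - 1) * \<Delta>..real n * \<Delta>}|lborel. X s \<omega>) * Z \<omega>) \<in> borel_measurable M"
      unfolding set_lebesgue_integral_def by measurable
  qed (use V[OF n] in auto)
  also have "\<dots> = (LINT s:{(real n - 1) * \<Delta>..real n * \<Delta>}|lborel. expectation (\<lambda>\<omega>. X s \<omega> * Z \<omega>))"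
    by (rule expectation_path_integral_mult[OF joint X_moments(1) eq_refl[OF X_moments(3)] Z])
  finally show ?thesis .
qed

lemma expectation_V: "expectation (V 1) = \<Delta> * X_mean"
  using expectation_V_mult[of 1 "\<lambda>_. 1"] \<Delta>
  by (simp add: X_moments(2) set_lebesgue_integral_def prob_space)

lemma expectation_V_V:
  "expectation (\<lambda>\<omega>. V 1 \<omega> * V (1 + h) \<omega>) =
    levy_variance / (2 * - B * (\<alpha> - 1)) * memory_integral \<Delta> (- B) \<alpha> h + (\<Delta> * X_mean)\<^sup>2"
proof -
  let ?C = "levy_variance / (2 * - B * (\<alpha> - 1))"
  let ?I = "{real h * \<Delta>..real (h + 1) * \<Delta>}"
  let ?k = "\<lambda>s t. (1 + - B * \<bar>t - s\<bar>) powr (1 - \<alpha>)"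
  have B': "- B > 0" using B by simp
  \<comment> \<open>\<open>V (1 + h)\<close> is resolved first, with the square-integrable
    \<open>X s\<close> as the factor; afterwards \<open>V 1\<close> is resolved with
    \<open>V (1 + h)\<close> as the factor.\<close>
  have inner: "expectation (\<lambda>\<omega>. X s \<omega> * V (1 + h) \<omega>) = ?C * integral ?I (?k s) + X_mean\<^sup>2 * \<Delta>" for s
  proof -
    have "expectation (\<lambda>\<omega>. X s \<omega> * V (1 + h) \<omega>) = expectation (\<lambda>\<omega>. V (1 + h) \<omega> * X s \<omega>)"
      by (simp add: mult.commute)
    also have "\<dots> = (LINT t:{(real (1 + h) - 1) * \<Delta>..real (1 + h) * \<Delta>}|lborel. expectation (\<lambda>\<omega>. X t \<omega> * X s \<omega>))"
      by (rule expectation_V_mult) (auto simp: X_moments(1))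
    also have "\<dots> = (LINT t:?I|lborel. ?C * ?k s t + X_mean\<^sup>2)"
    proof -
      have "expectation (\<lambda>\<omega>. X t \<omega> * X s \<omega>) = ?C * ?k s t + X_mean\<^sup>2" for t
        unfolding X_product_moment(2) by (simp add: abs_minus_commute field_simps)
      moreover have "{(real (1 + h) - 1) * \<Delta>..real (1 + h) * \<Delta>} = ?I" by (simp add: add.commute)
      ultimately show ?thesis by (simp only:)
    qed
    also have "\<dots> = ?C * integral ?I (?k s) + X_mean\<^sup>2 * (real (h + 1) * \<Delta> - real h * \<Delta>)"
    proof (rule set_integral_affine)
      show "continuous_on ?I (?k s)"
        by (rule continuous_on_memory_integrand[OF B'])
      show "real h * \<Delta> \<le> real (h + 1) * \<Delta>" using \<Delta> by simp
    qed
    finally show ?thesis by (simp add: algebra_simps)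
  qed
  have "expectation (\<lambda>\<omega>. V 1 \<omega> * V (1 + h) \<omega>) = (LINT s:{(real 1 - 1) * \<Delta>..real 1 * \<Delta>}|lborel. expectation (\<lambda>\<omega>. X s \<omega> * V (1 + h) \<omega>))"
    by (rule expectation_V_mult) (auto intro: V V2)
  also have "\<dots> = (LINT s:{0..\<Delta>}|lborel. ?C * integral ?I (?k s) + X_mean\<^sup>2 * \<Delta>)"
    by (simp only: inner) simp
  also have "\<dots> = ?C * integral {0..\<Delta>} (\<lambda>s. integral ?I (?k s)) + X_mean\<^sup>2 * \<Delta> * (\<Delta> - 0)"
    by (rule set_integral_affine[OF continuous_on_memory_kernel[OF B']]) (use \<Delta> in simp)
  also have "\<dots> = ?C * memory_integral \<Delta> (- B) \<alpha> h + (\<Delta> * X_mean)\<^sup>2"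
    by (simp add: memory_integral_def power2_eq_square)
  finally show ?thesis .
qed

end

section \<open>The parameters of the underlying Levy process\<close>

context levy_setting
begin

lemma measure_unit_strip: "measure control ({..<0} \<times> {0<..1}) = 1"
proof -
  have "emeasure \<pi> {..<0} = 1"
    using AE_pi_negative by (intro mean_reversion.emeasure_eq_1_AE) (auto simp: sets_pi)
  then have "emeasure control ({..<0} \<times> {0<..1}) = 1"
    by (subst lborel.emeasure_pair_measure_Times) (auto simp: sets_pi)
  then show ?thesis by (simp add: measure_def)
qed

text \<open>\<open>L 1\<close> integrates the indicator of a strip of control measure 1. It supplies
  the finite second moment of \<nu> and identifies the true mean and variance with quantities of the
  quadruple.\<close>

lemma underlying_levy_process_moments:
  assumes L: "underlying_levy_process M \<Lambda> \<pi> L" and sq: "square_integrable M (L 1)"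
  shows "integrable \<nu> (\<lambda>x. x\<^sup>2)" "expectation (L 1) = levy_mean" "variance (L 1) = levy_variance"
proof -
  let ?S = "{..<0} \<times> {0<..1::real} :: (real \<times> real) set"
  have S: "?S \<in> sets borel"
    by (subst borel_prod[symmetric]) (intro pair_measureI; simp)
  have L1: "has_levy_integral M \<Lambda> control (indicator ?S) (L 1)"
    using L by (simp add: underlying_levy_process_def)
  have L2: "integrable M (\<lambda>\<omega>. (L 1 \<omega>)\<^sup>2)" and [measurable]: "L 1 \<in> borel_measurable M"
    using sq by (auto simp: square_integrable_def)
  show nu2: "integrable \<nu> (\<lambda>x. x\<^sup>2)"
    by (rule levy_second_moment[OF L1 S measure_unit_strip L2])
  have "?S \<in> sets control"
    by (simp only: sets_control S)
  moreover have "emeasure control ?S \<noteq> \<infinity>"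
    using measure_unit_strip by (auto simp: measure_def)
  ultimately have int: "integrable control (indicator ?S :: _ \<Rightarrow> real)"
    by (simp add: less_top[symmetric])
  have 1: "(\<integral>z. indicator ?S z \<partial>control) = (1::real)"
    using measure_unit_strip by (simp only: Bochner_Integration.integral_indicator space_control Int_UNIV_right)
  have sq_ind: "(\<lambda>z. (indicator ?S z)\<^sup>2) = (indicator ?S :: _ \<Rightarrow> real)"
    by (auto simp: indicator_def)
  note mom = has_levy_integral_moments[OF nu2 L1 int, unfolded sq_ind 1, OF int]
  show mean: "expectation (L 1) = levy_mean"
    using mom(2) by simp
  have "integrable M (L 1)"
    using L2 by (rule square_integrable_imp_integrable[rotated]) simp
  from variance_eq[OF this L2] show "variance (L 1) = levy_variance"
    unfolding mean using mom(3) by simp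
qed

end

section \<open>Zeros of the expected moment vector\<close>

context gamma_integrated_supOU
begin

lemma integrable_V_V:
  assumes "n \<ge> 1" "k \<ge> 1"
  shows "integrable M (\<lambda>\<omega>. V n \<omega> * V k \<omega>)"
proof (rule Bochner_Integration.integrable_bound)
  show "integrable M (\<lambda>\<omega>. ((V n \<omega>)\<^sup>2 + (V k \<omega>)\<^sup>2) / 2)"
    using V2 assms by simp
  show "AE \<omega> in M. norm (V n \<omega> * V k \<omega>) \<le> norm (((V n \<omega>)\<^sup>2 + (V k \<omega>)\<^sup>2) / 2)"
  proof (rule AE_I2)
    fix \<omega>
    show "norm (V n \<omega> * V k \<omega>) \<le> norm (((V n \<omega>)\<^sup>2 + (V k \<omega>)\<^sup>2) / 2)"
      using sum_squares_bound[of "\<bar>V n \<omega>\<bar>" "\<bar>V k \<omega>\<bar>"] by (simp add: abs_mult)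
  qed
qed (use V assms in simp)

text \<open>Primes mark the candidate parameters; the true ones are those of the locale. Every entry
  \<open>k \<ge> 1\<close>, including the variance, is a difference of autocovariances at lag
  \<open>k - 1\<close> plus a difference of squared means.\<close>

lemma expectation_f_V:
  assumes "\<alpha>' > 1" "B' < 0"
  shows "expectation (\<lambda>\<omega>. f_V \<Delta> (\<lambda>n. V n \<omega>) (\<mu>', s2', \<alpha>', B') 0) =
      \<Delta> * X_mean - \<Delta> * (\<mu>' / (- B' * (\<alpha>' - 1)))"
    and "k \<ge> 1 \<Longrightarrow> expectation (\<lambda>\<omega>. f_V \<Delta> (\<lambda>n. V n \<omega>) (\<mu>', s2', \<alpha>', B') k) =
      levy_variance / (2 * - B * (\<alpha> - 1)) * memory_integral \<Delta> (- B) \<alpha> (k - 1)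
      - s2' / (2 * - B' * (\<alpha>' - 1)) * memory_integral \<Delta> (- B') \<alpha>' (k - 1)
      + ((\<Delta> * X_mean)\<^sup>2 - (\<Delta> * (\<mu>' / (- B' * (\<alpha>' - 1))))\<^sup>2)"
proof -
  have mean': "\<Delta> * \<mu>' / (B' * (\<alpha>' - 1)) = - (\<Delta> * (\<mu>' / (- B' * (\<alpha>' - 1))))"
    by simp
  have int: "integrable M (V 1)"
    using V2[of 1] V(1)[of 1] by (auto intro: square_integrable_imp_integrable)
  show "expectation (\<lambda>\<omega>. f_V \<Delta> (\<lambda>n. V n \<omega>) (\<mu>', s2', \<alpha>', B') 0) =
      \<Delta> * X_mean - \<Delta> * (\<mu>' / (- B' * (\<alpha>' - 1)))"
    using int expectation_V unfolding f_V_def f_mean_def split_conv if_True simp_thms mean'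
    by (simp add: prob_space)
  assume k: "k \<ge> 1"
  let ?c = "- s2' / (2 * - B' * (\<alpha>' - 1)) * memory_integral \<Delta> (- B') \<alpha>' (k - 1)"
  have "f_V \<Delta> v (\<mu>', s2', \<alpha>', B') k = v 1 * v (1 + (k - 1)) + (?c - (\<Delta> * (\<mu>' / (- B' * (\<alpha>' - 1))))\<^sup>2)" for v
  proof (cases "k = 1")
    case True
    then show ?thesis
      using cont_ext_var[OF \<Delta> assms(2,1), of s2']
      unfolding f_V_def f_var_def split_conv mean' by (simp add: power2_eq_square)
  next
    case False
    then show ?thesis
      using cont_ext_cov[OF \<Delta> assms(2,1), of "k - 1" s2'] k
      unfolding f_V_def f_cov_def split_conv mean' by simp
  qed
  then have "expectation (\<lambda>\<omega>. f_V \<Delta> (\<lambda>n. V n \<omega>) (\<mu>', s2', \<alpha>', B') k) =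
      expectation (\<lambda>\<omega>. V 1 \<omega> * V (1 + (k - 1)) \<omega> + (?c - (\<Delta> * (\<mu>' / (- B' * (\<alpha>' - 1))))\<^sup>2))"
    by (simp only:)
  also have "\<dots> = expectation (\<lambda>\<omega>. V 1 \<omega> * V (1 + (k - 1)) \<omega>) + (?c - (\<Delta> * (\<mu>' / (- B' * (\<alpha>' - 1))))\<^sup>2)"
    using integrable_V_V[of 1 "1 + (k - 1)"] by (simp add: prob_space)
  finally show "expectation (\<lambda>\<omega>. f_V \<Delta> (\<lambda>n. V n \<omega>) (\<mu>', s2', \<alpha>', B') k) =
      levy_variance / (2 * - B * (\<alpha> - 1)) * memory_integral \<Delta> (- B) \<alpha> (k - 1)
      - s2' / (2 * - B' * (\<alpha>' - 1)) * memory_integral \<Delta> (- B') \<alpha>' (k - 1)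
      + ((\<Delta> * X_mean)\<^sup>2 - (\<Delta> * (\<mu>' / (- B' * (\<alpha>' - 1))))\<^sup>2)"
    unfolding expectation_V_V by simp
qed

lemma expectation_f_V_eq_0_iff:
  assumes "levy_variance > 0" "s2' > 0" "\<alpha>' > 1" "B' < 0"
  shows "(\<forall>k. expectation (\<lambda>\<omega>. f_V \<Delta> (\<lambda>n. V n \<omega>) (\<mu>', s2', \<alpha>', B') k) = 0) \<longleftrightarrow>
    (\<mu>', s2', \<alpha>', B') = (levy_mean, levy_variance, \<alpha>, B)"
proof
  assume zero: "\<forall>k. expectation (\<lambda>\<omega>. f_V \<Delta> (\<lambda>n. V n \<omega>) (\<mu>', s2', \<alpha>', B') k) = 0"
  note E = expectation_f_V[OF assms(3,4), where \<mu>' = \<mu>' and s2' = s2']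
  \<comment> \<open>Entry 0 equates the two means, after which the squared means cancel in all other
    entries.\<close>
  have mean: "X_mean = \<mu>' / (- B' * (\<alpha>' - 1))"
    using zero[rule_format, of 0] \<Delta> unfolding E(1) right_diff_distrib[symmetric] by simp
  have "levy_variance / (2 * - B * (\<alpha> - 1)) * memory_integral \<Delta> (- B) \<alpha> h =
      s2' / (2 * - B' * (\<alpha>' - 1)) * memory_integral \<Delta> (- B') \<alpha>' h" if "h \<ge> 1" for h
    using zero[rule_format, of "h + 1"] E(2)[of "h + 1"] unfolding mean by simp
  from memory_integral_identifies[OF \<Delta> _ _ _ _ _ _ this]
  have eq: "levy_variance = s2'" "- B = - B'" "\<alpha> = \<alpha>'"
    using assms B \<alpha> by auto
  with mean B \<alpha> have "levy_mean = \<mu>'" by simp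
  with eq show "(\<mu>', s2', \<alpha>', B') = (levy_mean, levy_variance, \<alpha>, B)" by simp
next
  assume eq: "(\<mu>', s2', \<alpha>', B') = (levy_mean, levy_variance, \<alpha>, B)"
  show "\<forall>k. expectation (\<lambda>\<omega>. f_V \<Delta> (\<lambda>n. V n \<omega>) (\<mu>', s2', \<alpha>', B') k) = 0"
  proof
    fix k
    show "expectation (\<lambda>\<omega>. f_V \<Delta> (\<lambda>n. V n \<omega>) (\<mu>', s2', \<alpha>', B') k) = 0"
      using expectation_f_V[OF \<alpha> B, where \<mu>' = levy_mean and s2' = levy_variance] eq by (cases "k = 0") auto
  qed
qed

end

theorem proposition3p4:
  fixes M :: "'a measure"
    and \<Lambda> :: "(real \<times> real) set \<Rightarrow> 'a \<Rightarrow> real"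
    and \<gamma> \<Delta> :: real
    and \<nu> \<pi> :: "real measure"
    and L :: "real \<Rightarrow> 'a \<Rightarrow> real"
    and V :: "nat \<Rightarrow> 'a \<Rightarrow> real"
    and W :: "(real \<times> real \<times> real \<times> real) set"
    and \<beta>\<^sub>0 :: "real \<times> real \<times> real \<times> real"
  assumes "\<Delta> > 0"
    and "compact W"
    and "W \<subseteq> {(\<mu>, s2, \<alpha>, B). s2 > 0 \<and> \<alpha> > 1 \<and> B < 0}"
    and "\<beta>\<^sub>0 \<in> W"
    and "integrated_supOU M \<Lambda> \<gamma> \<nu> \<pi> \<Delta> V"
    and "\<forall>n\<ge>1. square_integrable M (V n)"
    and "underlying_levy_process M \<Lambda> \<pi> L"
    and "true_parameter M L \<pi> \<beta>\<^sub>0"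
  shows "asymptotically_identifiable W
           (\<lambda>\<beta> k. prob_space.expectation M (\<lambda>\<omega>. f_V \<Delta> (\<lambda>n. V n \<omega>) \<beta> k)) \<beta>\<^sub>0"
proof -
  obtain \<mu> s2 \<alpha> B where \<beta>\<^sub>0: "\<beta>\<^sub>0 = (\<mu>, s2, \<alpha>, B)"
    by (metis prod_cases4)
  with assms(3,4) have pos: "s2 > 0" "\<alpha> > 1" "B < 0" by auto
  have true: "square_integrable M (L 1)" "prob_space.expectation M (L 1) = \<mu>"
      "prob_space.variance M (L 1) = s2" "\<pi> = mean_reversion_law \<alpha> B"
    using assms(8) by (auto simp: \<beta>\<^sub>0 true_parameter_def)
  obtain X where X: "supOU_process M \<Lambda> \<gamma> 0 \<nu> \<pi> X"
      "(\<lambda>(s, \<omega>). X s \<omega>) \<in> borel_measurable (borel \<Otimes>\<^sub>M M)"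
      "\<forall>n\<ge>1. V n \<in> borel_measurable M \<and>
         (AE \<omega> in M. V n \<omega> = (LINT s:{(real n - 1) * \<Delta>..real n * \<Delta>}|lborel. X s \<omega>))"
    using assms(5) unfolding integrated_supOU_def by blast
  interpret prob_space M
    using X(1) by (simp add: supOU_process_def levy_basis_def)
  interpret levy_setting M \<Lambda> \<gamma> \<nu> \<pi>
    using X(1) by unfold_locales (auto simp: supOU_process_def)
  \<comment> \<open>The second moment of \<nu> required by the next interpretation comes from the
    square integrability of \<open>L 1\<close>.\<close>
  note L = underlying_levy_process_moments[OF assms(7) true(1)]
  interpret gamma_integrated_supOU M \<Lambda> \<gamma> \<nu> \<pi> \<alpha> B X \<Delta> V
    using X assms(1,6) pos true(4) L(1)
    by unfold_locales (auto simp: supOU_process_def square_integrable_def)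
  have \<beta>\<^sub>0': "\<beta>\<^sub>0 = (levy_mean, levy_variance, \<alpha>, B)"
    using true L \<beta>\<^sub>0 by simp
  have iff: "(\<lambda>k. expectation (\<lambda>\<omega>. f_V \<Delta> (\<lambda>n. V n \<omega>) \<beta> k)) = (\<lambda>_. 0) \<longleftrightarrow> \<beta> = \<beta>\<^sub>0" if "\<beta> \<in> W" for \<beta>
  proof -
    obtain \<mu>' s2' \<alpha>' B' where \<beta>: "\<beta> = (\<mu>', s2', \<alpha>', B')"
      by (metis prod_cases4)
    with assms(3) that have "s2' > 0" "\<alpha>' > 1" "B' < 0" by auto
    with expectation_f_V_eq_0_iff[of s2' \<alpha>' B' \<mu>'] pos(1) true(3) L(3) show ?thesis
      by (simp add: \<beta> \<beta>\<^sub>0' fun_eq_iff)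
  qed
  show ?thesis
    unfolding asymptotically_identifiable_def using iff assms(4) by blast
qed

end
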